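(* If $G$ is a minor minimal not $2$-apex (MMN2A) graph with $|E(G)| = 21$ and $|V(G)| \notin \{11,12,13\}$, then $G$ is (isomorphic to) a graph in the Heawood family.
   Context: Graphs are finite and simple. A graph is $2$-apex if it can be made planar by deleting two or fewer vertices (and their incident edges); it is N2A if it is not $2$-apex. A graph is MMN2A if it is N2A but no proper minor of it is N2A. A $\nabla\mathrm{Y}$ move on a graph consists of deleting the three edges of a $3$-cycle $abc$ and adding a new degree three vertex adjacent to $a$, $b$, and $c$. The reverse $\mathrm{Y}\nabla$ move consists of deleting a degree three vertex and adding edges to make its three neighbors mutually adjacent. The Heawood family is the set of graphs (there are $20$ up to isomorphism) obtained from the complete graph $K_7$ by a finite sequence of zero or more $\nabla\mathrm{Y}$ or $\mathrm{Y}\nabla$ moves. *)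

theory Defs
  imports "HOL-Analysis.Analysis"
begin

text \<open>A simple graph is a pair of a vertex set and a set of edges, each edge being a
  two-element set of vertices.\<close>

type_synonym 'a sgraph = "'a set \<times> 'a set set"

abbreviation verts :: "'a sgraph \<Rightarrow> 'a set" where
  "verts \<equiv> fst"

abbreviation edges :: "'a sgraph \<Rightarrow> 'a set set" where
  "edges \<equiv> snd"

definition finite_sgraph :: "'a sgraph \<Rightarrow> bool" where
  "finite_sgraph G \<longleftrightarrow>
     finite (verts G) \<and> (\<forall>e\<in>edges G. e \<subseteq> verts G \<and> card e = 2)"

definition sgraph_iso :: "'a sgraph \<Rightarrow> 'b sgraph \<Rightarrow> bool" where
  "sgraph_iso G H \<longleftrightarrow>
     (\<exists>f. bij_betw f (verts G) (verts H) \<and>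
          (\<forall>u\<in>verts G. \<forall>v\<in>verts G. {u, v} \<in> edges G \<longleftrightarrow> {f u, f v} \<in> edges H))"

definition neighbours :: "'a sgraph \<Rightarrow> 'a \<Rightarrow> 'a set" where
  "neighbours G v = {w. {v, w} \<in> edges G}"

definition del_verts :: "'a sgraph \<Rightarrow> 'a set \<Rightarrow> 'a sgraph" where
  "del_verts G X = (verts G - X, {e \<in> edges G. e \<inter> X = {}})"

definition del_edge :: "'a sgraph \<Rightarrow> 'a set \<Rightarrow> 'a sgraph" where
  "del_edge G e = (verts G, edges G - {e})"

text \<open>Contraction of the edge \<open>{u, v}\<close>: \<open>v\<close> is merged into \<open>u\<close>. The loop at \<open>u\<close> is dropped,
  and parallel edges are identified because edges form a set.\<close>

definition contract :: "'a sgraph \<Rightarrow> 'a \<Rightarrow> 'a \<Rightarrow> 'a sgraph" where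
  "contract G u v =
     (verts G - {v},
      {e \<in> edges G. v \<notin> e} \<union> {{u, w} | w. w \<in> neighbours G v \<and> w \<noteq> u})"

inductive minor_step :: "'a sgraph \<Rightarrow> 'a sgraph \<Rightarrow> bool" where
  del_vert: "v \<in> verts G \<Longrightarrow> minor_step G (del_verts G {v})"
| del_edge: "e \<in> edges G \<Longrightarrow> minor_step G (del_edge G e)"
| contract: "{u, v} \<in> edges G \<Longrightarrow> minor_step G (contract G u v)"

text \<open>Every step removes a vertex or an edge, so the proper minors are exactly the graphs
  reached in one or more steps.\<close>

definition proper_minor :: "'a sgraph \<Rightarrow> 'a sgraph \<Rightarrow> bool" where
  "proper_minor H G \<longleftrightarrow> minor_step\<^sup>+\<^sup>+ G H"

text \<open>Topological planarity, with \<open>\<complex>\<close> as the Euclidean plane: vertices are placed at distinct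
  points and edges are drawn as simple arcs between their end points, passing through no
  other vertex and meeting one another only at common end vertices.\<close>

definition planar :: "'a sgraph \<Rightarrow> bool" where
  "planar G \<longleftrightarrow>
     (\<exists>(p :: 'a \<Rightarrow> complex) (\<gamma> :: 'a set \<Rightarrow> real \<Rightarrow> complex).
        inj_on p (verts G) \<and>
        (\<forall>e\<in>edges G. arc (\<gamma> e) \<and> {pathstart (\<gamma> e), pathfinish (\<gamma> e)} = p ` e \<and>
                     path_image (\<gamma> e) \<inter> p ` verts G = p ` e) \<and>
        (\<forall>e\<in>edges G. \<forall>e'\<in>edges G. e \<noteq> e' \<longrightarrow>
                     path_image (\<gamma> e) \<inter> path_image (\<gamma> e') = p ` (e \<inter> e')))"

definition two_apex :: "'a sgraph \<Rightarrow> bool" where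
  "two_apex G \<longleftrightarrow> (\<exists>X \<subseteq> verts G. finite X \<and> card X \<le> 2 \<and> planar (del_verts G X))"

definition N2A :: "'a sgraph \<Rightarrow> bool" where
  "N2A G \<longleftrightarrow> \<not> two_apex G"

definition MMN2A :: "'a sgraph \<Rightarrow> bool" where
  "MMN2A G \<longleftrightarrow> N2A G \<and> (\<forall>H. proper_minor H G \<longrightarrow> \<not> N2A H)"

inductive nabla_Y :: "'a sgraph \<Rightarrow> 'a sgraph \<Rightarrow> bool" where
  "\<lbrakk>distinct [a, b, c]; {{a, b}, {b, c}, {a, c}} \<subseteq> edges G; v \<notin> verts G\<rbrakk> \<Longrightarrow>
   nabla_Y G (insert v (verts G),
              (edges G - {{a, b}, {b, c}, {a, c}}) \<union> {{v, a}, {v, b}, {v, c}})"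

text \<open>Neighbours of \<open>v\<close> that are already adjacent stay adjacent: no parallel edge arises.\<close>

inductive Y_nabla :: "'a sgraph \<Rightarrow> 'a sgraph \<Rightarrow> bool" where
  "\<lbrakk>v \<in> verts G; distinct [a, b, c]; neighbours G v = {a, b, c}\<rbrakk> \<Longrightarrow>
   Y_nabla G (verts G - {v},
              {e \<in> edges G. v \<notin> e} \<union> {{a, b}, {b, c}, {a, c}})"

definition complete_graph :: "'a set \<Rightarrow> 'a sgraph" where
  "complete_graph V = (V, {e. e \<subseteq> V \<and> card e = 2})"

text \<open>Realised on the vertex type \<open>nat\<close>, which always has a fresh vertex for the
  \<open>nabla_Y\<close> move; membership of a graph on another type is meant up to isomorphism.\<close>

inductive_set heawood_family :: "nat sgraph set" where
  K7: "complete_graph {0..<7} \<in> heawood_family"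
| nabla_Y: "G \<in> heawood_family \<Longrightarrow> nabla_Y G H \<Longrightarrow> H \<in> heawood_family"
| Y_nabla: "G \<in> heawood_family \<Longrightarrow> Y_nabla G H \<Longrightarrow> H \<in> heawood_family"

end

theory Submission
  imports Defs
begin

text \<open>A drawing can be straightened near its vertices, so a region next to an edge \<open>xy\<close> reaches both ends, and a
  homeomorphism supported in this region provides two disjoint arcs from \<open>x\<close> to \<open>y\<close>. Hence a graph is \<open>k\<close>-apex
  if it becomes so by smoothing a vertex of degree two or by removing a vertex of degree at most one.
  So a minor minimal graph has minimum degree at least three, and with 21 edges it has 7 to 14 vertices.

  The graphs that are not \<open>k\<close>-apex are enumerated by removing a vertex of large degree, which leaves a graph that is
  not \<open>(k - 1)\<close>-apex and has few edges. Every way of putting the vertex back gives either a graph that is \<open>k\<close>-apex,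
  certified by an embedding into one fixed plane triangulation, or a graph isomorphic to one on a list.
  The lists for \<open>k = 2\<close> and 21 edges consist of graphs obtained from \<open>K\<^sub>7\<close> by \<open>\<nabla>Y\<close> and \<open>Y\<nabla>\<close> moves.
  No obstruction to planarity is needed, since only the planarity of explicit graphs enters.\<close>

subsection \<open>Drawings in the plane\<close>

text \<open>Eight edges always give a planar graph and fourteen a 1-apex graph, while nine edges
  allow \<open>K_{3,3}\<close> and fifteen the Petersen family. These thresholds keep the
  enumeration short. With 21 edges the largest degree is at least 6 on 8 vertices and at least 5 on
  9 or 10 vertices, so at most 16 edges remain, and removing a second vertex leaves at most 12. On
  14 vertices the graph is cubic; what remains is subcubic with exactly ten vertices of degree
  three, essentially a subdivided Petersen graph. On 11, 12 or 13 vertices only a vertex of degree 4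
  is guaranteed, and up to 17 edges would remain.

  The lower degree bounds that accompany the lists keep \<open>K_5\<close> away: a graph of minimum
  degree two that contains a subdivided \<open>K_5\<close> has at least five more edges than
  vertices, whereas the lists of nonplanar graphs stop at an excess of four. The lists are upper
  bounds: an entry is a case for which no certificate is given, and only the last lists, for 21
  edges, have to be identified, by explicit moves from \<open>K_7\<close>.\<close>

definition drawing :: "'a sgraph \<Rightarrow> ('a \<Rightarrow> complex) \<Rightarrow> ('a set \<Rightarrow> real \<Rightarrow> complex) \<Rightarrow> bool" where
  "drawing G p \<gamma> \<longleftrightarrow>
     inj_on p (verts G) \<and>
     (\<forall>e\<in>edges G. arc (\<gamma> e) \<and> {pathstart (\<gamma> e), pathfinish (\<gamma> e)} = p ` e \<and>
                  path_image (\<gamma> e) \<inter> p ` verts G = p ` e) \<and>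
     (\<forall>e\<in>edges G. \<forall>e'\<in>edges G. e \<noteq> e' \<longrightarrow>
                  path_image (\<gamma> e) \<inter> path_image (\<gamma> e') = p ` (e \<inter> e'))"

lemma planar_iff_drawing: "planar G \<longleftrightarrow> (\<exists>p \<gamma>. drawing G p \<gamma>)"
  unfolding planar_def drawing_def by blast

text \<open>An injective homomorphism is enough: the drawing of \<open>H\<close> is pulled back
  along \<open>f\<close>, and edges of \<open>H\<close> outside the image are dropped. This is what
  lets one fixed host graph certify many planar graphs.\<close>

lemma planar_embed:
  assumes "planar H" "inj_on f (verts G)" "f ` verts G \<subseteq> verts H"
    and "\<And>e. e \<in> edges G \<Longrightarrow> e \<subseteq> verts G \<and> f ` e \<in> edges H"
  shows "planar G"
proof -
  obtain p \<gamma> where d: "drawing H p \<gamma>"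
    using assms(1) by (auto simp: planar_iff_drawing)
  have sub: "e \<subseteq> verts G" and im: "f ` e \<in> edges H" if "e \<in> edges G" for e
    using assms(4) that by auto
  have "drawing G (p \<circ> f) (\<lambda>e. \<gamma> (f ` e))"
    unfolding drawing_def
  proof (intro conjI ballI impI)
    show "inj_on (p \<circ> f) (verts G)"
      using d assms(2,3) by (auto simp: drawing_def intro: comp_inj_on inj_on_subset)
  next
    fix e assume e: "e \<in> edges G"
    show "arc (\<gamma> (f ` e))" "{pathstart (\<gamma> (f ` e)), pathfinish (\<gamma> (f ` e))} = (p \<circ> f) ` e"
      using d im[OF e] by (auto simp: drawing_def image_comp)
    have "path_image (\<gamma> (f ` e)) \<inter> p ` verts H = p ` f ` e"
      using d im[OF e] by (auto simp: drawing_def)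
    moreover have "(p \<circ> f) ` verts G \<subseteq> p ` verts H" "(p \<circ> f) ` e \<subseteq> (p \<circ> f) ` verts G" "p ` f ` e = (p \<circ> f) ` e"
      using sub[OF e] assms(3) by auto
    moreover have "P \<inter> A = B" if "P \<inter> V = B" "A \<subseteq> V" "B \<subseteq> A" for P A B V :: "complex set"
      using that by blast
    ultimately show "path_image (\<gamma> (f ` e)) \<inter> (p \<circ> f) ` verts G = (p \<circ> f) ` e"
      by metis
  next
    fix e e' assume e: "e \<in> edges G" "e' \<in> edges G" "e \<noteq> e'"
    then have "f ` e \<noteq> f ` e'"
      using sub inj_on_image_eq_iff[OF assms(2)] by metis
    then have "path_image (\<gamma> (f ` e)) \<inter> path_image (\<gamma> (f ` e')) = p ` (f ` e \<inter> f ` e')"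
      using d e im by (auto simp: drawing_def)
    also have "f ` e \<inter> f ` e' = f ` (e \<inter> e')"
      using e sub by (intro inj_on_image_Int[OF assms(2), symmetric]) auto
    finally show "path_image (\<gamma> (f ` e)) \<inter> path_image (\<gamma> (f ` e')) = (p \<circ> f) ` (e \<inter> e')"
      by (simp add: image_comp)
  qed
  then show ?thesis by (auto simp: planar_iff_drawing)
qed

lemma planar_subgraph:
  assumes "planar H" "verts G \<subseteq> verts H" "edges G \<subseteq> edges H" "\<And>e. e \<in> edges G \<Longrightarrow> e \<subseteq> verts G"
  shows "planar G"
  by (rule planar_embed[OF assms(1), of id]) (use assms in auto)

section \<open>Straightening arcs near their ends\<close>

lemma closed_segment_same_length:
  fixes a q q' z :: "'a::real_normed_vector"
  assumes "z \<in> closed_segment a q" "z \<in> closed_segment a q'" "z \<noteq> a" "dist a q = dist a q'"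
  shows "q = q'"
proof -
  obtain u where u: "0 \<le> u" "z = a + u *\<^sub>R (q - a)"
    using assms(1) by (auto simp: closed_segment_def algebra_simps)
  obtain u' where u': "0 \<le> u'" "z = a + u' *\<^sub>R (q' - a)"
    using assms(2) by (auto simp: closed_segment_def algebra_simps)
  have "norm (u *\<^sub>R (q - a)) = norm (u' *\<^sub>R (q' - a))"
    using u(2) u'(2) by simp
  then have "u * dist a q = u' * dist a q"
    using u(1) u'(1) assms(4) by (simp add: dist_norm norm_minus_commute)
  moreover have "dist a q \<noteq> 0" "u \<noteq> 0"
    using u assms(3) by auto
  ultimately have "u = u'" by simp
  with u u' \<open>u \<noteq> 0\<close> show ?thesis by simp
qed

text \<open>The arc is cut at its last exit from the ball at \<open>a\<close> and at its first later
  entry into the ball at \<open>b\<close>, and both ends are replaced by radii. The points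
  \<open>qa\<close> and \<open>qb\<close> stay on the old arc, so that arcs which do not meet there
  receive different radii.\<close>

lemma arc_radial_ends:
  fixes g :: "real \<Rightarrow> 'a::euclidean_space"
  assumes g: "arc g" and ab: "pathstart g = a" "pathfinish g = b"
    and r: "0 < r" "cball a r \<inter> cball b r = {}"
  obtains g' qa qb where "arc g'" "pathstart g' = a" "pathfinish g' = b"
    "dist a qa = r" "dist b qb = r" "qa \<in> path_image g" "qb \<in> path_image g"
    "path_image g' \<inter> cball a r = closed_segment a qa"
    "path_image g' \<inter> cball b r = closed_segment b qb"
    "path_image g' \<subseteq> path_image g \<union> cball a r \<union> cball b r"
proof -
  have pg: "path g" using g arc_imp_path by blast
  have cont: "continuous_on {0..1} g" using pg by (simp add: path_def)
  have g01: "g 0 = a" "g 1 = b" using ab by (auto simp: pathstart_def pathfinish_def)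
  have inj: "inj_on g {0..1}" using g by (simp add: arc_def)
  have b_out: "b \<notin> cball a r" using r by force
  have cont_sub: "continuous_on {s..t} g" if "0 \<le> s" "t \<le> 1" for s t
    using cont by (rule continuous_on_subset) (use that in auto)
  define S where "S = {0..1} \<inter> g -` cball a r"
  have "closed S" unfolding S_def
    by (rule continuous_closed_preimage[OF cont]) auto
  then have "compact ({0..1} \<inter> S)" by (intro compact_Int_closed) auto
  then have "compact S" by (simp add: S_def)
  moreover have "0 \<in> S" using r g01 by (auto simp: S_def)
  ultimately obtain t0 where t0: "t0 \<in> S" "\<And>t. t \<in> S \<Longrightarrow> t \<le> t0"
    using compact_attains_sup[of S] by blast
  have t0': "0 \<le> t0" "t0 < 1" "dist a (g t0) \<le> r"
    using t0(1) b_out g01 by (auto simp: S_def less_le)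
  \<comment> \<open>The last time in the ball is a time on the sphere: \<open>b\<close> lies
    outside, so the intermediate value theorem gives a time on the sphere at or after
    \<open>t0\<close>, and no later time belongs to \<open>S\<close>.\<close>
  have "\<exists>t\<ge>t0. t \<le> 1 \<and> dist a (g t) = r"
    by (rule IVT') (use t0' b_out g01 in \<open>auto intro!: continuous_intros cont_sub\<close>)
  then obtain t where t: "t0 \<le> t" "t \<le> 1" "dist a (g t) = r" by blast
  then have "t \<in> S" using t0' by (simp add: S_def)
  then have d0: "dist a (g t0) = r"
    using t0(2) t by (metis order_antisym)
  \<comment> \<open>Only times from \<open>t0\<close> on count, so that the entry at
    \<open>b\<close> follows the exit at \<open>a\<close>.\<close>
  define T where "T = {t0..1} \<inter> g -` cball b r"
  have "closed T" unfolding T_def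
    by (rule continuous_closed_preimage[OF cont_sub]) (use t0' in auto)
  then have "compact ({t0..1} \<inter> T)" by (intro compact_Int_closed) auto
  then have "compact T" by (simp add: T_def)
  moreover have "1 \<in> T" using r g01 t0' by (auto simp: T_def)
  ultimately obtain t1 where t1: "t1 \<in> T" "\<And>t. t \<in> T \<Longrightarrow> t1 \<le> t"
    using compact_attains_inf[of T] by blast
  have "g t0 \<notin> cball b r" using r d0 by force
  then have t1': "t0 < t1" "t1 \<le> 1" "dist b (g t1) \<le> r"
    using t1(1) by (auto simp: T_def less_le)
  have "\<exists>t\<ge>t0. t \<le> t1 \<and> dist b (g t) = r"
    by (rule IVT2') (use t0' t1' \<open>g t0 \<notin> cball b r\<close> in \<open>auto intro!: continuous_intros cont_sub\<close>)
  then obtain t where t: "t0 \<le> t" "t \<le> t1" "dist b (g t) = r" by blast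
  then have "t \<in> T" using t1' by (simp add: T_def)
  then have d1: "dist b (g t1) = r"
    using t1(2) t by (metis order_antisym)
  define mid where "mid = subpath t0 t1 g"
  have mid_arc: "arc mid" unfolding mid_def
    by (rule arc_subpath_arc[OF g]) (use t0' t1' in auto)
  have mid_ends: "pathstart mid = g t0" "pathfinish mid = g t1" by (auto simp: mid_def)
  have mid_im: "path_image mid = g ` {t0..t1}"
    using t1' by (simp add: mid_def path_image_subpath)
  have mid_a: "path_image mid \<inter> cball a r = {g t0}"
  proof -
    have "t = t0" if "t \<in> {t0..t1}" "g t \<in> cball a r" for t
      using t0(2)[of t] that t0' t1' by (auto simp: S_def)
    moreover have "t0 \<in> {t0..t1}" "g t0 \<in> cball a r" using t1' d0 by auto
    ultimately show ?thesis unfolding mid_im by blast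
  qed
  have mid_b: "path_image mid \<inter> cball b r = {g t1}"
  proof -
    have "t = t1" if "t \<in> {t0..t1}" "g t \<in> cball b r" for t
      using t1(2)[of t] that t0' t1' by (auto simp: T_def)
    moreover have "t1 \<in> {t0..t1}" "g t1 \<in> cball b r" using t1' d1 by auto
    ultimately show ?thesis unfolding mid_im by blast
  qed
  have segs: "closed_segment a (g t0) \<subseteq> cball a r" "closed_segment (g t1) b \<subseteq> cball b r"
    by (rule closed_segment_subset; use d0 d1 r in simp)+
  define g2 where "g2 = mid +++ linepath (g t1) b"
  define g' where "g' = linepath a (g t0) +++ g2"
  have arc2: "arc g2" unfolding g2_def
    using mid_arc mid_ends mid_b segs d1 r by (intro arc_join) auto
  have im2: "path_image g2 = path_image mid \<union> closed_segment (g t1) b"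
    unfolding g2_def using mid_ends by (simp add: path_image_join)
  have st2: "pathstart g2 = g t0" "pathfinish g2 = b" by (auto simp: g2_def mid_ends)
  have "arc g'" unfolding g'_def
    using arc2 st2 im2 mid_a segs d0 r by (intro arc_join) auto
  moreover have union_cap: "(S \<union> M \<union> T) \<inter> C = S" if "S \<subseteq> C" "M \<inter> C = {x}" "x \<in> S" "T \<inter> C = {}" for S M T C :: "'a set" and x
    using that by auto
  have im': "path_image g' = closed_segment a (g t0) \<union> path_image mid \<union> closed_segment (g t1) b"
    unfolding g'_def using st2 by (auto simp: path_image_join im2)
  have "path_image g' \<inter> cball a r = closed_segment a (g t0)"
  proof -
    have "g t0 \<in> closed_segment a (g t0)" "closed_segment (g t1) b \<inter> cball a r = {}"
      using segs r(2) by auto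
    then show ?thesis unfolding im' by (intro union_cap[OF segs(1) mid_a]) auto
  qed
  moreover have "path_image g' \<inter> cball b r = closed_segment b (g t1)"
  proof -
    have "g t1 \<in> closed_segment (g t1) b" "closed_segment a (g t0) \<inter> cball b r = {}"
      using segs r(2) by auto
    then have "(closed_segment (g t1) b \<union> path_image mid \<union> closed_segment a (g t0)) \<inter> cball b r = closed_segment (g t1) b"
      by (intro union_cap[OF segs(2) mid_b]) auto
    then show ?thesis unfolding im' by (simp add: Un_ac closed_segment_commute[of b])
  qed
  moreover have "path_image mid \<subseteq> path_image g"
    unfolding mid_im using t0' t1' by (auto simp: path_image_def[of g])
  moreover have "g t0 \<in> path_image g" "g t1 \<in> path_image g"
    unfolding path_image_def using t0' t1' by auto
  moreover have "path_image g' \<subseteq> path_image g \<union> cball a r \<union> cball b r"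
    unfolding im' using segs \<open>path_image mid \<subseteq> path_image g\<close> by blast
  ultimately show ?thesis
    using that[of g' "g t0" "g t1"] d0 d1 st2 by (auto simp: g'_def)
qed

section \<open>Two disjoint arcs in a region of the plane\<close>

lemma first_hit:
  fixes b z :: "'a::euclidean_space"
  assumes "closed C" "z \<in> C"
  obtains s where "s \<in> closed_segment b z" "s \<in> C" "closed_segment b s \<inter> C = {s}"
proof -
  have "closed (closed_segment b z \<inter> C)" "closed_segment b z \<inter> C \<noteq> {}"
    using assms by auto
  then obtain s where s: "s \<in> closed_segment b z \<inter> C" "\<And>y. y \<in> closed_segment b z \<inter> C \<Longrightarrow> dist b s \<le> dist b y"
    using distance_attains_inf by metis
  have "y = s" if y: "y \<in> closed_segment b s" "y \<in> C" for y
  proof -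
    have "y \<in> closed_segment b z"
      using y(1) s(1) by (meson IntD1 ends_in_segment(1) subsetD subset_closed_segment)
    then have "dist b s \<le> dist b y" using s y by auto
    moreover have "dist b y + dist y s = dist b s"
      using y(1) by (simp add: between_mem_segment[symmetric] between)
    ultimately have "dist y s \<le> 0" by linarith
    then show ?thesis by simp
  qed
  moreover have "s \<in> closed_segment b s" by simp
  ultimately have "closed_segment b s \<inter> C = {s}" using s(1) by blast
  then show ?thesis using s(1) by (intro that[of s]) auto
qed

text \<open>A homeomorphism supported in \<open>W\<close> that moves \<open>w1\<close>, \<open>w2\<close> to \<open>z1\<close>, \<open>z2\<close> turns the triangle \<open>a w1 w2\<close> into a
  closed curve that is met by both segments from \<open>b\<close>; its two arcs from \<open>a\<close> to the first hits are disjoint.\<close>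

lemma two_arcs_in_region:
  fixes a b :: complex
  assumes W: "open W" "connected W" "a \<notin> W" "b \<notin> W" "a \<noteq> b"
    and w: "closed_segment a w1 \<subseteq> insert a W" "closed_segment a w2 \<subseteq> insert a W"
           "closed_segment w1 w2 \<subseteq> W" "\<not> collinear {a, w1, w2}"
    and z: "closed_segment b z1 \<subseteq> insert b W" "closed_segment b z2 \<subseteq> insert b W"
           "\<not> collinear {b, z1, z2}"
  obtains \<alpha> \<beta> where "arc \<alpha>" "pathstart \<alpha> = a" "pathfinish \<alpha> = b"
    "arc \<beta>" "pathstart \<beta> = a" "pathfinish \<beta> = b"
    "path_image \<alpha> \<subseteq> W \<union> {a, b}" "path_image \<beta> \<subseteq> W \<union> {a, b}"
    "path_image \<alpha> \<inter> path_image \<beta> = {a, b}"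
proof -
  note result = that
  have ne: "w1 \<noteq> w2" "a \<noteq> w1" "a \<noteq> w2" "z1 \<noteq> z2" "b \<noteq> z1" "b \<noteq> z2"
    using w(4) z(3) by (auto simp: insert_commute)
  have inW: "w1 \<in> W" "w2 \<in> W" "z1 \<in> W" "z2 \<in> W"
    using subsetD[OF w(1), of w1] subsetD[OF w(2), of w2] subsetD[OF z(1), of z1] subsetD[OF z(2), of z2] ne by simp_all
  define x y where "x = (\<lambda>i::bool. if i then w1 else w2)" and "y = (\<lambda>i::bool. if i then z1 else z2)"
  have aff: "affine hull W = UNIV" using W(1) inW(1) affine_hull_open by blast
  obtain h h' where h: "homeomorphism UNIV UNIV h h'" "\<And>i. i \<in> UNIV \<Longrightarrow> h (x i) = y i"
      "{x. \<not> (h x = x \<and> h' x = x)} \<subseteq> W"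
    by (rule homeomorphism_moving_points_exists[of W UNIV UNIV x y])
       (use W inW ne aff in \<open>auto simp: x_def y_def pairwise_def split: if_splits\<close>)
  have hw: "h w1 = z1" "h w2 = z2" using h(2)[of True] h(2)[of False] by (auto simp: x_def y_def)
  have hfix: "h u = u" "h' u = u" if "u \<notin> W" for u using h(3) that by auto
  have hh: "h' (h u) = u" for u using h(1) by (auto simp: homeomorphism_def)
  have hW: "h u \<in> W" if "u \<in> W" for u using hfix(2) hh that by metis
  have hcont: "continuous_on T h" for T
    using h(1) by (auto simp: homeomorphism_def intro: continuous_on_subset)
  have hinj: "inj_on h T" for T by (metis hh inj_onI)
  \<comment> \<open>The triangle is traversed from \<open>a\<close>, so that its image
    \<open>c\<close> starts and ends at \<open>a\<close>, which is fixed because it lies outside the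
    support \<open>W\<close>.\<close>
  define c1 where "c1 = linepath a w1 +++ linepath w1 w2"
  define c0 where "c0 = c1 +++ linepath w2 a"
  have coll: "\<not> collinear {w1, w2, a}" "\<not> collinear {w2, a, w1}"
    using w(4) by (auto simp: insert_commute)
  have arc1: "arc c1" unfolding c1_def
    using ne w(4) by (intro arc_join) (auto simp: Int_closed_segment)
  have im1: "path_image c1 = closed_segment a w1 \<union> closed_segment w1 w2"
    by (simp add: c1_def path_image_join)
  have "simple_path c0" unfolding c0_def
  proof (rule simple_path_join_loop)
    have "closed_segment w1 w2 \<inter> closed_segment w2 a = {w2}" "closed_segment w2 a \<inter> closed_segment a w1 = {a}"
      using Int_closed_segment[of w2 w1 a] Int_closed_segment[of a w2 w1] coll by auto
    then have "path_image c1 \<inter> closed_segment w2 a \<subseteq> {a, w2}"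
      unfolding im1 by blast
    then show "path_image c1 \<inter> path_image (linepath w2 a) \<subseteq> {pathstart c1, pathstart (linepath w2 a)}"
      by (simp add: c1_def)
  qed (use arc1 ne in \<open>auto simp: c1_def\<close>)
  define c where "c = h \<circ> c0"
  have c: "simple_path c" unfolding c_def
    by (rule simple_path_continuous_image[OF \<open>simple_path c0\<close> hcont hinj])
  have im0: "path_image c0 = closed_segment a w1 \<union> closed_segment w1 w2 \<union> closed_segment w2 a"
    unfolding c0_def by (simp add: path_image_join im1 c1_def)
  have imc: "path_image c = h ` path_image c0" by (simp add: c_def path_image_compose)
  have c_sub: "path_image c \<subseteq> insert a W"
    unfolding imc im0 using w hW hfix(1)[OF W(3)] by (auto simp: closed_segment_commute)
  have zc: "z1 \<in> path_image c" "z2 \<in> path_image c"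
    unfolding imc im0 using hw by (auto intro!: image_eqI[of _ h] )
  have c01: "c 0 = a" "c 1 = a"
  proof -
    have "pathstart c0 = a" "pathfinish c0 = a" by (auto simp: c0_def c1_def)
    then show "c 0 = a" "c 1 = a" using hfix(1)[OF W(3)] by (auto simp: c_def pathstart_def pathfinish_def)
  qed
  have clc: "closed (path_image c)" using c by (simp add: closed_path_image simple_path_imp_path)
  \<comment> \<open>The point \<open>z1\<close> lies on \<open>c\<close>, so the segment from
    \<open>b\<close> has to hit \<open>c\<close>, and what precedes the first hit is free of
    \<open>c\<close>.\<close>
  obtain s1 where s1: "s1 \<in> closed_segment b z1" "s1 \<in> path_image c" "closed_segment b s1 \<inter> path_image c = {s1}"
    using first_hit[OF clc zc(1)] by blast
  obtain s2 where s2: "s2 \<in> closed_segment b z2" "s2 \<in> path_image c" "closed_segment b s2 \<inter> path_image c = {s2}"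
    using first_hit[OF clc zc(2)] by blast
  have seg: "closed_segment b s1 \<subseteq> closed_segment b z1" "closed_segment b s2 \<subseteq> closed_segment b z2"
    using s1(1) s2(1) by (simp_all add: subset_closed_segment)
  have "closed_segment b z1 \<inter> closed_segment b z2 = {b}"
    using Int_closed_segment[of b z1 z2] z(3) by (simp add: closed_segment_commute insert_commute)
  then have disj: "closed_segment b s1 \<inter> closed_segment b s2 = {b}"
    using seg by auto
  have b_out: "b \<notin> path_image c" using c_sub W by auto
  have s_ne: "s1 \<noteq> b" "s2 \<noteq> b" "s1 \<noteq> a" "s2 \<noteq> a" using s1 s2 b_out z W by auto
  have "s1 \<noteq> s2" using disj s_ne by auto
  have disjnt: "X \<inter> L = {}" if "X \<subseteq> C" "L \<inter> C = {u}" "u \<notin> X" for X L C :: "complex set" and u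
    using that by auto
  have Int_union: "(X \<union> L) \<inter> (Y \<union> M) \<subseteq> {u, v}"
    if "X \<inter> Y = {u}" "X \<inter> M = {}" "Y \<inter> L = {}" "L \<inter> M = {v}" for X Y L M :: "complex set" and u v
    using that by auto
  \<comment> \<open>The two hits are interchangeable, so let \<open>s\<close> come first along
    \<open>c\<close>. \<open>A\<close> runs forward from \<open>a\<close> to \<open>s\<close>, and
    \<open>B\<close> backward from the end of \<open>c\<close> to \<open>s'\<close>; since
    \<open>\<tau> < \<tau>'\<close> they share only \<open>a\<close>.\<close>
  have main: thesis
    if t: "c \<tau> = s" "c \<tau>' = s'" "0 \<le> \<tau>" "\<tau> < \<tau>'" "\<tau>' \<le> 1"
      and s: "closed_segment b s \<inter> path_image c = {s}" "closed_segment b s' \<inter> path_image c = {s'}"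
        "closed_segment b s \<inter> closed_segment b s' = {b}" "s \<noteq> a" "s' \<noteq> a" "s \<noteq> b" "s' \<noteq> b"
        "closed_segment b s \<subseteq> insert b W" "closed_segment b s' \<subseteq> insert b W" for \<tau> \<tau>' s s'
  proof -
    define A where "A = subpath 0 \<tau> c"
    define B where "B = subpath 1 \<tau>' c"
    have arcs: "arc A" "arc B"
      unfolding A_def B_def using t c01 s by (auto intro!: arc_simple_path_subpath[OF c])
    have imA: "path_image A = c ` {0..\<tau>}" and imB: "path_image B = c ` {\<tau>'..1}"
      unfolding A_def B_def using t by (auto simp: path_image_subpath)
    have AB: "path_image A \<subseteq> path_image c" "path_image B \<subseteq> path_image c"
      unfolding imA imB using t by (auto simp: path_image_def)
    have ends: "pathstart A = a" "pathfinish A = s" "pathstart B = a" "pathfinish B = s'"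
      unfolding A_def B_def using t c01 by auto
    have cinj: "u = v \<or> u = 0 \<and> v = 1 \<or> u = 1 \<and> v = 0" if "c u = c v" "u \<in> {0..1}" "v \<in> {0..1}" for u v
      using c that unfolding simple_path_def loop_free_def by blast
    have ABint: "path_image A \<inter> path_image B = {a}"
    proof
      show "path_image A \<inter> path_image B \<subseteq> {a}"
      proof
        fix u assume "u \<in> path_image A \<inter> path_image B"
        then obtain i j where ij: "u = c i" "u = c j" "i \<in> {0..\<tau>}" "j \<in> {\<tau>'..1}"
          unfolding imA imB by blast
        then have "i = 0 \<and> j = 1"
          using cinj[of i j] t by auto
        with ij c01 show "u \<in> {a}" by simp
      qed
      show "{a} \<subseteq> path_image A \<inter> path_image B"
        using ends pathstart_in_path_image by (metis IntI empty_subsetI insert_subset)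
    qed
    have sA: "s' \<notin> path_image A" and sB: "s \<notin> path_image B"
      using ABint s ends pathfinish_in_path_image by (metis IntI singletonD)+
    define \<alpha> where "\<alpha> = A +++ linepath s b"
    define \<beta> where "\<beta> = B +++ linepath s' b"
    have im: "path_image \<alpha> = path_image A \<union> closed_segment b s" "path_image \<beta> = path_image B \<union> closed_segment b s'"
      unfolding \<alpha>_def \<beta>_def using ends by (auto simp: path_image_join closed_segment_commute)
    have "arc \<alpha>" unfolding \<alpha>_def
      using arcs ends AB s by (intro arc_join) (auto simp: closed_segment_commute)
    moreover have "arc \<beta>" unfolding \<beta>_def
      using arcs ends AB s by (intro arc_join) (auto simp: closed_segment_commute)
    moreover have "path_image \<alpha> \<subseteq> W \<union> {a, b}" "path_image \<beta> \<subseteq> W \<union> {a, b}"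
      unfolding im using AB c_sub s by auto
    moreover have "path_image \<alpha> \<inter> path_image \<beta> = {a, b}"
    proof
      have "path_image A \<inter> closed_segment b s' = {}" "path_image B \<inter> closed_segment b s = {}"
        by (rule disjnt[OF AB(1) s(2) sA], rule disjnt[OF AB(2) s(1) sB])
      then show "path_image \<alpha> \<inter> path_image \<beta> \<subseteq> {a, b}"
        unfolding im by (intro Int_union[OF ABint _ _ s(3)])
      show "{a, b} \<subseteq> path_image \<alpha> \<inter> path_image \<beta>"
        unfolding im using ABint by auto
    qed
    ultimately show thesis
      by (intro result[of \<alpha> \<beta>]) (auto simp: \<alpha>_def \<beta>_def ends)
  qed
  obtain \<tau>1 \<tau>2 where \<tau>: "c \<tau>1 = s1" "c \<tau>2 = s2" "\<tau>1 \<in> {0..1}" "\<tau>2 \<in> {0..1}"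
    using s1(2) s2(2) by (auto simp: path_image_def)
  have segW: "closed_segment b s1 \<subseteq> insert b W" "closed_segment b s2 \<subseteq> insert b W"
    using seg z by auto
  consider "\<tau>1 < \<tau>2" | "\<tau>2 < \<tau>1" using \<tau> \<open>s1 \<noteq> s2\<close> by fastforce
  then show thesis
  proof cases
    case 1 then show ?thesis using main[of \<tau>1 s1 \<tau>2 s2] \<tau> s1 s2 s_ne disj segW by auto
  next
    case 2 then show ?thesis using main[of \<tau>2 s2 \<tau>1 s1] \<tau> s1 s2 s_ne disj segW by (auto simp: Int_commute)
  qed
qed

section \<open>Drawings whose edges are radial at the vertices\<close>

lemma finite_sgraph_edgesD:
  assumes "finite_sgraph G"
  shows "finite (verts G)" "finite (edges G)" "e \<in> edges G \<Longrightarrow> e \<subseteq> verts G" "e \<in> edges G \<Longrightarrow> card e = 2"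
proof -
  have "edges G \<subseteq> Pow (verts G)" using assms by (auto simp: finite_sgraph_def)
  then show "finite (edges G)" using assms by (auto simp: finite_sgraph_def intro: finite_subset)
qed (use assms in \<open>auto simp: finite_sgraph_def\<close>)

lemma drawingD:
  assumes "drawing G p \<gamma>"
  shows "inj_on p (verts G)"
    and "e \<in> edges G \<Longrightarrow> arc (\<gamma> e)"
    and "e \<in> edges G \<Longrightarrow> {pathstart (\<gamma> e), pathfinish (\<gamma> e)} = p ` e"
    and "e \<in> edges G \<Longrightarrow> path_image (\<gamma> e) \<inter> p ` verts G = p ` e"
    and "e \<in> edges G \<Longrightarrow> e' \<in> edges G \<Longrightarrow> e \<noteq> e' \<Longrightarrow> path_image (\<gamma> e) \<inter> path_image (\<gamma> e') = p ` (e \<inter> e')"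
  using assms by (auto simp: drawing_def)

text \<open>Every vertex has a positive distance from the other vertices and from the edges that
  avoid it, and finiteness gives a common bound.\<close>

lemma drawing_radius:
  assumes G: "finite_sgraph G" and d: "drawing G p \<gamma>"
  obtains r where "0 < r"
    "\<And>x y. x \<in> verts G \<Longrightarrow> y \<in> verts G \<Longrightarrow> x \<noteq> y \<Longrightarrow> cball (p x) r \<inter> cball (p y) r = {}"
    "\<And>x e. x \<in> verts G \<Longrightarrow> e \<in> edges G \<Longrightarrow> x \<notin> e \<Longrightarrow> path_image (\<gamma> e) \<inter> cball (p x) r = {}"
proof -
  note fin = finite_sgraph_edgesD[OF G] and dr = drawingD[OF d]
  define K where "K x = p ` (verts G - {x}) \<union> (\<Union>e\<in>{e \<in> edges G. x \<notin> e}. path_image (\<gamma> e))" for x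
  have "\<exists>\<delta>>0. \<forall>z\<in>K x. \<delta> \<le> dist (p x) z" if x: "x \<in> verts G" for x
  proof (rule separate_point_closed)
    show "closed (K x)"
      unfolding K_def using fin(1,2) dr(2)
      by (intro closed_Un closed_UN finite_imp_closed) (auto intro: closed_path_image arc_imp_path)
    show "p x \<notin> K x"
    proof
      assume "p x \<in> K x"
      then consider y where "y \<in> verts G" "y \<noteq> x" "p x = p y" | e where "e \<in> edges G" "x \<notin> e" "p x \<in> path_image (\<gamma> e)"
        unfolding K_def by auto
      then show False
      proof cases
        case 1 then show ?thesis using dr(1) x by (auto dest: inj_onD)
      next
        case (2 e)
        then have "p x \<in> p ` e" using dr(4)[of e] x by blast
        then show ?thesis using 2 fin(3)[of e] dr(1) x by (auto dest: inj_onD)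
      qed
    qed
  qed
  then obtain \<delta> where \<delta>: "\<And>x. x \<in> verts G \<Longrightarrow> 0 < \<delta> x" "\<And>x z. x \<in> verts G \<Longrightarrow> z \<in> K x \<Longrightarrow> \<delta> x \<le> dist (p x) z"
    by metis
  \<comment> \<open>The element 1 serves the graph without vertices; a third of the distance makes
    two closed balls disjoint.\<close>
  define r where "r = Min (insert 1 (\<delta> ` verts G)) / 3"
  have r: "3 * r \<le> \<delta> x" if "x \<in> verts G" for x
    unfolding r_def using that fin(1) by (auto intro: Min_le)
  have r0: "0 < r" unfolding r_def using \<delta>(1) fin(1) by auto
  show thesis
  proof (rule that[OF r0])
    fix x y assume xy: "x \<in> verts G" "y \<in> verts G" "x \<noteq> y"
    then have "p y \<in> K x" by (auto simp: K_def)
    then have "3 * r \<le> dist (p x) (p y)" using \<delta>(2)[OF xy(1)] r[OF xy(1)] by force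
    then show "cball (p x) r \<inter> cball (p y) r = {}"
      using r0 by (intro disjoint_cballI) auto
  next
    fix x e assume xe: "x \<in> verts G" "e \<in> edges G" "x \<notin> e"
    have "r < dist (p x) z" if "z \<in> path_image (\<gamma> e)" for z
    proof -
      have "z \<in> K x" using that xe by (auto simp: K_def)
      then have "3 * r \<le> dist (p x) z" using \<delta>(2)[OF xe(1)] r[OF xe(1)] by force
      then show ?thesis using r0 by auto
    qed
    then show "path_image (\<gamma> e) \<inter> cball (p x) r = {}" by force
  qed
qed

text \<open>All edges are straightened at once. Outside the balls nothing new is drawn, and inside a
  ball the edges at its centre become radii through points of the old edges, which differ from edge
  to edge.\<close>

lemma drawing_radial:
  assumes G: "finite_sgraph G" and d: "drawing G p \<gamma>"
  obtains r \<gamma>' where "0 < r" "drawing G p \<gamma>'"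
    "\<And>x y. x \<in> verts G \<Longrightarrow> y \<in> verts G \<Longrightarrow> x \<noteq> y \<Longrightarrow> cball (p x) r \<inter> cball (p y) r = {}"
    "\<And>x e. x \<in> verts G \<Longrightarrow> e \<in> edges G \<Longrightarrow> x \<notin> e \<Longrightarrow> path_image (\<gamma>' e) \<inter> cball (p x) r = {}"
    "\<And>x e. e \<in> edges G \<Longrightarrow> x \<in> e \<Longrightarrow>
       \<exists>q. dist (p x) q = r \<and> path_image (\<gamma>' e) \<inter> cball (p x) r = closed_segment (p x) q"
proof -
  note fin = finite_sgraph_edgesD[OF G] and dr = drawingD[OF d]
  obtain r where r: "0 < r"
    "\<And>x y. x \<in> verts G \<Longrightarrow> y \<in> verts G \<Longrightarrow> x \<noteq> y \<Longrightarrow> cball (p x) r \<inter> cball (p y) r = {}"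
    "\<And>x e. x \<in> verts G \<Longrightarrow> e \<in> edges G \<Longrightarrow> x \<notin> e \<Longrightarrow> path_image (\<gamma> e) \<inter> cball (p x) r = {}"
    using drawing_radius[OF G d] by metis
  have "\<exists>g'. arc g' \<and> {pathstart g', pathfinish g'} = p ` e \<and>
      (\<forall>x\<in>e. \<exists>q. dist (p x) q = r \<and> q \<in> path_image (\<gamma> e) \<and> path_image g' \<inter> cball (p x) r = closed_segment (p x) q) \<and>
      path_image g' \<subseteq> path_image (\<gamma> e) \<union> (\<Union>x\<in>e. cball (p x) r)" if e: "e \<in> edges G" for e
  proof -
    have "pathstart (\<gamma> e) \<in> p ` e" using dr(3)[OF e] by blast
    then obtain x where x: "x \<in> e" "pathstart (\<gamma> e) = p x" by auto
    have "pathfinish (\<gamma> e) \<in> p ` e" using dr(3)[OF e] by blast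
    then obtain y where y: "y \<in> e" "pathfinish (\<gamma> e) = p y" by auto
    have ends: "{p x, p y} = p ` e" using dr(3)[OF e] x y by simp
    have "x \<noteq> y" using x y arc_distinct_ends[OF dr(2)[OF e]] by auto
    then have exy: "e = {x, y}"
      using fin(4)[OF e] x y by (auto simp: card_2_iff)
    have "cball (p x) r \<inter> cball (p y) r = {}"
      using r(2) fin(3)[OF e] x y \<open>x \<noteq> y\<close> by blast
    from arc_radial_ends[OF dr(2)[OF e] x(2) y(2) r(1) this] obtain g' qa qb where
      g': "arc g'" "pathstart g' = p x" "pathfinish g' = p y"
      "dist (p x) qa = r" "dist (p y) qb = r" "qa \<in> path_image (\<gamma> e)" "qb \<in> path_image (\<gamma> e)"
      "path_image g' \<inter> cball (p x) r = closed_segment (p x) qa"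
      "path_image g' \<inter> cball (p y) r = closed_segment (p y) qb"
      "path_image g' \<subseteq> path_image (\<gamma> e) \<union> cball (p x) r \<union> cball (p y) r"
      by metis
    show ?thesis
      apply (rule exI[of _ g'])
      using g' ends unfolding exy by (auto simp: Un_assoc)
  qed
  then obtain \<gamma>' where \<gamma>': "\<And>e. e \<in> edges G \<Longrightarrow> arc (\<gamma>' e)"
      "\<And>e. e \<in> edges G \<Longrightarrow> {pathstart (\<gamma>' e), pathfinish (\<gamma>' e)} = p ` e"
      "\<And>e x. e \<in> edges G \<Longrightarrow> x \<in> e \<Longrightarrow> \<exists>q. dist (p x) q = r \<and> q \<in> path_image (\<gamma> e) \<and>
         path_image (\<gamma>' e) \<inter> cball (p x) r = closed_segment (p x) q"
      "\<And>e. e \<in> edges G \<Longrightarrow> path_image (\<gamma>' e) \<subseteq> path_image (\<gamma> e) \<union> (\<Union>x\<in>e. cball (p x) r)"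
    by metis
  have away: "path_image (\<gamma>' e) \<inter> cball (p x) r = {}" if "x \<in> verts G" "e \<in> edges G" "x \<notin> e" for x e
  proof -
    have "cball (p y) r \<inter> cball (p x) r = {}" if "y \<in> e" for y
      using r(2)[of y x] that fin(3)[OF \<open>e \<in> edges G\<close>] \<open>x \<notin> e\<close> \<open>x \<in> verts G\<close> by blast
    then show ?thesis using \<gamma>'(4)[OF that(2)] r(3)[OF that] by fast
  qed
  have center: "p x \<in> cball (p x) r" for x using r(1) by simp
  have "drawing G p \<gamma>'"
    unfolding drawing_def
  proof (intro conjI ballI impI)
    show "inj_on p (verts G)" by (rule dr(1))
  next
    fix e assume e: "e \<in> edges G"
    show "arc (\<gamma>' e)" "{pathstart (\<gamma>' e), pathfinish (\<gamma>' e)} = p ` e"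
      using \<gamma>'(1,2)[OF e] by auto
    show "path_image (\<gamma>' e) \<inter> p ` verts G = p ` e"
    proof
      show "p ` e \<subseteq> path_image (\<gamma>' e) \<inter> p ` verts G"
        using \<gamma>'(2)[OF e] fin(3)[OF e] pathstart_in_path_image[of "\<gamma>' e"] pathfinish_in_path_image[of "\<gamma>' e"]
        by (metis Int_subset_iff empty_subsetI image_mono insert_subset)
      show "path_image (\<gamma>' e) \<inter> p ` verts G \<subseteq> p ` e"
        using away[OF _ e] center by blast
    qed
  next
    fix e e' assume e: "e \<in> edges G" and e': "e' \<in> edges G" and ne: "e \<noteq> e'"
    have ends: "p ` f \<subseteq> path_image (\<gamma>' f)" if "f \<in> edges G" for f
      using \<gamma>'(2)[OF that] pathstart_in_path_image[of "\<gamma>' f"] pathfinish_in_path_image[of "\<gamma>' f"]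
      by (metis empty_subsetI insert_subset)
    show "path_image (\<gamma>' e) \<inter> path_image (\<gamma>' e') = p ` (e \<inter> e')"
    proof
      show "p ` (e \<inter> e') \<subseteq> path_image (\<gamma>' e) \<inter> path_image (\<gamma>' e')"
        using ends[OF e] ends[OF e'] by blast
      show "path_image (\<gamma>' e) \<inter> path_image (\<gamma>' e') \<subseteq> p ` (e \<inter> e')"
      proof
        fix z assume z: "z \<in> path_image (\<gamma>' e) \<inter> path_image (\<gamma>' e')"
        show "z \<in> p ` (e \<inter> e')"
        proof (cases "\<exists>x\<in>verts G. z \<in> cball (p x) r")
          case True
          then obtain x where x: "x \<in> verts G" "z \<in> cball (p x) r" by blast
          then have xe: "x \<in> e" "x \<in> e'" using away[OF x(1) e] away[OF x(1) e'] z by blast+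
          obtain q where q: "dist (p x) q = r" "q \<in> path_image (\<gamma> e)" "path_image (\<gamma>' e) \<inter> cball (p x) r = closed_segment (p x) q"
            using \<gamma>'(3)[OF e xe(1)] by blast
          obtain q' where q': "dist (p x) q' = r" "q' \<in> path_image (\<gamma> e')" "path_image (\<gamma>' e') \<inter> cball (p x) r = closed_segment (p x) q'"
            using \<gamma>'(3)[OF e' xe(2)] by blast
          \<comment> \<open>Two radii with a common point other than the centre coincide; the old
            edges would then meet on the circle, where no vertex lies.\<close>
          have "z = p x"
          proof (rule ccontr)
            assume "z \<noteq> p x"
            then have "q = q'"
              using z x q q' by (intro closed_segment_same_length[of z "p x" q q']) auto
            then have "q \<in> p ` (e \<inter> e')" using q(2) q'(2) dr(5)[OF e e' ne] by blast
            then obtain y where y: "y \<in> e" "q = p y" by blast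
            then have "y \<noteq> x" using q(1) r(1) by auto
            then have "cball (p x) r \<inter> cball (p y) r = {}" using r(2) x(1) y(1) fin(3)[OF e] by blast
            then show False using q(1) y(2) r(1) by force
          qed
          then show ?thesis using xe by blast
        next
          case False
          have "e \<subseteq> verts G" "e' \<subseteq> verts G" using fin(3) e e' by auto
          then have out: "z \<notin> (\<Union>x\<in>e. cball (p x) r)" "z \<notin> (\<Union>x\<in>e'. cball (p x) r)"
            using False by blast+
          have "z \<in> path_image (\<gamma> e)" "z \<in> path_image (\<gamma> e')"
            using subsetD[OF \<gamma>'(4)[OF e], of z] subsetD[OF \<gamma>'(4)[OF e'], of z] z out by (simp_all only: Int_iff Un_iff) auto
          then show ?thesis using dr(5)[OF e e' ne] by blast
        qed
      qed
    qed
  qed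
  then show thesis
  proof (rule that[OF r(1)])
    show "\<exists>q. dist (p x) q = r \<and> path_image (\<gamma>' e) \<inter> cball (p x) r = closed_segment (p x) q"
      if "e \<in> edges G" "x \<in> e" for x e
      using \<gamma>'(3)[OF that] by metis
  qed (use r(2) away in auto)
qed

text \<open>\<open>K\<close> is what the rest of a drawing occupies; near \<open>a\<close> it
  consists of radii other than the one to \<open>q\<close>. A small disc around the midpoint of that
  radius avoids \<open>K\<close>, and the second corner \<open>w\<close> is taken in this disc, off
  the line through \<open>a\<close> and \<open>q\<close>.\<close>

lemma cone_region:
  fixes a q :: complex
  assumes r: "0 < r" "dist a q = r"
    and K: "K \<inter> cball a r \<subseteq> insert a (\<Union>q'\<in>Q. closed_segment a q')"
    and Q: "finite Q" "\<And>q'. q' \<in> Q \<Longrightarrow> dist a q' = r" "q \<notin> Q"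
  obtains w where "\<not> collinear {a, midpoint a q, w}"
    "closed_segment a (midpoint a q) \<subseteq> insert a (- K)" "closed_segment a w \<subseteq> insert a (- K)"
    "closed_segment (midpoint a q) w \<subseteq> - K"
proof -
  let ?m = "midpoint a q"
  define U where "U = ball a r - insert a (\<Union>q'\<in>Q. closed_segment a q')"
  have "closed (insert a (\<Union>q'\<in>Q. closed_segment a q'))"
    using Q(1) by (auto intro!: closed_insert closed_UN)
  then have "open U" unfolding U_def by (intro open_Diff) auto
  moreover have mU: "?m \<in> U"
  proof -
    have "dist a ?m = r / 2" using r by (simp add: dist_midpoint)
    moreover from this have "?m \<noteq> a" using r(1) by auto
    then have "?m \<notin> closed_segment a q'" if "q' \<in> Q" for q'
      using closed_segment_same_length[of ?m a q q'] Q(2,3) that r(2) by auto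
    ultimately show ?thesis
      using r(1) \<open>?m \<noteq> a\<close> by (auto simp: U_def)
  qed
  ultimately obtain \<eta> where \<eta>: "0 < \<eta>" "ball ?m \<eta> \<subseteq> U"
    using open_contains_ball by blast
  have U_K: "U \<inter> K = {}"
    using K by (auto simp: U_def)
  \<comment> \<open>A segment from \<open>a\<close> that meets a radius outside \<open>a\<close>
    runs along it; as \<open>w\<close> is closer to \<open>a\<close> than \<open>r\<close>, it would
    lie on this radius, against \<open>w \<in> U\<close>.\<close>
  have seg_U: "closed_segment a w \<subseteq> insert a (- K)" if w: "w \<in> U" for w
  proof
    fix z assume z: "z \<in> closed_segment a w"
    show "z \<in> insert a (- K)"
    proof (rule ccontr)
      assume "z \<notin> insert a (- K)"
      then have zK: "z \<noteq> a" "z \<in> K" by auto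
      obtain t where t: "0 \<le> t" "t \<le> 1" "z - a = t *\<^sub>R (w - a)"
        using z by (auto simp: closed_segment_def algebra_simps)
      have t0: "t \<noteq> 0" using t zK by auto
      have "closed_segment a w \<subseteq> cball a r"
        by (rule closed_segment_subset) (use w r in \<open>auto simp: U_def\<close>)
      then obtain q' where q': "q' \<in> Q" "z \<in> closed_segment a q'"
        using K z zK by blast
      then obtain u where u: "0 \<le> u" "z - a = u *\<^sub>R (q' - a)"
        by (auto simp: closed_segment_def algebra_simps)
      have wq: "w - a = (u / t) *\<^sub>R (q' - a)"
      proof -
        have "w - a = (1 / t) *\<^sub>R (z - a)" using t t0 by simp
        then show ?thesis using u by simp
      qed
      have "norm (w - a) = (u / t) * r"
        using wq Q(2)[OF q'(1)] t u by (simp add: dist_norm norm_minus_commute)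
      moreover have "norm (w - a) < r" using w by (simp add: U_def dist_norm norm_minus_commute)
      ultimately have "(u / t) * r < 1 * r" by simp
      then have "u / t \<le> 1" using r(1) mult_less_cancel_right_pos by (metis less_imp_le)
      moreover have "w = (1 - u / t) *\<^sub>R a + (u / t) *\<^sub>R q'"
        using wq by (simp add: algebra_simps)
      moreover have "0 \<le> u / t" using u t by simp
      ultimately have "w \<in> closed_segment a q'"
        by (auto simp: closed_segment_def)
      then show False using w q' by (auto simp: U_def)
    qed
  qed
  define \<delta> where "\<delta> = \<eta> / (2 * r)"
  \<comment> \<open>Multiplication by \<open>\<i>\<close> turns the radius by a right angle, which
    keeps \<open>w\<close> off the line; the factor \<open>\<delta>\<close> makes the distance from
    the midpoint equal to \<open>\<eta> / 2\<close>.\<close>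
  define w where "w = ?m + \<delta> *\<^sub>R (\<i> * (q - a))"
  have "dist ?m w = \<delta> * r"
    unfolding w_def using r \<eta> by (simp add: dist_norm norm_mult \<delta>_def norm_minus_commute)
  then have w: "w \<in> ball ?m \<eta>"
    using r \<eta> by (simp add: \<delta>_def)
  show thesis
  proof (rule that)
    show "closed_segment a ?m \<subseteq> insert a (- K)" "closed_segment a w \<subseteq> insert a (- K)"
      using seg_U[OF mU] seg_U[OF subsetD[OF \<eta>(2) w]] by auto
    have "closed_segment ?m w \<subseteq> ball ?m \<eta>"
      by (rule closed_segment_subset) (use w \<eta> in auto)
    then show "closed_segment ?m w \<subseteq> - K" using \<eta>(2) U_K by blast
    show "\<not> collinear {a, ?m, w}"
    proof
      assume "collinear {a, ?m, w}"
      then have "collinear {0, a - ?m, w - ?m}" by (subst (asm) collinear_3) auto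
      moreover have "a - ?m = (1/2) *\<^sub>R (a - q)"
        by (simp add: midpoint_def algebra_simps scaleR_2[symmetric])
      moreover have "w - ?m = \<delta> *\<^sub>R (\<i> * (q - a))" by (simp add: w_def)
      ultimately have "collinear {0, (1/2) *\<^sub>R (a - q), \<delta> *\<^sub>R (\<i> * (q - a))}" by simp
      moreover have "a \<noteq> q" "\<delta> \<noteq> 0" using r \<eta> by (auto simp: \<delta>_def)
      ultimately obtain c where "\<delta> *\<^sub>R (\<i> * (q - a)) = c *\<^sub>R ((1/2) *\<^sub>R (a - q))"
        by (auto simp: collinear_lemma)
      moreover define k where "k = c / 2"
      ultimately have "\<delta> *\<^sub>R (\<i> * (q - a)) = k *\<^sub>R (a - q)" by simp
      then have "(complex_of_real \<delta> * \<i> + of_real k) * (q - a) = 0"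
        unfolding scaleR_conv_of_real by (simp add: algebra_simps)
      then have "complex_of_real \<delta> * \<i> + of_real k = 0" using \<open>a \<noteq> q\<close> by simp
      then have "\<delta> = 0" by (simp add: complex_eq_iff)
      with \<open>\<delta> \<noteq> 0\<close> show False ..
    qed
  qed
qed

section \<open>Adding vertices and edges to a drawing\<close>

lemma drawing_add_vertex:
  assumes G: "finite_sgraph G" and d: "drawing G p \<gamma>" and v: "v \<notin> verts G"
    and z: "z \<notin> p ` verts G" "\<And>e. e \<in> edges G \<Longrightarrow> z \<notin> path_image (\<gamma> e)"
  shows "drawing (insert v (verts G), edges G) (p(v := z)) \<gamma>"
proof -
  note fin = finite_sgraph_edgesD[OF G] and dr = drawingD[OF d]
  have pe: "(p(v := z)) ` e = p ` e" if "e \<subseteq> verts G" for e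
    using that v by auto
  have sub: "e \<subseteq> verts G" "e \<inter> e' \<subseteq> verts G" if "e \<in> edges G" for e e'
    using fin(3)[OF that] by auto
  have "inj_on (p(v := z)) (insert v (verts G))"
    using dr(1) v z(1) by (auto simp: inj_on_def)
  moreover have "(p(v := z)) ` insert v (verts G) = insert z (p ` verts G)"
    using v by auto
  ultimately show ?thesis
    unfolding drawing_def using dr(2-5) sub z(2) by (auto simp: pe simp del: image_insert fun_upd_apply)
qed

lemma drawing_add_edge:
  assumes G: "finite_sgraph G" and d: "drawing G p \<gamma>"
    and xy: "x \<in> verts G" "y \<in> verts G" "x \<noteq> y" "{x, y} \<notin> edges G"
    and g: "arc g" "pathstart g = p x" "pathfinish g = p y"
      "path_image g \<inter> p ` verts G \<subseteq> {p x, p y}"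
      "\<And>e. e \<in> edges G \<Longrightarrow> path_image g \<inter> path_image (\<gamma> e) \<subseteq> {p x, p y}"
  shows "drawing (verts G, insert {x, y} (edges G)) p (\<gamma>({x, y} := g))"
proof -
  note fin = finite_sgraph_edgesD[OF G] and dr = drawingD[OF d]
  have ends: "p x \<in> path_image g" "p y \<in> path_image g"
    using g(2,3) pathstart_in_path_image[of g] pathfinish_in_path_image[of g] by auto
  have cap: "path_image g \<inter> path_image (\<gamma> e) = p ` ({x, y} \<inter> e)" if e: "e \<in> edges G" for e
  proof -
    have "p u \<in> path_image (\<gamma> e) \<longleftrightarrow> u \<in> e" if "u \<in> verts G" for u
    proof -
      have "p u \<in> path_image (\<gamma> e) \<longleftrightarrow> p u \<in> p ` e" using dr(4)[OF e] that by blast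
      also have "\<dots> \<longleftrightarrow> u \<in> e" using dr(1) fin(3)[OF e] that by (auto dest: inj_onD)
      finally show ?thesis .
    qed
    then have "p x \<in> path_image (\<gamma> e) \<longleftrightarrow> x \<in> e" "p y \<in> path_image (\<gamma> e) \<longleftrightarrow> y \<in> e"
      using xy by auto
    then show ?thesis using g(5)[OF e] ends by auto
  qed
  show ?thesis
    unfolding drawing_def
  proof (intro conjI ballI impI)
    show "inj_on p (verts (verts G, insert {x, y} (edges G)))" using dr(1) by simp
  next
    fix e assume "e \<in> edges (verts G, insert {x, y} (edges G))"
    then have e: "e = {x, y} \<or> e \<in> edges G" by simp
    show "arc ((\<gamma>({x, y} := g)) e)" using g(1) dr(2) e by auto
    show "{pathstart ((\<gamma>({x, y} := g)) e), pathfinish ((\<gamma>({x, y} := g)) e)} = p ` e"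
      using g(2,3) dr(3) e by auto
    have "path_image g \<inter> p ` verts G = p ` {x, y}" using g(4) ends xy by auto
    then show "path_image ((\<gamma>({x, y} := g)) e) \<inter> p ` verts (verts G, insert {x, y} (edges G)) = p ` e"
      using dr(4) e by (cases "e = {x, y}") simp_all
  next
    fix e e' assume "e \<in> edges (verts G, insert {x, y} (edges G))"
      "e' \<in> edges (verts G, insert {x, y} (edges G))" "e \<noteq> e'"
    then consider "e = {x, y}" "e' \<in> edges G" "e' \<noteq> {x, y}" | "e' = {x, y}" "e \<in> edges G" "e \<noteq> {x, y}"
      | "e \<in> edges G" "e' \<in> edges G" "e \<noteq> {x, y}" "e' \<noteq> {x, y}"
      by auto
    then show "path_image ((\<gamma>({x, y} := g)) e) \<inter> path_image ((\<gamma>({x, y} := g)) e') = p ` (e \<inter> e')"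
    proof cases
      case 1 then show ?thesis using cap[of e'] by simp
    next
      case 2 then show ?thesis using cap[of e] by (simp add: Int_commute)
    next
      case 3 then show ?thesis using dr(5) \<open>e \<noteq> e'\<close> by simp
    qed
  qed
qed

lemma drawing_sub_edges:
  assumes "drawing G p \<gamma>" "E \<subseteq> edges G"
  shows "drawing (verts G, E) p \<gamma>"
  using assms unfolding drawing_def by (auto simp: subset_iff)

lemma arc_halves:
  assumes g: "arc g"
  shows "arc (subpath 0 (1/2) g)" "arc (subpath (1/2) 1 g)"
    "path_image (subpath 0 (1/2) g) \<union> path_image (subpath (1/2) 1 g) = path_image g"
    "path_image (subpath 0 (1/2) g) \<inter> path_image (subpath (1/2) 1 g) = {g (1/2)}"
    "pathfinish g \<notin> path_image (subpath 0 (1/2) g)" "pathstart g \<notin> path_image (subpath (1/2) 1 g)"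
    "g (1/2) \<noteq> pathstart g" "g (1/2) \<noteq> pathfinish g"
proof -
  have inj: "inj_on g {0..1}" using g by (simp add: arc_def)
  have D: "s = t" if "g s = g t" "s \<in> {0..1}" "t \<in> {0..1}" for s t using inj that by (auto dest: inj_onD)
  have im: "path_image (subpath 0 (1/2) g) = g ` {0..1/2}" "path_image (subpath (1/2) 1 g) = g ` {1/2..1}"
    by (auto simp: path_image_subpath)
  show "arc (subpath 0 (1/2) g)" "arc (subpath (1/2) 1 g)"
    by (rule arc_subpath_arc[OF g]; simp)+
  have "{0..1} = {0..1/2} \<union> {1/2..1::real}" by auto
  then show "path_image (subpath 0 (1/2) g) \<union> path_image (subpath (1/2) 1 g) = path_image g"
    unfolding im by (metis image_Un path_image_def)
  have "s = 1/2" if "g s = g t" "s \<in> {0..1/2}" "t \<in> {1/2..1}" for s t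
    using D[of s t] that by auto
  then show "path_image (subpath 0 (1/2) g) \<inter> path_image (subpath (1/2) 1 g) = {g (1/2)}"
    unfolding im by fastforce
  show "pathfinish g \<notin> path_image (subpath 0 (1/2) g)" "pathstart g \<notin> path_image (subpath (1/2) 1 g)"
    "g (1/2) \<noteq> pathstart g" "g (1/2) \<noteq> pathfinish g"
    unfolding im pathfinish_def pathstart_def by (auto dest: D)
qed

text \<open>At \<open>x\<close> the other edges are radii different from that of \<open>e\<close>,
  so \<open>cone_region\<close> applies beside \<open>e\<close>. The corner \<open>w1\<close> is put
  on \<open>e\<close> itself: this links the triangles found at the two ends of
  \<open>e\<close>.\<close>

lemma drawing_access:
  fixes p :: "'a \<Rightarrow> complex"
  assumes G: "finite_sgraph G" and d: "drawing G p \<gamma>" and e: "e \<in> edges G" "x \<in> e"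
    and r: "0 < r"
      "\<And>x y. x \<in> verts G \<Longrightarrow> y \<in> verts G \<Longrightarrow> x \<noteq> y \<Longrightarrow> cball (p x) r \<inter> cball (p y) r = {}"
      "\<And>x e. x \<in> verts G \<Longrightarrow> e \<in> edges G \<Longrightarrow> x \<notin> e \<Longrightarrow> path_image (\<gamma> e) \<inter> cball (p x) r = {}"
      "\<And>x e. e \<in> edges G \<Longrightarrow> x \<in> e \<Longrightarrow>
       \<exists>q. dist (p x) q = r \<and> path_image (\<gamma> e) \<inter> cball (p x) r = closed_segment (p x) q"
    and K: "K = p ` verts G \<union> (\<Union>f\<in>edges G - {e}. path_image (\<gamma> f))"
  obtains w1 w2 where "\<not> collinear {p x, w1, w2}" "w1 \<in> path_image (\<gamma> e)"
    "closed_segment (p x) w1 \<subseteq> insert (p x) (- K)" "closed_segment (p x) w2 \<subseteq> insert (p x) (- K)"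
    "closed_segment w1 w2 \<subseteq> - K"
proof -
  note fin = finite_sgraph_edgesD[OF G] and dr = drawingD[OF d]
  have x: "x \<in> verts G" using e fin(3) by auto
  define F where "F = {f \<in> edges G. x \<in> f}"
  have "\<forall>f\<in>F. \<exists>q. dist (p x) q = r \<and> path_image (\<gamma> f) \<inter> cball (p x) r = closed_segment (p x) q"
    using r(4) by (simp add: F_def)
  from bchoice[OF this] obtain q where q: "\<And>f. f \<in> F \<Longrightarrow> dist (p x) (q f) = r"
      "\<And>f. f \<in> F \<Longrightarrow> path_image (\<gamma> f) \<inter> cball (p x) r = closed_segment (p x) (q f)"
    by blast
  have eF: "e \<in> F" using e by (simp add: F_def)
  \<comment> \<open>A common end point of two radii would be a common vertex of both edges, but no
    vertex lies on the circle around \<open>p x\<close>.\<close>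
  have q_ne: "q f \<noteq> q e" if f: "f \<in> F - {e}" for f
  proof
    assume "q f = q e"
    moreover have "q f \<in> path_image (\<gamma> f)" using q(2)[of f] f by (metis DiffD1 IntD1 ends_in_segment(2))
    moreover have "q e \<in> path_image (\<gamma> e)" using q(2)[OF eF] by (metis IntD1 ends_in_segment(2))
    ultimately have "q e \<in> p ` (f \<inter> e)" using dr(5)[of f e] f eF by (auto simp: F_def)
    then obtain y where y: "y \<in> e" "q e = p y" by auto
    then have "y \<noteq> x" using q(1)[OF eF] r(1) by auto
    then have "cball (p x) r \<inter> cball (p y) r = {}" using r(2) x y fin(3)[OF e(1)] by blast
    moreover have "q e \<in> cball (p x) r" "q e \<in> cball (p y) r" using q(1)[OF eF] y r(1) by auto
    ultimately show False by blast
  qed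
  define Q where "Q = q ` (F - {e})"
  have "K \<inter> cball (p x) r \<subseteq> insert (p x) (\<Union>q'\<in>Q. closed_segment (p x) q')"
  proof
    fix z assume z: "z \<in> K \<inter> cball (p x) r"
    then consider y where "y \<in> verts G" "z = p y" | f where "f \<in> edges G" "f \<noteq> e" "z \<in> path_image (\<gamma> f)"
      unfolding K by auto
    then show "z \<in> insert (p x) (\<Union>q'\<in>Q. closed_segment (p x) q')"
    proof cases
      case (1 y)
      have "p y \<in> cball (p y) r" using r(1) by simp
      then have "y = x" using r(2)[OF x, of y] 1 z by blast
      then show ?thesis using 1 by simp
    next
      case (2 f)
      then have "x \<in> f" using r(3)[OF x 2(1)] z by blast
      then have "f \<in> F" using 2 by (simp add: F_def)
      then have "z \<in> closed_segment (p x) (q f)" using q(2) 2 z by blast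
      then show ?thesis using \<open>f \<in> F\<close> 2 by (auto simp: Q_def)
    qed
  qed
  moreover have "finite Q" using fin(2) by (simp add: Q_def F_def)
  moreover have "dist (p x) q' = r" if "q' \<in> Q" for q' using q(1) that by (auto simp: Q_def)
  moreover have "q e \<notin> Q" unfolding Q_def using q_ne by (metis imageE)
  ultimately obtain w where w: "\<not> collinear {p x, midpoint (p x) (q e), w}"
      "closed_segment (p x) (midpoint (p x) (q e)) \<subseteq> insert (p x) (- K)"
      "closed_segment (p x) w \<subseteq> insert (p x) (- K)" "closed_segment (midpoint (p x) (q e)) w \<subseteq> - K"
    using cone_region[OF r(1) q(1)[OF eF], of K Q] by metis
  moreover have "midpoint (p x) (q e) \<in> closed_segment (p x) (q e)" by simp
  then have "midpoint (p x) (q e) \<in> path_image (\<gamma> e)" using q(2)[OF eF] by blast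
  ultimately show thesis using that by blast
qed

text \<open>Without its end \<open>a\<close> the segment is still connected, hence inside one
  component. The point \<open>a\<close> is exempted because in the application it is a vertex of the
  drawing, outside the complement \<open>S\<close>.\<close>

lemma connected_component_set_segment:
  fixes a w :: "'a::euclidean_space"
  assumes "closed_segment a w \<subseteq> insert a S" "w \<in> connected_component_set S m"
  shows "closed_segment a w \<subseteq> insert a (connected_component_set S m)"
proof (cases "w = a")
  case False
  have "open_segment a w \<union> {w} = closed_segment a w - {a}"
    using False by (auto simp: open_segment_def)
  moreover have "connected (open_segment a w \<union> {w})"
  proof (rule connected_intermediate_closure[of "open_segment a w"])
    show "open_segment a w \<union> {w} \<subseteq> closure (open_segment a w)"
      using False by (simp add: closure_open_segment segment_open_subset_closed)
  qed (auto intro: convex_connected)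
  ultimately have "connected (closed_segment a w - {a})" by simp
  moreover have "closed_segment a w - {a} \<subseteq> S" using assms(1) by auto
  moreover have "w \<in> closed_segment a w - {a}" using False by simp
  ultimately have "closed_segment a w - {a} \<subseteq> connected_component_set S w"
    by (intro connected_component_maximal)
  also have "connected_component_set S w = connected_component_set S m"
    using assms(2) by (metis connected_component_eq)
  finally show ?thesis by auto
qed auto

text \<open>Let the edge be erased and let \<open>W\<close> be the component of the complement in
  which it ran. \<open>W\<close> is reached from both ends, so two arcs in it meet only at the ends:
  one redraws the edge, the other is cut at its midpoint, the place for \<open>v\<close>.\<close>

lemma planar_add_parallel:
  assumes pl: "planar G" and G: "finite_sgraph G" and e: "{x, y} \<in> edges G" and v: "v \<notin> verts G"
  shows "planar (insert v (verts G), edges G \<union> {{x, v}, {v, y}})"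
proof -
  note fin = finite_sgraph_edgesD[OF G]
  obtain p \<gamma>0 where "drawing G p \<gamma>0" using pl by (auto simp: planar_iff_drawing)
  from drawing_radial[OF G this] obtain r \<gamma> where r: "0 < r" and d: "drawing G p \<gamma>"
    and rad: "\<And>x y. x \<in> verts G \<Longrightarrow> y \<in> verts G \<Longrightarrow> x \<noteq> y \<Longrightarrow> cball (p x) r \<inter> cball (p y) r = {}"
      "\<And>x e. x \<in> verts G \<Longrightarrow> e \<in> edges G \<Longrightarrow> x \<notin> e \<Longrightarrow> path_image (\<gamma> e) \<inter> cball (p x) r = {}"
      "\<And>x e. e \<in> edges G \<Longrightarrow> x \<in> e \<Longrightarrow>
       \<exists>q. dist (p x) q = r \<and> path_image (\<gamma> e) \<inter> cball (p x) r = closed_segment (p x) q"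
    by metis
  note dr = drawingD[OF d]
  let ?e = "{x, y}"
  have xy: "x \<in> verts G" "y \<in> verts G" "x \<noteq> y" using fin(3)[OF e] fin(4)[OF e] by auto
  have pxy: "p x \<noteq> p y" using dr(1) xy by (auto dest: inj_onD)
  define K where "K = p ` verts G \<union> (\<Union>f\<in>edges G - {?e}. path_image (\<gamma> f))"
  obtain w1 w2 where w: "\<not> collinear {p x, w1, w2}" "w1 \<in> path_image (\<gamma> ?e)"
    "closed_segment (p x) w1 \<subseteq> insert (p x) (- K)" "closed_segment (p x) w2 \<subseteq> insert (p x) (- K)"
    "closed_segment w1 w2 \<subseteq> - K"
    by (rule drawing_access[OF G d e _ r rad K_def, of x]) auto
  obtain z1 z2 where z: "\<not> collinear {p y, z1, z2}" "z1 \<in> path_image (\<gamma> ?e)"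
    "closed_segment (p y) z1 \<subseteq> insert (p y) (- K)" "closed_segment (p y) z2 \<subseteq> insert (p y) (- K)"
    "closed_segment z1 z2 \<subseteq> - K"
    by (rule drawing_access[OF G d e _ r rad K_def, of y]) auto
  have notK: "w1 \<in> - K" "w2 \<in> - K" "z1 \<in> - K" "z2 \<in> - K"
    using w(5) z(5) by (meson ends_in_segment subsetD)+
  have "closed K"
    unfolding K_def using fin(1,2) dr(2)
    by (intro closed_Un closed_UN finite_imp_closed) (auto intro: closed_path_image arc_imp_path)
  define W where "W = connected_component_set (- K) w1"
  have W: "open W" "connected W" "W \<subseteq> - K"
    using \<open>closed K\<close> by (auto simp: W_def open_Compl connected_component_subset intro!: open_connected_component)
  have verts_W: "p u \<notin> W" if "u \<in> verts G" for u using W(3) that by (auto simp: K_def)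
  have w_in: "w1 \<in> W" "w2 \<in> W"
  proof -
    show "w1 \<in> W" using notK by (simp add: W_def)
    have "closed_segment w1 w2 \<subseteq> W"
      unfolding W_def using w(5) by (intro connected_component_maximal) auto
    then show "w2 \<in> W" by auto
  qed
  have z_in: "z1 \<in> W" "z2 \<in> W"
  proof -
    \<comment> \<open>The edge without its ends runs through the complement of \<open>K\<close> and
      contains \<open>w1\<close> and \<open>z1\<close>, so the triangles at both ends lead into the
      same component.\<close>
    define I where "I = path_image (\<gamma> ?e) - {pathstart (\<gamma> ?e), pathfinish (\<gamma> ?e)}"
    have I: "I = path_image (\<gamma> ?e) - p ` verts G"
      using dr(3)[OF e] dr(4)[OF e] by (auto simp: I_def)
    have "connected I" unfolding I_def
      by (rule connected_simple_path_endless) (use dr(2)[OF e] arc_imp_simple_path in auto)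
    moreover have "I \<subseteq> - K"
    proof -
      have "path_image (\<gamma> f) \<inter> path_image (\<gamma> ?e) \<subseteq> p ` verts G" if "f \<in> edges G - {?e}" for f
        using dr(5)[of f ?e] that e fin(3)[OF e] by auto
      then show ?thesis unfolding I K_def by blast
    qed
    moreover have "w1 \<in> I" "z1 \<in> I" using w(2) z(2) notK by (auto simp: I K_def)
    ultimately have "I \<subseteq> W" unfolding W_def by (intro connected_component_maximal)
    then show "z1 \<in> W" using \<open>z1 \<in> I\<close> by blast
    then have eq: "W = connected_component_set (- K) z1"
      unfolding W_def by (metis connected_component_eq)
    have "closed_segment z1 z2 \<subseteq> W"
      unfolding eq using z(5) by (intro connected_component_maximal) auto
    then show "z2 \<in> W" by auto
  qed
  have "closed_segment w1 w2 \<subseteq> W"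
    unfolding W_def using w(5) by (intro connected_component_maximal) auto
  moreover have "closed_segment (p x) w1 \<subseteq> insert (p x) W" "closed_segment (p x) w2 \<subseteq> insert (p x) W"
    "closed_segment (p y) z1 \<subseteq> insert (p y) W" "closed_segment (p y) z2 \<subseteq> insert (p y) W"
    by (rule connected_component_set_segment[OF w(3) w_in(1)[unfolded W_def], folded W_def]
      connected_component_set_segment[OF w(4) w_in(2)[unfolded W_def], folded W_def]
      connected_component_set_segment[OF z(3) z_in(1)[unfolded W_def], folded W_def]
      connected_component_set_segment[OF z(4) z_in(2)[unfolded W_def], folded W_def])+
  ultimately obtain \<alpha> \<beta> where \<alpha>: "arc \<alpha>" "pathstart \<alpha> = p x" "pathfinish \<alpha> = p y"
    and \<beta>: "arc \<beta>" "pathstart \<beta> = p x" "pathfinish \<beta> = p y"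
    and sub: "path_image \<alpha> \<subseteq> W \<union> {p x, p y}" "path_image \<beta> \<subseteq> W \<union> {p x, p y}"
    and cap: "path_image \<alpha> \<inter> path_image \<beta> = {p x, p y}"
    using two_arcs_in_region[OF W(1,2) verts_W[OF xy(1)] verts_W[OF xy(2)] pxy] w(1) z(1) by metis
  have meet: "W \<inter> p ` verts G = {}" "\<And>f. f \<in> edges G - {?e} \<Longrightarrow> W \<inter> path_image (\<gamma> f) = {}"
    using W(3) by (auto simp: K_def)
  define E0 where "E0 = edges G - {?e}"
  have "drawing (verts G, E0) p \<gamma>" using drawing_sub_edges[OF d] by (simp add: E0_def)
  moreover have "finite_sgraph (verts G, E0)" using G by (auto simp: finite_sgraph_def E0_def)
  moreover have "path_image \<alpha> \<inter> p ` verts G \<subseteq> {p x, p y}" using sub(1) meet(1) by auto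
  moreover have "path_image \<alpha> \<inter> path_image (\<gamma> f) \<subseteq> {p x, p y}" if "f \<in> E0" for f
    using sub(1) meet(2)[of f] that unfolding E0_def by auto
  moreover have "?e \<notin> E0" by (simp add: E0_def)
  \<comment> \<open>The old curve of the edge may cross \<open>\<beta>\<close>, so it is replaced by
    \<open>\<alpha>\<close>.\<close>
  ultimately have d1: "drawing (verts G, insert ?e E0) p (\<gamma>(?e := \<alpha>))"
    using drawing_add_edge[of "(verts G, E0)" p \<gamma> x y \<alpha>] xy \<alpha> by auto
  have E0: "insert ?e E0 = edges G" using e by (auto simp: E0_def)
  have d1: "drawing G p (\<gamma>(?e := \<alpha>))" using d1 by (simp add: E0)
  define \<gamma>1 where "\<gamma>1 = \<gamma>(?e := \<alpha>)"
  define m where "m = \<beta> (1/2)"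
  define \<beta>1 \<beta>2 where "\<beta>1 = subpath 0 (1/2) \<beta>" and "\<beta>2 = subpath (1/2) 1 \<beta>"
  note halves = arc_halves[OF \<beta>(1), folded m_def \<beta>1_def \<beta>2_def, unfolded \<beta>(2,3)]
  have ends: "pathstart \<beta>1 = p x" "pathfinish \<beta>1 = m" "pathstart \<beta>2 = m" "pathfinish \<beta>2 = p y"
    using \<beta>(2,3) by (auto simp: \<beta>1_def \<beta>2_def m_def pathstart_def pathfinish_def subpath_def)
  have sub_halves: "path_image \<beta>1 \<subseteq> path_image \<beta>" "path_image \<beta>2 \<subseteq> path_image \<beta>"
    using halves(3) by auto
  have "m \<in> path_image \<beta>" using halves(3,4) by auto
  then have m: "m \<in> W" "m \<notin> path_image \<alpha>" using sub(2) cap halves(7,8) by auto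
  have edge_cap: "path_image \<beta> \<inter> path_image (\<gamma>1 f) \<subseteq> {p x, p y}" if "f \<in> edges G" for f
    using that cap meet(2)[of f] sub(2) by (cases "f = ?e") (auto simp: \<gamma>1_def)
  have vert_cap: "path_image \<beta> \<inter> p ` verts G \<subseteq> {p x, p y}" using sub(2) meet(1) by auto
  have m_out: "m \<notin> p ` verts G" "\<And>f. f \<in> edges G \<Longrightarrow> m \<notin> path_image (\<gamma>1 f)"
    using m(1) meet(1) edge_cap \<open>m \<in> path_image \<beta>\<close> halves(7,8) by auto
  let ?p = "p(v := m)"
  let ?G2 = "(insert v (verts G), edges G)"
  have d2: "drawing ?G2 ?p \<gamma>1"
    by (rule drawing_add_vertex[OF G d1[folded \<gamma>1_def] v m_out])
  have G2: "finite_sgraph ?G2" using G by (auto simp: finite_sgraph_def)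
  have v_out: "v \<notin> f" if "f \<in> edges G" for f using fin(3)[OF that] v by auto
  have vxy: "v \<noteq> x" "v \<noteq> y" using xy v by auto
  have p_verts: "?p ` insert v (verts G) = insert m (p ` verts G)" using v by auto
  have b1: "path_image \<beta>1 \<inter> (path_image \<beta> \<inter> A) \<subseteq> {p x}" if "path_image \<beta> \<inter> A \<subseteq> {p x, p y}" for A
    using that halves(5) by auto
  have b2: "path_image \<beta>2 \<inter> (path_image \<beta> \<inter> A) \<subseteq> {p y}" if "path_image \<beta> \<inter> A \<subseteq> {p x, p y}" for A
    using that halves(6) by auto
  let ?G3 = "(insert v (verts G), insert {x, v} (edges G))"
  have d3: "drawing ?G3 ?p (\<gamma>1({x, v} := \<beta>1))"
  proof -
    have "path_image \<beta>1 \<inter> ?p ` insert v (verts G) \<subseteq> {?p x, ?p v}"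
      unfolding p_verts using b1[OF vert_cap] sub_halves vxy by auto
    moreover have "path_image \<beta>1 \<inter> path_image (\<gamma>1 f) \<subseteq> {?p x, ?p v}" if "f \<in> edges G" for f
      using b1[OF edge_cap[OF that]] sub_halves vxy by auto
    ultimately show ?thesis
      using drawing_add_edge[OF G2 d2, of x v \<beta>1] xy vxy v_out halves(1) ends by auto
  qed
  have G3: "finite_sgraph ?G3" using G2 xy vxy by (auto simp: finite_sgraph_def)
  have "drawing (insert v (verts G), insert {v, y} (insert {x, v} (edges G))) ?p ((\<gamma>1({x, v} := \<beta>1))({v, y} := \<beta>2))"
  proof -
    have "path_image \<beta>2 \<inter> ?p ` insert v (verts G) \<subseteq> {?p v, ?p y}"
      unfolding p_verts using b2[OF vert_cap] sub_halves vxy by auto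
    moreover have "path_image \<beta>2 \<inter> path_image ((\<gamma>1({x, v} := \<beta>1)) f) \<subseteq> {?p v, ?p y}"
      if "f \<in> insert {x, v} (edges G)" for f
    proof (cases "f = {x, v}")
      case True then show ?thesis using halves(4) by auto
    next
      case False
      then show ?thesis using that b2[OF edge_cap, of f] sub_halves vxy by auto
    qed
    ultimately show ?thesis
      using drawing_add_edge[OF G3 d3, of v y \<beta>2] xy vxy v_out halves(2) ends
      by (auto simp: doubleton_eq_iff)
  qed
  then show ?thesis
    by (auto simp: planar_iff_drawing insert_commute)
qed

subsection \<open>Vertices of degree at most two\<close>

text \<open>If \<open>x\<close> has an edge, a path parallel to it is added and its second half
  dropped. If \<open>x\<close> is isolated, it has a ball to itself, where a straight segment
  fits.\<close>

lemma planar_add_pendant: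
  assumes pl: "planar G" and G: "finite_sgraph G" and x: "x \<in> verts G" and v: "v \<notin> verts G"
  shows "planar (insert v (verts G), insert {x, v} (edges G))"
proof (cases "\<exists>e\<in>edges G. x \<in> e")
  case True
  then obtain e where "e \<in> edges G" "x \<in> e" by blast
  moreover then obtain y where "e = {x, y}"
    using finite_sgraph_edgesD(4)[OF G] by (force simp: card_2_iff)
  ultimately have "planar (insert v (verts G), edges G \<union> {{x, v}, {v, y}})"
    using planar_add_parallel[OF pl G _ v] by blast
  then show ?thesis
    by (rule planar_subgraph) (use x finite_sgraph_edgesD(3)[OF G] in auto)
next
  case False
  obtain p \<gamma> where d: "drawing G p \<gamma>" using pl by (auto simp: planar_iff_drawing)
  note dr = drawingD[OF d]
  obtain r where r: "0 < r"
    "\<And>x y. x \<in> verts G \<Longrightarrow> y \<in> verts G \<Longrightarrow> x \<noteq> y \<Longrightarrow> cball (p x) r \<inter> cball (p y) r = {}"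
    "\<And>x e. x \<in> verts G \<Longrightarrow> e \<in> edges G \<Longrightarrow> x \<notin> e \<Longrightarrow> path_image (\<gamma> e) \<inter> cball (p x) r = {}"
    using drawing_radius[OF G d] by metis
  define z where "z = p x + of_real r"
  have z: "z \<in> cball (p x) r" "z \<noteq> p x" using r(1) by (auto simp: z_def dist_norm)
  have seg: "closed_segment (p x) z \<subseteq> cball (p x) r"
    by (rule closed_segment_subset) (use z r(1) in auto)
  have out: "cball (p x) r \<inter> path_image (\<gamma> e) = {}" if "e \<in> edges G" for e
    using r(3)[OF x that] False that by blast
  have out': "p u = p x" if "p u \<in> cball (p x) r" "u \<in> verts G" for u
  proof (rule ccontr)
    assume "p u \<noteq> p x"
    then have "cball (p x) r \<inter> cball (p u) r = {}" using r(2)[OF x that(2)] by auto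
    then show False using that(1) r(1) by auto
  qed
  have "z \<notin> p ` verts G" using out' z by auto
  moreover have "z \<notin> path_image (\<gamma> e)" if "e \<in> edges G" for e using out[OF that] z by auto
  ultimately have d2: "drawing (insert v (verts G), edges G) (p(v := z)) \<gamma>"
    by (rule drawing_add_vertex[OF G d v])
  have G2: "finite_sgraph (insert v (verts G), edges G)" using G by (auto simp: finite_sgraph_def)
  have vx: "v \<noteq> x" using x v by auto
  have p_verts: "(p(v := z)) ` insert v (verts G) = insert z (p ` verts G)" using v by auto
  have "drawing (insert v (verts G), insert {x, v} (edges G)) (p(v := z)) (\<gamma>({x, v} := linepath (p x) z))"
  proof -
    have "closed_segment (p x) z \<inter> (p(v := z)) ` insert v (verts G) \<subseteq> {p x, z}"
      unfolding p_verts using seg out' by auto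
    moreover have "closed_segment (p x) z \<inter> path_image (\<gamma> e) = {}" if "e \<in> edges G" for e
      using seg out[OF that] by blast
    moreover have "{x, v} \<notin> edges G" using False by blast
    ultimately show ?thesis
      using drawing_add_edge[OF G2 d2, of x v "linepath (p x) z"] x vx z(2) by auto
  qed
  then show ?thesis by (auto simp: planar_iff_drawing)
qed

lemma neighbours_subset:
  assumes "finite_sgraph G"
  shows "neighbours G v \<subseteq> verts G - {v}"
  using finite_sgraph_edgesD(3,4)[OF assms] by (fastforce simp: neighbours_def)

lemma finite_sgraph_del_verts: "finite_sgraph G \<Longrightarrow> finite_sgraph (del_verts G X)"
  by (auto simp: finite_sgraph_def del_verts_def)

lemma edges_at:
  assumes "finite_sgraph G" "e \<in> edges G" "v \<in> e"
  obtains w where "w \<in> neighbours G v" "e = {v, w}"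
  using finite_sgraph_edgesD(4)[OF assms(1,2)] assms(2,3)
  by (force simp: card_2_iff neighbours_def insert_commute)

lemma planar_empty: "edges G = {} \<Longrightarrow> verts G \<subseteq> {v} \<Longrightarrow> planar G"
  unfolding planar_def by (auto simp: inj_on_def intro!: exI[of _ "\<lambda>_. 0"])

lemma planar_del_vert_degree_le_1:
  assumes G: "finite_sgraph G" and v: "v \<in> verts G" and N: "neighbours G v \<subseteq> {x}"
    and pl: "planar (del_verts G {v})"
  shows "planar G"
proof (cases "verts G = {v}")
  case True
  have "edges G = {}"
  proof (rule equals0I)
    fix e assume e: "e \<in> edges G"
    then have "card e \<le> card {v}" using finite_sgraph_edgesD(3)[OF G e] True by (intro card_mono) auto
    then show False using finite_sgraph_edgesD(4)[OF G e] by simp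
  qed
  then show ?thesis using True planar_empty[of G v] by simp
next
  case False
  then obtain y where y: "y \<in> verts G - {v}" using v by blast
  \<comment> \<open>For an isolated \<open>v\<close> the given \<open>x\<close> may fail to be a
    vertex of the rest, and any vertex \<open>y\<close> serves as the place to attach
    \<open>v\<close>.\<close>
  define z where "z = (if x \<in> verts G - {v} then x else y)"
  have z: "z \<in> verts (del_verts G {v})" using y by (auto simp: z_def del_verts_def)
  have N: "neighbours G v \<subseteq> {z}" using N neighbours_subset[OF G, of v] by (auto simp: z_def)
  have "planar (insert v (verts (del_verts G {v})), insert {z, v} (edges (del_verts G {v})))"
    by (rule planar_add_pendant[OF pl finite_sgraph_del_verts[OF G] z]) (simp add: del_verts_def)
  then show ?thesis
  proof (rule planar_subgraph)
    show "edges G \<subseteq> edges (insert v (verts (del_verts G {v})), insert {z, v} (edges (del_verts G {v})))"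
    proof
      fix e assume e: "e \<in> edges G"
      show "e \<in> edges (insert v (verts (del_verts G {v})), insert {z, v} (edges (del_verts G {v})))"
      proof (cases "v \<in> e")
        case True
        then obtain w where "w \<in> neighbours G v" "e = {v, w}" using edges_at[OF G e] by blast
        then show ?thesis using N by (auto simp: insert_commute)
      next
        case False
        then show ?thesis using e by (auto simp: del_verts_def)
      qed
    qed
  qed (use finite_sgraph_edgesD(3)[OF G] in \<open>auto simp: del_verts_def\<close>)
qed

text \<open>For a vertex of degree two with neighbours \<open>x\<close> and \<open>y\<close> this is the graph \<open>contract G x v\<close>.\<close>

definition smooth :: "'a sgraph \<Rightarrow> 'a \<Rightarrow> 'a \<Rightarrow> 'a \<Rightarrow> 'a sgraph" where
  "smooth G v x y = (verts G - {v}, insert {x, y} (edges (del_verts G {v})))"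

lemma finite_sgraph_smooth:
  "finite_sgraph G \<Longrightarrow> {x, y} \<subseteq> verts G - {v} \<Longrightarrow> x \<noteq> y \<Longrightarrow> finite_sgraph (smooth G v x y)"
  by (auto simp: finite_sgraph_def smooth_def del_verts_def)

text \<open>The path through \<open>v\<close> is drawn along the edge \<open>xy\<close>, which is
  dropped afterwards if it is missing in \<open>G\<close>.\<close>

lemma planar_smooth:
  assumes G: "finite_sgraph G" and v: "v \<in> verts G" and N: "neighbours G v \<subseteq> {x, y}"
    and xy: "{x, y} \<subseteq> verts G - {v}" "x \<noteq> y" and pl: "planar (smooth G v x y)"
  shows "planar G"
proof -
  have "planar (insert v (verts (smooth G v x y)), edges (smooth G v x y) \<union> {{x, v}, {v, y}})"
    by (rule planar_add_parallel[OF pl finite_sgraph_smooth[OF G xy]]) (auto simp: smooth_def)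
  then show ?thesis
  proof (rule planar_subgraph)
    show "edges G \<subseteq> edges (insert v (verts (smooth G v x y)), edges (smooth G v x y) \<union> {{x, v}, {v, y}})"
    proof
      fix e assume e: "e \<in> edges G"
      show "e \<in> edges (insert v (verts (smooth G v x y)), edges (smooth G v x y) \<union> {{x, v}, {v, y}})"
      proof (cases "v \<in> e")
        case True
        then obtain w where "w \<in> neighbours G v" "e = {v, w}" using edges_at[OF G e] by blast
        then show ?thesis using N by (auto simp: insert_commute)
      next
        case False
        then show ?thesis using e by (auto simp: del_verts_def smooth_def)
      qed
    qed
  qed (use finite_sgraph_edgesD(3)[OF G] in \<open>auto simp: smooth_def\<close>)
qed

section \<open>Degrees and edge counts\<close>

abbreviation deg :: "'a sgraph \<Rightarrow> 'a \<Rightarrow> nat" where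
  "deg G v \<equiv> card (neighbours G v)"

lemma neighbours_sym: "w \<in> neighbours G v \<longleftrightarrow> v \<in> neighbours G w"
  by (simp add: neighbours_def insert_commute)

lemma finite_neighbours: "finite_sgraph G \<Longrightarrow> finite (neighbours G v)"
  using neighbours_subset finite_sgraph_edgesD(1) by (metis finite_Diff finite_subset)

lemma neighbours_irrefl: "finite_sgraph G \<Longrightarrow> v \<notin> neighbours G v"
  using neighbours_subset by fastforce

lemma card_edges_at:
  assumes G: "finite_sgraph G"
  shows "card {e \<in> edges G. v \<in> e} = deg G v"
proof -
  have "bij_betw (\<lambda>w. {v, w}) (neighbours G v) {e \<in> edges G. v \<in> e}"
    unfolding bij_betw_def
  proof
    show "inj_on (\<lambda>w. {v, w}) (neighbours G v)" by (auto simp: inj_on_def doubleton_eq_iff)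
    show "(\<lambda>w. {v, w}) ` neighbours G v = {e \<in> edges G. v \<in> e}"
    proof
      show "{e \<in> edges G. v \<in> e} \<subseteq> (\<lambda>w. {v, w}) ` neighbours G v"
        using edges_at[OF G] by (metis (mono_tags, lifting) image_eqI mem_Collect_eq subsetI)
    qed (auto simp: neighbours_def)
  qed
  then show ?thesis by (simp add: bij_betw_same_card)
qed

text \<open>Double counting of the incident pairs of a vertex and an edge.\<close>

lemma sum_deg:
  assumes G: "finite_sgraph G"
  shows "(\<Sum>v\<in>verts G. deg G v) = 2 * card (edges G)"
proof -
  note fin = finite_sgraph_edgesD[OF G]
  have "(\<Sum>v\<in>verts G. deg G v) = (\<Sum>v\<in>verts G. \<Sum>e\<in>edges G. if v \<in> e then 1 else 0)"
    using fin(2) by (simp add: card_edges_at[OF G, symmetric] sum.If_cases Int_def)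
  also have "\<dots> = (\<Sum>e\<in>edges G. \<Sum>v\<in>verts G. if v \<in> e then 1 else 0)"
    by (rule sum.swap)
  also have "\<dots> = (\<Sum>e\<in>edges G. 2)"
  proof (rule sum.cong)
    fix e assume e: "e \<in> edges G"
    have "verts G \<inter> e = e" using fin(3)[OF e] by auto
    then show "(\<Sum>v\<in>verts G. if v \<in> e then 1 else 0) = (2::nat)"
      using fin(1) fin(4)[OF e] by (simp add: sum.If_cases Int_def)
  qed simp
  finally show ?thesis by simp
qed

lemma verts_del_verts [simp]: "verts (del_verts G X) = verts G - X"
  by (simp add: del_verts_def)

lemma neighbours_del_verts: "neighbours (del_verts G {v}) u = (if u = v then {} else neighbours G u - {v})"
  by (auto simp: neighbours_def del_verts_def)

lemma del_verts_del_verts: "del_verts (del_verts G X) Y = del_verts G (X \<union> Y)"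
  by (auto simp: del_verts_def)

lemma del_verts_empty [simp]: "del_verts G {} = G"
  by (simp add: del_verts_def)

lemma card_edges_del_vert:
  assumes G: "finite_sgraph G"
  shows "card (edges (del_verts G {v})) + deg G v = card (edges G)"
proof -
  have "edges G = edges (del_verts G {v}) \<union> {e \<in> edges G. v \<in> e}"
    by (auto simp: del_verts_def)
  moreover have "card (edges (del_verts G {v}) \<union> {e \<in> edges G. v \<in> e})
      = card (edges (del_verts G {v})) + card {e \<in> edges G. v \<in> e}"
    using finite_sgraph_edgesD(2)[OF G] by (intro card_Un_disjoint) (auto simp: del_verts_def)
  ultimately show ?thesis by (simp add: card_edges_at[OF G])
qed

lemma card_verts_del_vert:
  "finite_sgraph G \<Longrightarrow> v \<in> verts G \<Longrightarrow> card (verts (del_verts G {v})) = card (verts G) - 1"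
  using finite_sgraph_edgesD(1) by (simp add: card_Diff_singleton)

lemma deg_del_vert:
  assumes "finite_sgraph G" "u \<noteq> v"
  shows "deg (del_verts G {v}) u = deg G u - (if v \<in> neighbours G u then 1 else 0)"
  using assms finite_neighbours[OF assms(1)] by (simp add: neighbours_del_verts card_Diff_singleton)

lemma deg_del_vert_bounds:
  assumes "finite_sgraph G" "u \<in> verts (del_verts G {v})" "v \<in> verts G"
  shows "deg G u \<le> Suc (deg (del_verts G {v}) u)" "deg (del_verts G {v}) u \<le> deg G u"
  using assms deg_del_vert[OF assms(1), of u v] by auto

lemma deg_less:
  assumes "finite_sgraph G" "v \<in> verts G"
  shows "deg G v < card (verts G)"
proof -
  have "deg G v \<le> card (verts G - {v})"
    using neighbours_subset[OF assms(1), of v] finite_sgraph_edgesD(1)[OF assms(1)] by (intro card_mono) auto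
  also have "\<dots> < card (verts G)"
    using assms finite_sgraph_edgesD(1)[OF assms(1)] by (intro psubset_card_mono) auto
  finally show ?thesis .
qed

lemma sum_deg_lower:
  assumes "finite_sgraph G" "\<And>u. u \<in> verts G \<Longrightarrow> k \<le> deg G u"
  shows "k * card (verts G) \<le> 2 * card (edges G)"
  using sum_bounded_below[of "verts G" k "deg G"] assms sum_deg[OF assms(1)] by (simp add: mult.commute)

lemma sum_deg_upper:
  assumes "finite_sgraph G" "\<And>u. u \<in> verts G \<Longrightarrow> deg G u \<le> k"
  shows "2 * card (edges G) \<le> k * card (verts G)"
  using sum_bounded_above[of "verts G" "deg G" k] assms sum_deg[OF assms(1)] by (simp add: mult.commute)

lemma max_deg_vertex:
  assumes "finite_sgraph G" "verts G \<noteq> {}"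
  obtains v where "v \<in> verts G" "\<And>u. u \<in> verts G \<Longrightarrow> deg G u \<le> deg G v"
    "2 * card (edges G) \<le> deg G v * card (verts G)"
proof -
  have fin: "finite (deg G ` verts G)" "deg G ` verts G \<noteq> {}"
    using assms finite_sgraph_edgesD(1)[OF assms(1)] by auto
  obtain v where v: "v \<in> verts G" "deg G v = Max (deg G ` verts G)"
    using Max_in[OF fin] by auto
  then have "deg G u \<le> deg G v" if "u \<in> verts G" for u
    using Max_ge[OF fin(1)] that by simp
  with v sum_deg_upper[OF assms(1)] that show thesis by blast
qed

lemma low_deg_vertex:
  assumes "finite_sgraph G" "2 * card (edges G) < 3 * card (verts G)"
  obtains v where "v \<in> verts G" "deg G v \<le> 2"
proof -
  have "\<exists>v\<in>verts G. deg G v \<le> 2"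
  proof (rule ccontr)
    assume "\<not> ?thesis"
    then have "\<And>u. u \<in> verts G \<Longrightarrow> 3 \<le> deg G u" by force
    then show False using sum_deg_lower[OF assms(1), of 3] assms(2) by auto
  qed
  then show thesis using that by blast
qed

subsection \<open>Apex graphs\<close>

text \<open>The parameter allows descent: deleting a vertex lowers it by one, down to planarity at
  0.\<close>

definition apex :: "nat \<Rightarrow> 'a sgraph \<Rightarrow> bool" where
  "apex k G \<longleftrightarrow> (\<exists>X \<subseteq> verts G. finite X \<and> card X \<le> k \<and> planar (del_verts G X))"

lemma apex_0: "apex 0 G \<longleftrightarrow> planar G"
  by (auto simp: apex_def)

lemma two_apex_iff: "two_apex G \<longleftrightarrow> apex 2 G"
  by (simp add: two_apex_def apex_def)

lemma apex_Suc:
  assumes "v \<in> verts G" "apex k (del_verts G {v})"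
  shows "apex (Suc k) G"
proof -
  obtain X where X: "X \<subseteq> verts G - {v}" "finite X" "card X \<le> k" "planar (del_verts G (insert v X))"
    using assms(2) by (auto simp: apex_def del_verts_del_verts)
  then have "card (insert v X) \<le> Suc k" by (simp add: card_insert_if)
  then show ?thesis unfolding apex_def using X assms(1) by (intro exI[of _ "insert v X"]) auto
qed

lemma neighbours_del_verts_subset: "neighbours (del_verts G X) v \<subseteq> neighbours G v - X"
  by (auto simp: neighbours_def del_verts_def)

text \<open>The set deleted from the smaller graph serves for \<open>G\<close> as well, since a
  vertex of degree at most one can be drawn again.\<close>

lemma apex_del_vert_degree_le_1:
  assumes G: "finite_sgraph G" and v: "v \<in> verts G" and d: "deg G v \<le> 1"
    and ap: "apex k (del_verts G {v})"
  shows "apex k G"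
proof -
  obtain X where X: "X \<subseteq> verts G - {v}" "finite X" "card X \<le> k" "planar (del_verts G (insert v X))"
    using ap by (auto simp: apex_def del_verts_del_verts)
  have "\<forall>a\<in>neighbours G v. \<forall>b\<in>neighbours G v. a = b"
    using d finite_neighbours[OF G, of v] by (simp add: card_le_Suc0_iff_eq)
  then obtain x where x: "neighbours G v \<subseteq> {x}" by blast
  have "planar (del_verts G X)"
  proof (rule planar_del_vert_degree_le_1)
    show "finite_sgraph (del_verts G X)" by (rule finite_sgraph_del_verts[OF G])
    show "v \<in> verts (del_verts G X)" using v X by auto
    show "neighbours (del_verts G X) v \<subseteq> {x}" using neighbours_del_verts_subset[of G X v] x by auto
    show "planar (del_verts (del_verts G X) {v})" using X(4) by (simp add: del_verts_del_verts)
  qed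
  then show ?thesis using X by (auto simp: apex_def)
qed

text \<open>The same set \<open>X\<close> is deleted from \<open>G\<close>. If it contains
  \<open>x\<close> or \<open>y\<close>, then \<open>v\<close> is left with degree at most one and
  can be drawn again; otherwise deleting \<open>X\<close> commutes with smoothing at
  \<open>v\<close>.\<close>

lemma apex_smooth:
  assumes G: "finite_sgraph G" and v: "v \<in> verts G" and N: "neighbours G v = {x, y}" and xy: "x \<noteq> y"
    and ap: "apex k (smooth G v x y)"
  shows "apex k G"
proof -
  have in_G: "x \<in> verts G - {v}" "y \<in> verts G - {v}"
    using neighbours_subset[OF G, of v] N by auto
  obtain X where X: "X \<subseteq> verts G - {v}" "finite X" "card X \<le> k" "planar (del_verts (smooth G v x y) X)"
    using ap by (auto simp: apex_def smooth_def)
  have "planar (del_verts G X)"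
  proof (cases "x \<in> X \<or> y \<in> X")
    case True
    then obtain z where z: "neighbours (del_verts G X) v \<subseteq> {z}"
      using neighbours_del_verts_subset[of G X v] N by auto
    have "del_verts (smooth G v x y) X = del_verts (del_verts G X) {v}"
      using True by (auto simp: smooth_def del_verts_def)
    then show ?thesis
      using planar_del_vert_degree_le_1[OF finite_sgraph_del_verts[OF G] _ z] X v by auto
  next
    case False
    have "del_verts (smooth G v x y) X = smooth (del_verts G X) v x y"
      using False by (auto simp: smooth_def del_verts_def)
    moreover have "neighbours (del_verts G X) v \<subseteq> {x, y}"
      using neighbours_del_verts_subset[of G X v] N by auto
    ultimately show ?thesis
      using planar_smooth[OF finite_sgraph_del_verts[OF G], of v X x y] X v in_G False xy by auto
  qed
  then show ?thesis using X by (auto simp: apex_def)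
qed

lemma smooth_adjacent: "{x, y} \<in> edges G \<Longrightarrow> v \<notin> {x, y} \<Longrightarrow> smooth G v x y = del_verts G {v}"
  by (auto simp: smooth_def del_verts_def)

lemma card_edges_smooth:
  assumes G: "finite_sgraph G" and N: "neighbours G v = {x, y}" "x \<noteq> y" "{x, y} \<notin> edges G"
  shows "card (edges (smooth G v x y)) = card (edges G) - 1"
proof -
  have "card (edges (smooth G v x y)) = Suc (card (edges (del_verts G {v})))"
    using N(3) finite_sgraph_edgesD(2)[OF finite_sgraph_del_verts[OF G, of "{v}"]]
    by (simp add: smooth_def del_verts_def)
  then show ?thesis using card_edges_del_vert[OF G, of v] N(1,2) by simp
qed

text \<open>At \<open>x\<close> and \<open>y\<close> the neighbour \<open>v\<close> is exchanged for
  the other end of the new edge. If \<open>xy\<close> were an edge already, both would lose a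
  neighbour.\<close>

lemma deg_smooth:
  assumes G: "finite_sgraph G" and N: "neighbours G v = {x, y}" "x \<noteq> y" "{x, y} \<notin> edges G"
    and u: "u \<noteq> v"
  shows "deg (smooth G v x y) u = deg G u"
proof -
  have vxy: "v \<notin> {x, y}" using neighbours_irrefl[OF G] N by metis
  have nb: "v \<in> neighbours G u \<longleftrightarrow> u = x \<or> u = y" using N(1) neighbours_sym[of v G u] by auto
  have new: "y \<notin> neighbours G x" "x \<notin> neighbours G y" using N(3) by (auto simp: neighbours_def insert_commute)
  have sm: "neighbours (smooth G v x y) u = neighbours (del_verts G {v}) u \<union> (if u = x then {y} else if u = y then {x} else {})"
    using N(2) by (auto simp: neighbours_def smooth_def doubleton_eq_iff)
  have del: "neighbours (del_verts G {v}) u = neighbours G u - {v}" using u by (simp add: neighbours_del_verts)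
  note fin = finite_neighbours[OF G, of u]
  have pos: "v \<in> neighbours G u \<Longrightarrow> 0 < deg G u" using fin card_gt_0_iff by blast
  show ?thesis unfolding sm del using nb new N(2) fin pos by (auto simp: card_Diff_singleton)
qed

lemma card_verts_smooth: "finite_sgraph G \<Longrightarrow> v \<in> verts G \<Longrightarrow> card (verts (smooth G v x y)) = card (verts G) - 1"
  using finite_sgraph_edgesD(1) by (simp add: smooth_def card_Diff_singleton)

subsection \<open>Codes of graphs\<close>

text \<open>A graph on \<open>{..<n}\<close> is coded by the list whose entry \<open>j\<close> contains the neighbours of \<open>j\<close> that are below \<open>j\<close>.\<close>

definition adj :: "nat list list \<Rightarrow> nat \<Rightarrow> nat \<Rightarrow> bool" where
  "adj A i j = (if i < j then i \<in> set (A ! j) else if j < i then j \<in> set (A ! i) else False)"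

definition coding :: "nat list list \<Rightarrow> 'a sgraph \<Rightarrow> (nat \<Rightarrow> 'a) \<Rightarrow> bool" where
  "coding A G f \<longleftrightarrow> bij_betw f {..<length A} (verts G) \<and>
     (\<forall>i<length A. \<forall>j<length A. {f i, f j} \<in> edges G \<longleftrightarrow> adj A i j)"

definition codes :: "nat list list \<Rightarrow> 'a sgraph \<Rightarrow> bool" where
  "codes A G \<longleftrightarrow> (\<exists>f. coding A G f)"

definition listed :: "nat list list list \<Rightarrow> 'a sgraph \<Rightarrow> bool" where
  "listed L G \<longleftrightarrow> (\<exists>A\<in>set L. codes A G)"

lemma adj_sym: "adj A i j = adj A j i"
  by (auto simp: adj_def)

text \<open>Entry \<open>i\<close> of \<open>q\<close> is the vertex of \<open>A\<close> that takes
  the place of vertex \<open>i\<close> of \<open>B\<close>. Only pairs \<open>i < j\<close> are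
  compared, since adjacency is symmetric.\<close>

definition iso_check :: "nat list list \<Rightarrow> nat list list \<Rightarrow> nat list \<Rightarrow> bool" where
  "iso_check A B q \<longleftrightarrow> length q = length B \<and> length A = length B \<and> distinct q \<and> (\<forall>x\<in>set q. x < length A) \<and>
     (\<forall>j\<in>set [0..<length B]. \<forall>i\<in>set [0..<j]. (i \<in> set (B ! j)) = adj A (q ! i) (q ! j))"

lemma codes_iso_check:
  assumes "codes A G" "iso_check A B q"
  shows "codes B G"
proof -
  obtain f where f: "coding A G f" using assms(1) by (auto simp: codes_def)
  note q = assms(2)[unfolded iso_check_def]
  have "set q \<subseteq> {..<length A}" using q by auto
  moreover have "card (set q) = length A" using q by (simp add: distinct_card)
  ultimately have "set q = {..<length A}" by (intro card_subset_eq) auto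
  then have "bij_betw ((!) q) {..<length B} {..<length A}"
    using q by (intro bij_betw_nth) auto
  then have "bij_betw (f \<circ> (!) q) {..<length B} (verts G)"
    using f by (auto simp: coding_def intro: bij_betw_trans)
  moreover have "{(f \<circ> (!) q) i, (f \<circ> (!) q) j} \<in> edges G \<longleftrightarrow> adj B i j" if "i < length B" "j < length B" for i j
  proof -
    have "q ! i < length A" "q ! j < length A" using q that by auto
    then have "{f (q ! i), f (q ! j)} \<in> edges G \<longleftrightarrow> adj A (q ! i) (q ! j)"
      using f by (auto simp: coding_def)
    also have "\<dots> \<longleftrightarrow> adj B i j"
    proof (cases i j rule: linorder_cases)
      case less then show ?thesis using q that by (auto simp: adj_def[of B])
    next
      case equal then show ?thesis by (simp add: adj_def)
    next
      case greater then show ?thesis using q that by (auto simp: adj_def[of B] adj_sym[of A "q ! i"])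
    qed
    finally show ?thesis by simp
  qed
  ultimately show ?thesis unfolding codes_def coding_def by blast
qed

section \<open>Degrees in codes and candidate neighbourhoods\<close>

definition degs :: "nat list list \<Rightarrow> nat list" where
  "degs A = map (\<lambda>i. length (filter (adj A i) [0..<length A])) [0..<length A]"

lemma length_degs [simp]: "length (degs A) = length A"
  by (simp add: degs_def)

lemma coding_surj:
  assumes "coding A G f" "v \<in> verts G"
  obtains i where "i < length A" "v = f i"
proof -
  have "f ` {..<length A} = verts G" using assms(1) by (auto simp: coding_def bij_betw_def)
  then have "v \<in> f ` {..<length A}" using assms(2) by simp
  then show thesis using that by blast
qed

lemma list_all2_witness: "list_all2 P xs ys \<Longrightarrow> x \<in> set xs \<Longrightarrow> \<exists>y. P x y"
  by (metis in_set_conv_nth list_all2_nthD)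

lemma coding_neighbours:
  assumes G: "finite_sgraph G" and f: "coding A G f" and i: "i < length A"
  shows "neighbours G (f i) = f ` {j. j < length A \<and> adj A i j}"
proof
  show "neighbours G (f i) \<subseteq> f ` {j. j < length A \<and> adj A i j}"
  proof
    fix w assume w: "w \<in> neighbours G (f i)"
    then have "w \<in> verts G" using neighbours_subset[OF G] by blast
    then obtain j where "j < length A" "w = f j" using coding_surj[OF f] by blast
    then show "w \<in> f ` {j. j < length A \<and> adj A i j}"
      using w f i by (auto simp: coding_def neighbours_def)
  qed
qed (use f i in \<open>auto simp: coding_def neighbours_def\<close>)

lemma coding_deg:
  assumes "finite_sgraph G" "coding A G f" "i < length A"
  shows "deg G (f i) = degs A ! i"
proof -
  have "inj_on f {j. j < length A \<and> adj A i j}"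
    using assms(2) by (auto simp: coding_def bij_betw_def inj_on_def)
  then have "deg G (f i) = card {j. j < length A \<and> adj A i j}"
    by (simp add: coding_neighbours[OF assms] card_image)
  also have "{j. j < length A \<and> adj A i j} = set (filter (adj A i) [0..<length A])" by auto
  also have "card \<dots> = degs A ! i" using assms(3) by (subst distinct_card) (auto simp: degs_def)
  finally show ?thesis .
qed

lemma coding_sum_degs:
  assumes "finite_sgraph G" "coding A G f"
  shows "sum_list (degs A) = 2 * card (edges G)"
proof -
  have "2 * card (edges G) = (\<Sum>i<length A. deg G (f i))"
    using sum.reindex_bij_betw[of f "{..<length A}" "verts G" "deg G"] assms by (simp add: coding_def sum_deg)
  also have "\<dots> = (\<Sum>i<length A. degs A ! i)"
    using coding_deg[OF assms] by simp
  finally show ?thesis by (simp add: sum_list_sum_nth atLeast0LessThan)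
qed

text \<open>\<open>exts lo hi k i ds\<close> lists the possible neighbourhoods of size \<open>k\<close> of a new vertex: a vertex \<open>i + j\<close>
  of degree \<open>ds ! j\<close> has to reach degree at least \<open>lo\<close> and may not be joined if its degree is \<open>hi\<close> already.\<close>

fun exts :: "nat \<Rightarrow> nat \<Rightarrow> nat \<Rightarrow> nat \<Rightarrow> nat list \<Rightarrow> nat list list" where
  "exts lo hi k i [] = (if k = 0 then [[]] else [])"
| "exts lo hi k i (d # ds) =
     (if lo \<le> d then exts lo hi k (Suc i) ds else []) @
     (if 0 < k \<and> d < hi \<and> lo \<le> Suc d then map ((#) i) (exts lo hi (k - 1) (Suc i) ds) else [])"

text \<open>Induction along \<open>ds\<close>, where the head decides whether \<open>i\<close>
  belongs to \<open>U\<close>. Completeness turns a finite check over \<open>exts\<close> into a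
  statement about all graphs.\<close>

lemma exts_complete:
  assumes "U \<subseteq> {i..<i + length ds}" "card U = k"
    and "\<And>j. j < length ds \<Longrightarrow> lo \<le> ds ! j + (if i + j \<in> U then 1 else 0)"
    and "\<And>j. j < length ds \<Longrightarrow> i + j \<in> U \<Longrightarrow> ds ! j < hi"
  shows "\<exists>S\<in>set (exts lo hi k i ds). set S = U"
  using assms
proof (induction ds arbitrary: i k U)
  case Nil
  then show ?case by auto
next
  case (Cons d ds)
  have fin: "finite U" using Cons.prems(1) finite_subset by blast
  have lo: "lo \<le> ds ! j + (if Suc i + j \<in> U then 1 else 0)" if "j < length ds" for j
    using Cons.prems(3)[of "Suc j"] that by simp
  have hi: "ds ! j < hi" if "j < length ds" "Suc i + j \<in> U" for j
    using Cons.prems(4)[of "Suc j"] that by simp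
  show ?case
  proof (cases "i \<in> U")
    case True
    have "\<exists>S\<in>set (exts lo hi (k - 1) (Suc i) ds). set S = U - {i}"
    proof (rule Cons.IH)
      show "U - {i} \<subseteq> {Suc i..<Suc i + length ds}" using Cons.prems(1) by fastforce
      show "card (U - {i}) = k - 1" using True Cons.prems(2) fin by (simp add: card_Diff_singleton)
    qed (use lo hi in auto)
    then obtain S where "S \<in> set (exts lo hi (k - 1) (Suc i) ds)" "set S = U - {i}" by blast
    moreover have "0 < k" using True Cons.prems(2) fin card_gt_0_iff by blast
    moreover have "d < hi" "lo \<le> Suc d" using True Cons.prems(3,4)[of 0] by auto
    ultimately show ?thesis using True by (intro bexI[of _ "i # S"]) auto
  next
    case False
    have "\<exists>S\<in>set (exts lo hi k (Suc i) ds). set S = U"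
    proof (rule Cons.IH)
      show "U \<subseteq> {Suc i..<Suc i + length ds}"
      proof
        fix x assume "x \<in> U"
        then have "x \<in> {i..<i + length (d # ds)}" "x \<noteq> i" using Cons.prems(1) False by auto
        then show "x \<in> {Suc i..<Suc i + length ds}" by auto
      qed
    qed (use lo hi Cons.prems(2) in auto)
    moreover have "lo \<le> d" using False Cons.prems(3)[of 0] by auto
    ultimately show ?thesis by auto
  qed
qed

subsection \<open>Certificates\<close>

definition graph_of :: "nat list list \<Rightarrow> nat sgraph" where
  "graph_of A = ({..<length A}, {{i, j} | i j. i < length A \<and> j < length A \<and> adj A i j})"

definition edge_list :: "nat list list \<Rightarrow> (nat \<times> nat) list" where
  "edge_list A = concat (map (\<lambda>j. map (\<lambda>i. (i, j)) (filter (\<lambda>i. i < j) (A ! j))) [0..<length A])"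

lemma set_edge_list: "set (edge_list A) = {(i, j). i < j \<and> j < length A \<and> adj A i j}"
  by (auto simp: edge_list_def adj_def)

text \<open>Twice the signed area of the triangle of the three points; the sign tells on which side
  of the line through the first two the third one lies.\<close>

fun cross :: "int \<times> int \<Rightarrow> int \<times> int \<Rightarrow> int \<times> int \<Rightarrow> int" where
  "cross (ax, ay) (bx, by) (cx, cy) = (bx - ax) * (cy - ay) - (by - ay) * (cx - ax)"

text \<open>Edges without a common end have to be separated by the line through one of them. Edges
  with a common end are left to the collinearity test in \<open>straight_line\<close>.\<close>

definition compatible :: "(int \<times> int) list \<Rightarrow> nat \<times> nat \<Rightarrow> nat \<times> nat \<Rightarrow> bool" where
  "compatible P = (\<lambda>(a, b) (c, d). a = c \<or> a = d \<or> b = c \<or> b = d \<or>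
     0 < cross (P ! a) (P ! b) (P ! c) * cross (P ! a) (P ! b) (P ! d) \<or>
     0 < cross (P ! c) (P ! d) (P ! a) * cross (P ! c) (P ! d) (P ! b))"

definition straight_line :: "nat list list \<Rightarrow> (int \<times> int) list \<Rightarrow> bool" where
  "straight_line A P \<longleftrightarrow> length P = length A \<and> distinct P \<and>
     list_all (\<lambda>(a, b). list_all (\<lambda>c. c = a \<or> c = b \<or> cross (P ! a) (P ! b) (P ! c) \<noteq> 0) [0..<length A]) (edge_list A) \<and>
     sorted_wrt (compatible P) (edge_list A)"

definition plane_point :: "int \<times> int \<Rightarrow> complex" where
  "plane_point P = Complex (of_int (fst P)) (of_int (snd P))"

text \<open>The function \<open>cross P Q\<close> extended from integer points to the whole plane;
  it is affine along segments.\<close>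

definition side :: "int \<times> int \<Rightarrow> int \<times> int \<Rightarrow> complex \<Rightarrow> real" where
  "side P Q z = (of_int (fst Q) - of_int (fst P)) * (Im z - of_int (snd P)) -
     (of_int (snd Q) - of_int (snd P)) * (Re z - of_int (fst P))"

lemma side_plane_point: "side P Q (plane_point R) = of_int (cross P Q R)"
  by (cases P; cases Q; cases R) (simp add: side_def plane_point_def)

lemma side_segment:
  "side P Q ((1 - t) *\<^sub>R y + t *\<^sub>R z) = (1 - t) * side P Q y + t * side P Q z"
  by (simp add: side_def algebra_simps)

lemma side_on_segment:
  assumes "z \<in> closed_segment (plane_point P) (plane_point Q)"
  shows "side P Q z = 0"
proof -
  obtain t where "z = (1 - t) *\<^sub>R plane_point P + t *\<^sub>R plane_point Q"
    using assms by (auto simp: closed_segment_def)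
  moreover have "cross P Q P = 0" "cross P Q Q = 0" by (cases P; cases Q; simp)+
  ultimately show ?thesis by (simp add: side_segment side_plane_point)
qed

lemma side_off_segment:
  assumes "z \<in> closed_segment (plane_point R) (plane_point S)" "0 < cross P Q R * cross P Q S"
  shows "side P Q z \<noteq> 0"
proof -
  obtain t where t: "0 \<le> t" "t \<le> 1" "z = (1 - t) *\<^sub>R plane_point R + t *\<^sub>R plane_point S"
    using assms(1) by (auto simp: closed_segment_def)
  define x y where "x = real_of_int (cross P Q R)" and "y = real_of_int (cross P Q S)"
  have z: "side P Q z = (1 - t) * x + t * y"
    by (simp only: t(3) side_segment side_plane_point x_def y_def)
  have "0 < x * y" using assms(2) by (simp add: x_def y_def flip: of_int_mult)
  then consider "0 < x" "0 < y" | "x < 0" "y < 0" by (auto simp: zero_less_mult_iff)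
  then show ?thesis
  proof cases
    case 1
    have "0 < (1 - t) * x + t * y"
      using 1 t(1,2) by (cases "t = 0") (auto intro: add_nonneg_pos)
    then show ?thesis using z by simp
  next
    case 2
    have "(1 - t) * x + t * y < 0"
    proof (cases "t = 0")
      case False
      then have "t * y < 0" using 2 t(1) by (intro mult_pos_neg) auto
      moreover have "(1 - t) * x \<le> 0" using 2 t(2) by (intro mult_nonneg_nonpos) auto
      ultimately show ?thesis by linarith
    qed (use 2 in simp)
    then show ?thesis using z by simp
  qed
qed

text \<open>Along the segment from \<open>P\<close> to \<open>R\<close> the affine function
  \<open>side P Q\<close> vanishes at \<open>P\<close> only, while it is zero on the whole segment
  from \<open>P\<close> to \<open>Q\<close>.\<close>

lemma segments_common_end:
  assumes "z \<in> closed_segment (plane_point P) (plane_point Q)"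
    "z \<in> closed_segment (plane_point P) (plane_point R)" "cross P Q R \<noteq> 0"
  shows "z = plane_point P"
proof -
  obtain t where t: "z = (1 - t) *\<^sub>R plane_point P + t *\<^sub>R plane_point R"
    using assms(2) by (auto simp: closed_segment_def)
  have "cross P Q P = 0" by (cases P; cases Q; simp)
  then have "t * of_int (cross P Q R) = 0"
    using side_on_segment[OF assms(1)] by (simp add: t side_segment side_plane_point)
  then show ?thesis using t assms(3) by simp
qed

text \<open>The collinearity test keeps vertices off the edges and lets edges with a common end meet
  only there. For any other pair, one segment lies strictly on one side of the line through the
  other.\<close>

lemma planar_straight_line:
  assumes "straight_line A P"
  shows "planar (graph_of A)"
proof -
  have len: "length P = length A" and dist: "distinct P" and cmp: "sorted_wrt (compatible P) (edge_list A)"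
    using assms by (auto simp: straight_line_def)
  have gen: "cross (P ! a) (P ! b) (P ! c) \<noteq> 0" if "(a, b) \<in> set (edge_list A)" "c < length A" "c \<noteq> a" "c \<noteq> b" for a b c
  proof -
    have "\<forall>(a, b)\<in>set (edge_list A). \<forall>c<length A. c = a \<or> c = b \<or> cross (P ! a) (P ! b) (P ! c) \<noteq> 0"
      using assms by (simp add: straight_line_def list_all_iff case_prod_beta atLeast0LessThan)
    from bspec[OF this that(1)] have "\<forall>c<length A. c = a \<or> c = b \<or> cross (P ! a) (P ! b) (P ! c) \<noteq> 0"
      by simp
    then show ?thesis using that(2-4) by blast
  qed
  have sym: "compatible P e e'" if "compatible P e' e" for e e'
    using that by (auto simp: compatible_def split: prod.splits)
  have cmp: "compatible P e e'" if e: "e \<in> set (edge_list A)" "e' \<in> set (edge_list A)" and ne: "e \<noteq> e'" for e e'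
  proof -
    obtain i j where ij: "i < length (edge_list A)" "j < length (edge_list A)" "edge_list A ! i = e" "edge_list A ! j = e'"
      using e by (auto simp: in_set_conv_nth)
    show ?thesis
    proof (cases i j rule: linorder_cases)
      case less then show ?thesis using sorted_wrt_nth_less[OF cmp less ij(2)] ij by simp
    next
      case equal then show ?thesis using ij ne by simp
    next
      case greater then show ?thesis using sorted_wrt_nth_less[OF cmp greater ij(1)] ij sym by simp
    qed
  qed
  define p where "p i = plane_point (P ! i)" for i
  have inj: "inj_on p {..<length A}"
  proof (rule inj_onI)
    fix i j assume ij: "i \<in> {..<length A}" "j \<in> {..<length A}" "p i = p j"
    then have "P ! i = P ! j" by (simp add: p_def plane_point_def prod_eq_iff)
    then show "i = j" using ij dist len by (simp add: nth_eq_iff_index_eq)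
  qed
  \<comment> \<open>\<open>Min\<close> and \<open>Max\<close> orient an edge, so that its curve
    depends on the set only.\<close>
  define \<gamma> where "\<gamma> e = linepath (p (Min e)) (p (Max e))" for e
  have edge: "\<exists>a b. (a, b) \<in> set (edge_list A) \<and> e = {a, b} \<and> a < b \<and> b < length A \<and> \<gamma> e = linepath (p a) (p b)"
    if e: "e \<in> edges (graph_of A)" for e
  proof -
    obtain i j where ij: "e = {i, j}" "i < length A" "j < length A" "adj A i j" using e by (auto simp: graph_of_def)
    have "\<gamma> {a, b} = linepath (p a) (p b)" if "a < b" for a b :: nat
      using that by (simp add: \<gamma>_def)
    moreover have "i < j \<or> j < i" using ij(4) by (auto simp: adj_def split: if_splits)
    then obtain a b where "a < b" "b < length A" "adj A a b" "e = {a, b}"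
      using ij adj_sym[of A i j] by (metis insert_commute)
    ultimately show ?thesis by (auto simp: set_edge_list)
  qed
  have on_edge: "z \<in> {p a, p b}"
    if "(a, b) \<in> set (edge_list A)" "c < length A" "z = p c" "z \<in> closed_segment (p a) (p b)" for a b c z
  proof (rule ccontr)
    assume "z \<notin> {p a, p b}"
    then have "cross (P ! a) (P ! b) (P ! c) \<noteq> 0" using gen[OF that(1,2)] that(3) by auto
    then show False
      using side_on_segment[of z "P ! a" "P ! b"] that(3,4) by (simp add: p_def side_plane_point)
  qed
  have meet: "z \<in> p ` ({a, b} \<inter> {c, d})"
    if ab: "(a, b) \<in> set (edge_list A)" and cd: "(c, d) \<in> set (edge_list A)" and ne: "(a, b) \<noteq> (c, d)"
      and z: "z \<in> closed_segment (p a) (p b)" "z \<in> closed_segment (p c) (p d)" for a b c d z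
  proof -
    have lt: "a < b" "b < length A" "c < d" "d < length A" using ab cd by (auto simp: set_edge_list)
    have share: "z = p x"
      if "(x, y) \<in> set (edge_list A) \<or> (y, x) \<in> set (edge_list A)" "w < length A" "w \<noteq> x" "w \<noteq> y"
        "z \<in> closed_segment (p x) (p y)" "z \<in> closed_segment (p x) (p w)" for x y w
    proof -
      have "cross (P ! x) (P ! y) (P ! w) \<noteq> 0"
      proof (cases "(x, y) \<in> set (edge_list A)")
        case True then show ?thesis using gen that by blast
      next
        case False
        then have "cross (P ! y) (P ! x) (P ! w) \<noteq> 0" using gen that by blast
        then show ?thesis by (cases "P ! x"; cases "P ! y"; cases "P ! w") (auto simp: algebra_simps)
      qed
      then show ?thesis using segments_common_end that(5,6) unfolding p_def by blast
    qed
    consider "a = c" "b \<noteq> d" | "a = d" | "b = c" | "b = d" "a \<noteq> c"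
      | "0 < cross (P ! a) (P ! b) (P ! c) * cross (P ! a) (P ! b) (P ! d)"
      | "0 < cross (P ! c) (P ! d) (P ! a) * cross (P ! c) (P ! d) (P ! b)"
      using cmp[OF ab cd ne] ne by (auto simp: compatible_def)
    then show ?thesis
    proof cases
      case 1 then show ?thesis using share[of a b d] ab z lt by auto
    next
      case 2 then show ?thesis using share[of a b c] ab z lt by (auto simp: closed_segment_commute)
    next
      case 3 then show ?thesis using share[of b a d] ab z lt by (auto simp: closed_segment_commute)
    next
      case 4 then show ?thesis using share[of b a c] ab z lt by (auto simp: closed_segment_commute)
    next
      case 5
      then show ?thesis using side_off_segment[OF z(2)[unfolded p_def] 5] side_on_segment[OF z(1)[unfolded p_def]] by simp
    next
      case 6
      then show ?thesis using side_off_segment[OF z(1)[unfolded p_def] 6] side_on_segment[OF z(2)[unfolded p_def]] by simp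
    qed
  qed
  have "drawing (graph_of A) p \<gamma>"
    unfolding drawing_def
  proof (intro conjI ballI impI)
    show "inj_on p (verts (graph_of A))" using inj by (simp add: graph_of_def)
  next
    fix e assume "e \<in> edges (graph_of A)"
    then obtain a b where e: "(a, b) \<in> set (edge_list A)" "e = {a, b}" "a < b" "b < length A" "\<gamma> e = linepath (p a) (p b)"
      using edge by blast
    then have "p a \<noteq> p b" using inj by (auto simp: inj_on_def)
    then show "arc (\<gamma> e)" using e(5) by simp
    show "{pathstart (\<gamma> e), pathfinish (\<gamma> e)} = p ` e" using e by simp
    show "path_image (\<gamma> e) \<inter> p ` verts (graph_of A) = p ` e"
      using on_edge[OF e(1)] e by (auto simp: graph_of_def)
  next
    fix e e' assume "e \<in> edges (graph_of A)" "e' \<in> edges (graph_of A)" and ne: "e \<noteq> e'"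
    then obtain a b c d where e: "(a, b) \<in> set (edge_list A)" "e = {a, b}" "\<gamma> e = linepath (p a) (p b)"
      and e': "(c, d) \<in> set (edge_list A)" "e' = {c, d}" "\<gamma> e' = linepath (p c) (p d)"
      using edge by metis
    have ne: "(a, b) \<noteq> (c, d)" using ne e e' by auto
    have im: "path_image (\<gamma> e) = closed_segment (p a) (p b)" "path_image (\<gamma> e') = closed_segment (p c) (p d)"
      by (simp_all add: e(3) e'(3))
    show "path_image (\<gamma> e) \<inter> path_image (\<gamma> e') = p ` (e \<inter> e')"
    proof
      show "path_image (\<gamma> e) \<inter> path_image (\<gamma> e') \<subseteq> p ` (e \<inter> e')"
        unfolding im unfolding e(2) e'(2) using meet[OF e(1) e'(1) ne] by auto
      show "p ` (e \<inter> e') \<subseteq> path_image (\<gamma> e) \<inter> path_image (\<gamma> e')"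
        unfolding im unfolding e(2) e'(2) by auto
    qed
  qed
  then show ?thesis by (auto simp: planar_iff_drawing)
qed

text \<open>A plane triangulation in which all the planar graphs needed below can be found.\<close>

definition host :: "nat list list" where
  "host = [[], [0], [0, 1], [], [0, 1, 2, 3], [3], [2, 3, 4], [2, 6], [2, 3, 5, 6], [2, 3, 4, 5, 8], [0, 1, 4],
     [1, 2, 4, 6, 7]]"

text \<open>For a straight drawing with integer coordinates all conditions are about signs of
  integers, which evaluation decides.\<close>

lemma planar_host: "planar (graph_of host)"
proof (rule planar_straight_line)
  show "straight_line host [(14, 1), (10, 2), (0, 0), (11, 13), (21, 0), (8, 17), (13, 6), (10, 4), (7, 17), (6, 21),
      (15, 1), (11, 3)]"
    by code_simp
qed

text \<open>The certificate \<open>c\<close> shows that \<open>A @ [S]\<close> is \<open>k\<close>-apex: it sends the vertices to vertices of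
  \<open>host\<close>, up to at most \<open>k\<close> vertices sent to numbers outside \<open>host\<close>, which are the ones to delete.
  The last entry is the image of the new vertex.\<close>

definition certificate :: "nat \<Rightarrow> nat list list \<Rightarrow> nat list \<Rightarrow> bool" where
  "certificate k A c \<longleftrightarrow> length c = Suc (length A) \<and> distinct c \<and> last c < length host \<and>
     length (filter (\<lambda>x. length host \<le> x) c) \<le> k \<and>
     (\<forall>j\<in>set [0..<length A]. \<forall>i\<in>set [0..<j]. adj A i j \<longrightarrow>
        length host \<le> c ! i \<or> length host \<le> c ! j \<or> adj host (c ! i) (c ! j))"

text \<open>Kept apart from \<open>certificate\<close>, because only this part depends on the
  neighbourhood \<open>S\<close>: one embedding \<open>c\<close> of \<open>A\<close> with a place
  for the new vertex settles every \<open>S\<close> within a fixed set.\<close>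

definition covers :: "nat list \<Rightarrow> nat list \<Rightarrow> bool" where
  "covers c S \<longleftrightarrow> (\<forall>i\<in>set S. length host \<le> c ! i \<or> adj host (c ! i) (last c))"

lemma apex_certificate:
  assumes G: "finite_sgraph G" and f: "coding (A @ [S]) G f"
    and c: "certificate k A c" "covers c S"
  shows "apex k G"
proof -
  let ?n = "length A"
  have len: "length c = Suc ?n" and dist: "distinct c"
    and del: "length (filter (\<lambda>x. length host \<le> x) c) \<le> k"
    and edge: "\<And>i j. i < j \<Longrightarrow> j < ?n \<Longrightarrow> adj A i j \<Longrightarrow>
        length host \<le> c ! i \<or> length host \<le> c ! j \<or> adj host (c ! i) (c ! j)"
    using c(1) by (auto simp: certificate_def)
  have cov: "\<And>i. i \<in> set S \<Longrightarrow> length host \<le> c ! i \<or> adj host (c ! i) (last c)"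
    using c(2) by (simp add: covers_def)
  have bij: "bij_betw f {..<Suc ?n} (verts G)" using f by (simp add: coding_def)
  define g where "g = the_inv_into {..<Suc ?n} f"
  have gf: "g (f i) = i" if "i < Suc ?n" for i
    unfolding g_def using that bij by (intro the_inv_into_f_f) (auto simp: bij_betw_def)
  have last: "last c = c ! ?n" using len by (cases c rule: rev_cases) (auto simp: nth_append)
  define Y where "Y = {i. i < Suc ?n \<and> length host \<le> c ! i}"
  define X where "X = f ` Y"
  have V: "\<exists>i<Suc ?n. v = f i" if "v \<in> verts G" for v
    using that bij by (auto simp: bij_betw_def)
  have X_iff: "f i \<in> X \<longleftrightarrow> length host \<le> c ! i" if "i < Suc ?n" for i
  proof
    assume "f i \<in> X"
    then obtain j where j: "j \<in> Y" "f i = f j" unfolding X_def by blast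
    then have "j < Suc ?n" "length host \<le> c ! j" by (simp_all add: Y_def)
    moreover from this have "i = j" using gf[of j] gf[OF that] j(2) by metis
    ultimately show "length host \<le> c ! i" by simp
  next
    assume "length host \<le> c ! i"
    then show "f i \<in> X" unfolding X_def Y_def using that by blast
  qed
  have "card Y = length (filter (\<lambda>x. length host \<le> x) c)"
    unfolding Y_def by (simp add: length_filter_conv_card len)
  moreover have "finite Y" by (simp add: Y_def)
  ultimately have "finite X" "card X \<le> k"
    unfolding X_def using del card_image_le[of Y f] by auto
  moreover have "X \<subseteq> verts G" unfolding X_def Y_def using bij by (auto simp: bij_betw_def)
  moreover have "planar (del_verts G X)"
  proof (rule planar_embed[OF planar_host, of "\<lambda>v. c ! g v"])
    show "inj_on (\<lambda>v. c ! g v) (verts (del_verts G X))"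
    proof (rule inj_onI)
      fix u v assume "u \<in> verts (del_verts G X)" "v \<in> verts (del_verts G X)" "c ! g u = c ! g v"
      moreover from this obtain i j where ij: "i < Suc ?n" "j < Suc ?n" "u = f i" "v = f j"
        using V[of u] V[of v] by auto
      moreover have "g u = i" "g v = j" using ij gf by auto
      ultimately show "u = v" using nth_eq_iff_index_eq[OF dist, of i j] len by simp
    qed
    show "(\<lambda>v. c ! g v) ` verts (del_verts G X) \<subseteq> verts (graph_of host)"
    proof
      fix t assume "t \<in> (\<lambda>v. c ! g v) ` verts (del_verts G X)"
      then obtain v where v: "v \<in> verts G" "v \<notin> X" "t = c ! g v" by auto
      then obtain i where "i < Suc ?n" "v = f i" using V by blast
      then have "i < Suc ?n" "f i \<notin> X" "t = c ! i" using v gf[of i] by auto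
      then show "t \<in> verts (graph_of host)" using X_iff by (auto simp: graph_of_def)
    qed
  next
    fix e assume "e \<in> edges (del_verts G X)"
    then have e: "e \<in> edges G" "e \<inter> X = {}" by (auto simp: del_verts_def)
    have sub: "e \<subseteq> verts (del_verts G X)"
      using e finite_sgraph_edgesD(3)[OF G e(1)] by auto
    obtain u v where uv: "e = {u, v}" "u \<noteq> v" using finite_sgraph_edgesD(4)[OF G e(1)] by (auto simp: card_2_iff)
    have "u \<in> verts G" "v \<in> verts G" using sub uv by auto
    then obtain i j where ij: "i < Suc ?n" "j < Suc ?n" "u = f i" "v = f j"
      using V[of u] V[of v] by auto
    have host: "c ! i < length host" "c ! j < length host"
      using X_iff ij uv e by auto
    have step: "adj host (c ! i) (c ! j)" if "adj (A @ [S]) i j" "i < j" "j < Suc ?n" "c ! i < length host" "c ! j < length host" for i j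
    proof (cases "j = ?n")
      case True
      then have "i \<in> set S" using that by (simp add: adj_def)
      then show ?thesis using cov[of i] that True last by auto
    next
      case False
      then have "adj A i j" using that by (auto simp: adj_def nth_append)
      then show ?thesis using edge[of i j] that False by auto
    qed
    have "adj (A @ [S]) i j" using f ij uv e by (auto simp: coding_def)
    moreover have "i \<noteq> j" using uv ij by auto
    ultimately have "adj host (c ! i) (c ! j)"
      using step[of i j] step[of j i] host ij by (metis adj_sym linorder_neqE_nat)
    then have "{c ! i, c ! j} \<in> edges (graph_of host)"
      using host by (auto simp: graph_of_def)
    then show "e \<subseteq> verts (del_verts G X) \<and> (\<lambda>v. c ! g v) ` e \<in> edges (graph_of host)"
      using sub uv ij gf by auto
  qed
  ultimately show ?thesis unfolding apex_def by blast
qed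

section \<open>Extensions of listed graphs\<close>

definition iso_to :: "nat list list list \<Rightarrow> nat list list \<Rightarrow> nat \<times> nat list \<Rightarrow> bool" where
  "iso_to L A w \<longleftrightarrow> fst w < length L \<and> iso_check A (L ! fst w) (snd w)"

lemma listed_iso_to: "codes A G \<Longrightarrow> iso_to L A w \<Longrightarrow> listed L G"
  unfolding iso_to_def listed_def using codes_iso_check nth_mem by blast

text \<open>\<open>cs\<close> disposes of neighbourhoods that make the graph \<open>k\<close>-apex;
  each of the others, in the order of the filtered list, is paired with a relabelling onto an entry
  of \<open>L\<close>.\<close>

definition ext_check :: "nat \<Rightarrow> nat \<Rightarrow> nat \<Rightarrow> nat \<Rightarrow> nat list list list \<Rightarrow>
    nat list list \<Rightarrow> nat list list \<times> (nat \<times> nat list) list \<Rightarrow> bool" where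
  "ext_check k lo hi d L A = (\<lambda>(cs, ws). list_all (certificate k A) cs \<and>
     list_all2 (\<lambda>S. iso_to L (A @ [S])) (filter (\<lambda>S. \<not> list_ex (\<lambda>c. covers c S) cs) (exts lo hi d 0 (degs A))) ws)"

lemma coding_add_vertex:
  assumes G: "finite_sgraph G" and v: "v \<in> verts G" and f: "coding A (del_verts G {v}) f"
    and S: "set S = {i. i < length A \<and> f i \<in> neighbours G v}"
  shows "coding (A @ [S]) G (f(length A := v))"
proof -
  let ?n = "length A" and ?f = "f(length A := v)"
  have bij: "bij_betw f {..<?n} (verts G - {v})" using f by (simp add: coding_def)
  have ne: "f i \<noteq> v" if "i < ?n" for i using bij that by (auto simp: bij_betw_def)
  have "bij_betw ?f {..<?n} (verts G - {v})" using bij by (rule bij_betw_cong[THEN iffD1, rotated]) auto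
  then have "bij_betw ?f (insert ?n {..<?n}) (insert v (verts G - {v}))"
    using notIn_Un_bij_betw[of ?n "{..<?n}" ?f "verts G - {v}"] by simp
  then have "bij_betw ?f {..<length (A @ [S])} (verts G)"
    using v by (simp add: lessThan_Suc insert_absorb)
  moreover have "{?f i, ?f j} \<in> edges G \<longleftrightarrow> adj (A @ [S]) i j" if ij: "i < Suc ?n" "j < Suc ?n" for i j
  proof -
    consider "i < ?n" "j < ?n" | "i < ?n" "j = ?n" | "i = ?n" "j < ?n" | "i = ?n" "j = ?n" using ij by linarith
    then show ?thesis
    proof cases
      case 1
      then have "{f i, f j} \<in> edges G \<longleftrightarrow> {f i, f j} \<in> edges (del_verts G {v})"
        using ne by (auto simp: del_verts_def)
      also have "\<dots> \<longleftrightarrow> adj A i j" using f 1 by (auto simp: coding_def)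
      finally show ?thesis using 1 by (auto simp: adj_def nth_append)
    next
      case 2 then show ?thesis using S by (auto simp: adj_def neighbours_def insert_commute)
    next
      case 3 then show ?thesis using S by (auto simp: adj_def neighbours_def)
    next
      case 4 then show ?thesis using neighbours_irrefl[OF G, of v] by (auto simp: adj_def neighbours_def)
    qed
  qed
  ultimately show ?thesis by (simp add: coding_def)
qed

text \<open>\<open>v\<close> becomes the last vertex of the code. Its neighbourhood passes the tests
  of \<open>exts\<close> because the degrees of \<open>G\<close> are those of \<open>A\<close>,
  raised by one on this neighbourhood.\<close>

lemma extension_exts:
  assumes G: "finite_sgraph G" and v: "v \<in> verts G" "deg G v = d"
    and degs: "\<And>u. u \<in> verts G \<Longrightarrow> lo \<le> deg G u \<and> deg G u \<le> hi"
    and A: "codes A (del_verts G {v})"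
  obtains S where "S \<in> set (exts lo hi d 0 (degs A))" "codes (A @ [S]) G"
proof -
  obtain f where f: "coding A (del_verts G {v}) f" using A by (auto simp: codes_def)
  let ?n = "length A" and ?H = "del_verts G {v}"
  have bij: "bij_betw f {..<?n} (verts G - {v})" using f by (simp add: coding_def)
  have inj: "inj_on f {..<?n}" and im: "f ` {..<?n} = verts G - {v}" using bij by (auto simp: bij_betw_def)
  define U where "U = {i. i < ?n \<and> f i \<in> neighbours G v}"
  have fi: "f i \<in> verts G" "f i \<noteq> v" if "i < ?n" for i using im that by auto
  have "f ` U = neighbours G v"
  proof
    show "neighbours G v \<subseteq> f ` U"
    proof
      fix w assume w: "w \<in> neighbours G v"
      then have "w \<in> f ` {..<?n}" using im neighbours_subset[OF G, of v] by blast
      then show "w \<in> f ` U" using w by (auto simp: U_def)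
    qed
  qed (auto simp: U_def)
  moreover have "inj_on f U" using inj by (auto simp: U_def inj_on_def)
  ultimately have "card U = d" using v(2) card_image by metis
  have dd: "deg G (f i) = degs A ! i + (if i \<in> U then 1 else 0)" if "i < ?n" for i
  proof -
    have "degs A ! i = deg ?H (f i)" using coding_deg[OF finite_sgraph_del_verts[OF G] f that] by simp
    also have "\<dots> = deg G (f i) - (if i \<in> U then 1 else 0)"
      using deg_del_vert[OF G fi(2)[OF that]] that neighbours_sym[of v G "f i"] by (simp add: U_def)
    moreover have "0 < deg G (f i)" if "i \<in> U"
      using that neighbours_sym[of v G "f i"] finite_neighbours[OF G, of "f i"] by (auto simp: U_def card_gt_0_iff)
    ultimately show ?thesis by auto
  qed
  have "\<exists>S\<in>set (exts lo hi d 0 (degs A)). set S = U"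
  proof (rule exts_complete)
    show "U \<subseteq> {0..<0 + length (degs A)}" by (auto simp: U_def)
    show "card U = d" by fact
    fix j assume j: "j < length (degs A)"
    show "lo \<le> degs A ! j + (if 0 + j \<in> U then 1 else 0)" using dd[of j] degs[of "f j"] fi j by auto
    show "degs A ! j < hi" if "0 + j \<in> U" using dd[of j] degs[of "f j"] fi j that by auto
  qed
  then obtain S where S: "S \<in> set (exts lo hi d 0 (degs A))" "set S = U" by blast
  have "coding (A @ [S]) G (f(?n := v))"
    by (rule coding_add_vertex[OF G v(1) f]) (use S in \<open>simp add: U_def\<close>)
  then show thesis using that[OF S(1)] unfolding codes_def by blast
qed

text \<open>The variant of \<open>ext_check\<close> without certificates, for steps in which every
  candidate is kept.\<close>

definition all_ext_check :: "nat \<Rightarrow> nat \<Rightarrow> nat \<Rightarrow> nat list list list \<Rightarrow> nat list list \<Rightarrow> (nat \<times> nat list) list \<Rightarrow> bool" where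
  "all_ext_check lo hi d L A ws = list_all2 (\<lambda>S. iso_to L (A @ [S])) (exts lo hi d 0 (degs A)) ws"

lemma listed_all_extension:
  assumes "finite_sgraph G" "v \<in> verts G" "deg G v = d"
    and "\<And>u. u \<in> verts G \<Longrightarrow> lo \<le> deg G u \<and> deg G u \<le> hi"
    and W: "listed L' (del_verts G {v})" "list_all2 (all_ext_check lo hi d L) L' W"
  shows "listed L G"
proof -
  obtain A where A: "A \<in> set L'" "codes A (del_verts G {v})" using W(1) by (auto simp: listed_def)
  obtain S where S: "S \<in> set (exts lo hi d 0 (degs A))" "codes (A @ [S]) G"
    using extension_exts[OF assms(1-4) A(2)] by blast
  obtain ws where "all_ext_check lo hi d L A ws" using list_all2_witness[OF W(2) A(1)] ..
  then obtain w where "iso_to L (A @ [S]) w"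
    using S(1) list_all2_witness[of "\<lambda>S. iso_to L (A @ [S])"] unfolding all_ext_check_def by blast
  then show ?thesis using S(2) listed_iso_to by blast
qed

text \<open>A certificate that covers the neighbourhood of \<open>v\<close> would make
  \<open>G\<close> a \<open>k\<close>-apex graph, so this neighbourhood survives the filter and
  comes with a relabelling.\<close>

lemma listed_extension:
  assumes G: "finite_sgraph G" "v \<in> verts G" "deg G v = d"
    and degs: "\<And>u. u \<in> verts G \<Longrightarrow> lo \<le> deg G u \<and> deg G u \<le> hi"
    and ap: "\<not> apex k G"
    and W: "listed L' (del_verts G {v})" "list_all2 (ext_check k lo hi d L) L' W"
  shows "listed L G"
proof -
  obtain A where A: "A \<in> set L'" "codes A (del_verts G {v})" using W(1) by (auto simp: listed_def)
  obtain S where S: "S \<in> set (exts lo hi d 0 (degs A))" "codes (A @ [S]) G"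
    using extension_exts[OF G degs A(2)] by blast
  obtain cs ws where chk: "ext_check k lo hi d L A (cs, ws)" using list_all2_witness[OF W(2) A(1)] by auto
  have "\<not> list_ex (\<lambda>c. covers c S) cs"
  proof
    assume "list_ex (\<lambda>c. covers c S) cs"
    then obtain c where "c \<in> set cs" "covers c S" by (auto simp: list_ex_iff)
    moreover from this have "certificate k A c" using chk by (simp add: ext_check_def list_all_iff)
    ultimately show False using apex_certificate[OF G(1)] S(2) ap unfolding codes_def by blast
  qed
  then have "S \<in> set (filter (\<lambda>S. \<not> list_ex (\<lambda>c. covers c S) cs) (exts lo hi d 0 (degs A)))"
    using S by simp
  then obtain w where "iso_to L (A @ [S]) w"
    using chk list_all2_witness[of "\<lambda>S. iso_to L (A @ [S])"] unfolding ext_check_def split_conv by blast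
  then show ?thesis using S(2) listed_iso_to by blast
qed

text \<open>An edge \<open>(i, j)\<close> of the edge list has \<open>i < j\<close>; it is recorded
  in entry \<open>j\<close> alone and is removed there.\<close>

definition subdivide :: "nat list list \<Rightarrow> nat \<times> nat \<Rightarrow> nat list list" where
  "subdivide A = (\<lambda>(i, j). A[j := removeAll i (A ! j)] @ [[i, j]])"

text \<open>In contrast to \<open>subdivide\<close> the edge stays, so the new vertex completes a
  triangle.\<close>

definition add_ear :: "nat list list \<Rightarrow> nat \<times> nat \<Rightarrow> nat list list" where
  "add_ear A = (\<lambda>(i, j). A @ [[i, j]])"

definition child_check :: "(nat list list \<Rightarrow> nat \<times> nat \<Rightarrow> nat list list) \<Rightarrow> nat \<Rightarrow> nat \<Rightarrow> nat list list list \<Rightarrow>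
    nat list list \<Rightarrow> (nat \<times> nat list) list \<Rightarrow> bool" where
  "child_check F lo hi L A ws = list_all2 (iso_to L)
     (filter (\<lambda>B. list_all (\<lambda>d. lo \<le> d \<and> d \<le> hi) (degs B)) (map (F A) (edge_list A))) ws"

lemma listed_child:
  assumes G: "finite_sgraph G" and code: "codes (F A e) G" and e: "e \<in> set (edge_list A)"
    and degs: "\<And>u. u \<in> verts G \<Longrightarrow> lo \<le> deg G u \<and> deg G u \<le> hi"
    and chk: "child_check F lo hi L A ws"
  shows "listed L G"
proof -
  obtain f where f: "coding (F A e) G f" using code by (auto simp: codes_def)
  have "list_all (\<lambda>d. lo \<le> d \<and> d \<le> hi) (degs (F A e))"
    unfolding list_all_length
  proof (intro allI impI)
    fix i assume i: "i < length (degs (F A e))"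
    then have "deg G (f i) = degs (F A e) ! i" "f i \<in> verts G"
      using coding_deg[OF G f] f by (auto simp: coding_def bij_betw_def)
    then show "lo \<le> degs (F A e) ! i \<and> degs (F A e) ! i \<le> hi" using degs by metis
  qed
  then have "F A e \<in> set (filter (\<lambda>B. list_all (\<lambda>d. lo \<le> d \<and> d \<le> hi) (degs B)) (map (F A) (edge_list A)))"
    using e by simp
  then obtain w where "iso_to L (F A e) w"
    using chk list_all2_witness[of "iso_to L"] unfolding child_check_def by blast
  then show ?thesis using code listed_iso_to by blast
qed

lemma coding_edge:
  assumes "coding A G f" "{x, y} \<in> edges G" "x \<noteq> y" "{x, y} \<subseteq> verts G"
  obtains i j where "(i, j) \<in> set (edge_list A)" "{f i, f j} = {x, y}"
proof -
  obtain i where i: "i < length A" "x = f i" using coding_surj[OF assms(1), of x] assms(4) by blast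
  obtain j where j: "j < length A" "y = f j" using coding_surj[OF assms(1), of y] assms(4) by blast
  note ij = i(1) j(1) i(2) j(2)
  then have "adj A i j" "i \<noteq> j" using assms by (auto simp: coding_def)
  then have "(i, j) \<in> set (edge_list A) \<or> (j, i) \<in> set (edge_list A)"
    using ij adj_sym[of A i j] by (auto simp: set_edge_list)
  then show thesis using that ij by (metis insert_commute)
qed

text \<open>In the smoothed graph \<open>xy\<close> is an edge in any case, and \<open>v\<close> has
  to be put back on it. Whether \<open>xy\<close> was an edge of \<open>G\<close> decides between an
  ear and a subdivision.\<close>

lemma codes_smooth:
  assumes G: "finite_sgraph G" and v: "v \<in> verts G" and N: "neighbours G v = {x, y}" "x \<noteq> y"
    and code: "codes A (smooth G v x y)"
  obtains e where "e \<in> set (edge_list A)"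
    "codes (if {x, y} \<in> edges G then add_ear A e else subdivide A e) G"
proof -
  let ?H = "smooth G v x y"
  obtain f where f: "coding A ?H f" using code by (auto simp: codes_def)
  have xy: "x \<in> verts G - {v}" "y \<in> verts G - {v}" using neighbours_subset[OF G, of v] N by auto
  obtain i j where ij: "(i, j) \<in> set (edge_list A)" "{f i, f j} = {x, y}"
    by (rule coding_edge[OF f, of x y]) (use N(2) xy in \<open>auto simp: smooth_def\<close>)
  then have lt: "i < j" "j < length A" by (auto simp: set_edge_list)
  have inj: "inj_on f {..<length A}" and im: "f ` {..<length A} = verts G - {v}"
    using f by (auto simp: coding_def bij_betw_def smooth_def)
  have inv: "f l \<in> {x, y} \<longleftrightarrow> l = i \<or> l = j" if "l < length A" for l
  proof -
    have "f l \<in> {x, y} \<longleftrightarrow> f l \<in> {f i, f j}" using ij(2) by simp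
    also have "\<dots> \<longleftrightarrow> l = i \<or> l = j" using inj lt that by (auto simp: inj_on_def)
    finally show ?thesis .
  qed
  have nb: "{l. l < length A \<and> f l \<in> neighbours G v} = {i, j}"
  proof -
    have "{l. l < length A \<and> f l \<in> neighbours G v} = {l. l < length A \<and> (l = i \<or> l = j)}"
      unfolding N(1) using inv by blast
    also have "\<dots> = {i, j}" using lt by auto
    finally show ?thesis .
  qed
  define B where "B = (if {x, y} \<in> edges G then A else A[j := removeAll i (A ! j)])"
  have len: "length B = length A" by (simp add: B_def)
  have "coding B (del_verts G {v}) f"
    unfolding coding_def
  proof (intro conjI allI impI)
    show "bij_betw f {..<length B} (verts (del_verts G {v}))"
      using inj im len by (simp add: bij_betw_def)
    fix l m assume lm: "l < length B" "m < length B"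
    have old: "{f l, f m} \<in> edges ?H \<longleftrightarrow> adj A l m" using f lm len by (simp add: coding_def)
    have new: "{f l, f m} \<in> edges ?H \<longleftrightarrow> {f l, f m} = {x, y} \<or> {f l, f m} \<in> edges (del_verts G {v})"
      by (simp add: smooth_def)
    have is_e: "{f l, f m} = {x, y} \<longleftrightarrow> {l, m} = {i, j}"
      unfolding ij(2)[symmetric] using lm len lt inj by (auto simp: doubleton_eq_iff inj_on_def)
    have xy_G: "{x, y} \<in> edges (del_verts G {v}) \<longleftrightarrow> {x, y} \<in> edges G"
      using xy by (auto simp: del_verts_def)
    show "{f l, f m} \<in> edges (del_verts G {v}) \<longleftrightarrow> adj B l m"
    proof (cases "{x, y} \<in> edges G")
      case True
      then show ?thesis using old new xy_G by (auto simp: B_def)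
    next
      case False
      have "adj B l m \<longleftrightarrow> adj A l m \<and> {l, m} \<noteq> {i, j}"
        using False lm len lt by (auto simp: B_def adj_def nth_list_update doubleton_eq_iff)
      then show ?thesis using old new xy_G False is_e by auto
    qed
  qed
  then have "coding (B @ [[i, j]]) G (f(length B := v))"
    by (rule coding_add_vertex[OF G v]) (use nb len in auto)
  moreover have "B @ [[i, j]] = (if {x, y} \<in> edges G then add_ear A (i, j) else subdivide A (i, j))"
    by (simp add: B_def add_ear_def subdivide_def)
  ultimately show thesis using that[OF ij(1)] by (auto simp: codes_def)
qed

lemma listed_smooth:
  assumes G: "finite_sgraph G" and v: "v \<in> verts G" and N: "neighbours G v = {x, y}" "x \<noteq> y" "{x, y} \<notin> edges G"
    and degs: "\<And>u. u \<in> verts G \<Longrightarrow> lo \<le> deg G u \<and> deg G u \<le> hi"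
    and W: "listed L' (smooth G v x y)" "list_all2 (child_check subdivide lo hi L) L' W"
  shows "listed L G"
proof -
  obtain A where A: "A \<in> set L'" "codes A (smooth G v x y)" using W(1) by (auto simp: listed_def)
  obtain e where "e \<in> set (edge_list A)" "codes (subdivide A e) G"
    using codes_smooth[OF G v N(1,2) A(2)] N(3) by metis
  moreover obtain ws where "child_check subdivide lo hi L A ws" using list_all2_witness[OF W(2) A(1)] ..
  ultimately show ?thesis using listed_child[where F = subdivide, OF G _ _ degs] by blast
qed

lemma listed_ear:
  assumes G: "finite_sgraph G" and v: "v \<in> verts G" and N: "neighbours G v = {x, y}" "x \<noteq> y" "{x, y} \<in> edges G"
    and degs: "\<And>u. u \<in> verts G \<Longrightarrow> lo \<le> deg G u \<and> deg G u \<le> hi"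
    and W: "listed L' (del_verts G {v})" "list_all2 (child_check add_ear lo hi L) L' W"
  shows "listed L G"
proof -
  have "v \<notin> {x, y}" using neighbours_irrefl[OF G, of v] N(1) by simp
  then have sm: "smooth G v x y = del_verts G {v}" using N(3) by (intro smooth_adjacent) auto
  obtain A where A: "A \<in> set L'" "codes A (smooth G v x y)" using W(1) sm by (auto simp: listed_def)
  obtain e where "e \<in> set (edge_list A)" "codes (add_ear A e) G"
    using codes_smooth[OF G v N(1,2) A(2)] N(3) by metis
  moreover obtain ws where "child_check add_ear lo hi L A ws" using list_all2_witness[OF W(2) A(1)] ..
  ultimately show ?thesis using listed_child[where F = add_ear, OF G _ _ degs] by blast
qed

definition with_edges :: "nat \<Rightarrow> nat list list list \<Rightarrow> nat list list list" where
  "with_edges m L = filter (\<lambda>A. sum_list (degs A) = 2 * m) L"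

lemma listed_with_edges:
  assumes "finite_sgraph G" "listed L G"
  shows "listed (with_edges (card (edges G)) L) G"
  using assms coding_sum_degs by (fastforce simp: listed_def with_edges_def codes_def)

text \<open>All labelled graphs, without regard to isomorphism. They form the base of the
  enumeration at four vertices, where there are 64 of them.\<close>

fun all_codes :: "nat \<Rightarrow> nat list list list" where
  "all_codes 0 = [[]]"
| "all_codes (Suc n) = concat (map (\<lambda>A. map (\<lambda>S. A @ [S]) (subseqs [0..<n])) (all_codes n))"

lemma length_all_codes: "A \<in> set (all_codes n) \<Longrightarrow> length A = n"
  by (induction n arbitrary: A) auto

lemma listed_all_codes:
  "finite_sgraph G \<Longrightarrow> card (verts G) = n \<Longrightarrow> listed (all_codes n) G"
proof (induction n arbitrary: G)
  case 0
  from finite_sgraph_edgesD(1)[OF "0.prems"(1)] have "verts G = {}" using "0.prems"(2) by simp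
  then show ?case by (auto simp: listed_def codes_def coding_def bij_betw_def)
next
  case (Suc n)
  note G = Suc.prems(1)
  obtain v where v: "v \<in> verts G" using Suc.prems(2) by fastforce
  have "listed (all_codes n) (del_verts G {v})"
    using Suc.IH[OF finite_sgraph_del_verts[OF G]] card_verts_del_vert[OF G v] Suc.prems(2) by simp
  then obtain A f where A: "A \<in> set (all_codes n)" "coding A (del_verts G {v}) f"
    by (auto simp: listed_def codes_def)
  have len: "length A = n" using length_all_codes[OF A(1)] .
  have "{i. i < n \<and> f i \<in> neighbours G v} \<in> set ` set (subseqs [0..<n])"
    by (auto simp: subseqs_powset)
  then obtain S where S: "S \<in> set (subseqs [0..<n])" "set S = {i. i < n \<and> f i \<in> neighbours G v}"
    by auto
  have "coding (A @ [S]) G (f(length A := v))"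
    by (rule coding_add_vertex[OF G v A(2)]) (simp add: S(2) len)
  with S(1) show ?case using A(1) by (auto simp: listed_def codes_def)
qed

subsection \<open>Lists of codes\<close>

text \<open>In the names, \<open>g\<close> stands for all graphs, \<open>np\<close>, \<open>na\<close> and \<open>n2a\<close> for those that are not planar, not 1-apex and
  not 2-apex, with the given numbers of vertices and edges and some bounds on the degrees. A check is
  labelled by the degree of the vertex that is added, by \<open>s\<close> for a subdivided edge or by \<open>e\<close> for an ear.\<close>

definition g5_6 :: "nat list list list" where
  "g5_6 = [
     [[], [0], [0], [0], [1, 2, 3]],
     [[], [0], [0], [1], [1, 2, 3]],
     [[], [0], [], [2], [0, 1, 2, 3]]]"

lemma g5_6_3_check:
  "list_all2 (all_ext_check 2 3 3 g5_6) (with_edges 3 (all_codes 4)) [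
     [],
     [(0, [0, 1, 2, 3, 4])],
     [(1, [0, 1, 2, 3, 4]), (1, [1, 0, 3, 2, 4])],
     [(1, [0, 2, 1, 3, 4]), (1, [2, 0, 3, 1, 4])],
     [(1, [0, 1, 3, 2, 4]), (1, [1, 0, 2, 3, 4])],
     [(0, [1, 0, 2, 3, 4])],
     [(1, [0, 4, 1, 3, 2]), (1, [2, 1, 3, 0, 4])],
     [],
     [(1, [0, 3, 1, 2, 4]), (1, [2, 4, 3, 1, 0])],
     [(1, [0, 4, 1, 2, 3]), (1, [2, 4, 3, 0, 1])],
     [(1, [0, 2, 3, 1, 4]), (1, [1, 4, 2, 3, 0])],
     [(1, [1, 2, 3, 0, 4]), (1, [0, 4, 2, 3, 1])],
     [(0, [2, 0, 1, 3, 4])],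
     [(1, [0, 3, 2, 1, 4]), (1, [1, 4, 3, 2, 0])],
     [],
     [(1, [0, 4, 2, 1, 3]), (1, [1, 4, 3, 0, 2])],
     [(1, [1, 3, 2, 0, 4]), (1, [0, 4, 3, 2, 1])],
     [(1, [1, 4, 2, 0, 3]), (1, [0, 4, 3, 1, 2])],
     [],
     [(0, [3, 0, 1, 2, 4])]]"
  by code_simp

lemma g5_6_4_check:
  "list_all2 (all_ext_check 2 4 4 g5_6) (with_edges 2 (all_codes 4)) [
     [],
     [],
     [],
     [],
     [(2, [0, 1, 2, 3, 4])],
     [],
     [],
     [(2, [0, 2, 1, 3, 4])],
     [],
     [(2, [0, 3, 1, 2, 4])],
     [],
     [],
     [],
     [],
     []]"
  by code_simp

definition g5_5 :: "nat list list list" where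
  "g5_5 = [
     [[], [0], [0], [1], [2, 3]]]"

lemma g5_5_2_check:
  "list_all2 (all_ext_check 2 2 2 g5_5) (with_edges 3 (all_codes 4)) [
     [],
     [],
     [(0, [0, 1, 2, 3, 4])],
     [(0, [0, 1, 2, 4, 3])],
     [(0, [0, 1, 3, 2, 4])],
     [],
     [(0, [0, 1, 4, 2, 3])],
     [],
     [(0, [0, 1, 3, 4, 2])],
     [(0, [0, 1, 4, 3, 2])],
     [(0, [0, 2, 3, 1, 4])],
     [(0, [0, 2, 4, 1, 3])],
     [],
     [(0, [0, 2, 3, 4, 1])],
     [],
     [(0, [0, 2, 4, 3, 1])],
     [(0, [0, 3, 4, 1, 2])],
     [(0, [0, 3, 4, 2, 1])],
     [],
     []]"
  by code_simp

definition g5_3 :: "nat list list list" where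
  "g5_3 = [
     [[], [0], [], [], [2, 3]],
     [[], [0], [], [], [1, 3]],
     [[], [0], [], [], [0, 1]],
     [[], [], [], [], [1, 2, 3]]]"

lemma g5_3_2_check:
  "list_all2 (all_ext_check 0 2 2 g5_3) (with_edges 1 (all_codes 4)) [
     [(0, [0, 1, 2, 3, 4]), (1, [0, 1, 2, 3, 4]), (1, [0, 1, 3, 2, 4]), (1, [1, 0, 2, 3, 4]), (1, [1, 0, 3, 2, 4]),
      (2, [0, 1, 2, 3, 4])],
     [(1, [0, 2, 1, 3, 4]), (0, [0, 2, 1, 3, 4]), (1, [0, 2, 3, 1, 4]), (1, [2, 0, 1, 3, 4]), (2, [0, 2, 1, 3, 4]),
      (1, [1, 4, 3, 2, 0])],
     [(1, [1, 2, 0, 3, 4]), (1, [2, 1, 0, 3, 4]), (2, [1, 2, 0, 3, 4]), (0, [1, 2, 0, 3, 4]), (1, [0, 4, 3, 1, 2]),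
      (1, [0, 4, 3, 2, 1])],
     [(1, [0, 3, 1, 2, 4]), (1, [0, 3, 2, 1, 4]), (0, [0, 3, 1, 2, 4]), (2, [0, 3, 1, 2, 4]), (1, [2, 4, 1, 3, 0]),
      (1, [1, 4, 2, 3, 0])],
     [(1, [1, 3, 0, 2, 4]), (2, [1, 3, 0, 2, 4]), (1, [2, 4, 0, 3, 1]), (1, [0, 4, 2, 1, 3]), (0, [1, 3, 0, 2, 4]),
      (1, [0, 4, 2, 3, 1])],
     [(2, [2, 3, 0, 1, 4]), (1, [1, 4, 0, 2, 3]), (1, [1, 4, 0, 3, 2]), (1, [0, 4, 1, 2, 3]), (1, [0, 4, 1, 3, 2]),
      (0, [2, 3, 0, 1, 4])]]"
  by code_simp

lemma g5_3_3_check: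
  "list_all2 (all_ext_check 0 3 3 g5_3) (with_edges 0 (all_codes 4)) [
     [(3, [0, 1, 2, 3, 4]), (3, [1, 0, 2, 3, 4]), (3, [2, 0, 1, 3, 4]), (3, [3, 0, 1, 2, 4])]]"
  by code_simp

definition g5_4 :: "nat list list list" where
  "g5_4 = [
     [[], [0], [0], [], [2, 3]],
     [[], [0], [], [2], [2, 3]],
     [[], [0], [], [], [1, 2, 3]]]"

lemma g5_4_2_check:
  "list_all2 (all_ext_check 1 2 2 g5_4) (with_edges 2 (all_codes 4)) [
     [(0, [0, 1, 2, 3, 4]), (0, [0, 2, 1, 3, 4])],
     [(0, [1, 0, 2, 3, 4]), (0, [1, 2, 0, 3, 4])],
     [(0, [0, 1, 3, 2, 4]), (0, [4, 2, 1, 3, 0])],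
     [(0, [1, 0, 3, 2, 4]), (0, [4, 2, 0, 3, 1])],
     [(1, [0, 1, 2, 3, 4]), (0, [1, 0, 4, 2, 3]), (0, [1, 0, 4, 3, 2]), (0, [0, 1, 4, 2, 3]), (0, [0, 1, 4, 3, 2]),
      (1, [2, 3, 0, 1, 4])],
     [(0, [2, 0, 1, 3, 4]), (0, [2, 1, 0, 3, 4])],
     [(0, [4, 1, 3, 2, 0]), (0, [4, 1, 2, 3, 0])],
     [(0, [2, 0, 4, 1, 3]), (1, [0, 2, 1, 3, 4]), (0, [2, 0, 4, 3, 1]), (0, [3, 1, 4, 2, 0]), (1, [1, 3, 0, 2, 4]),
      (0, [0, 2, 4, 3, 1])],
     [(0, [2, 0, 3, 1, 4]), (0, [4, 1, 0, 3, 2])],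
     [(0, [3, 0, 4, 1, 2]), (0, [3, 0, 4, 2, 1]), (1, [0, 3, 1, 2, 4]), (1, [1, 2, 0, 3, 4]), (0, [2, 1, 4, 3, 0]),
      (0, [1, 2, 4, 3, 0])],
     [(0, [4, 0, 3, 2, 1]), (0, [4, 0, 2, 3, 1])],
     [(0, [4, 0, 3, 1, 2]), (0, [4, 0, 1, 3, 2])],
     [(0, [3, 0, 1, 2, 4]), (0, [3, 1, 0, 2, 4])],
     [(0, [3, 0, 2, 1, 4]), (0, [4, 1, 0, 2, 3])],
     [(0, [4, 0, 2, 1, 3]), (0, [4, 0, 1, 2, 3])]]"
  by code_simp

lemma g5_4_3_check:
  "list_all2 (all_ext_check 1 3 3 g5_4) (with_edges 1 (all_codes 4)) [
     [(2, [0, 1, 2, 3, 4]), (2, [1, 0, 2, 3, 4])],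
     [(2, [0, 2, 1, 3, 4]), (2, [2, 0, 1, 3, 4])],
     [(2, [1, 2, 0, 3, 4]), (2, [2, 1, 0, 3, 4])],
     [(2, [0, 3, 1, 2, 4]), (2, [3, 0, 1, 2, 4])],
     [(2, [1, 3, 0, 2, 4]), (2, [3, 1, 0, 2, 4])],
     [(2, [2, 3, 0, 1, 4]), (2, [3, 2, 0, 1, 4])]]"
  by code_simp

definition g6_6 :: "nat list list list" where
  "g6_6 = [
     [[], [0], [0], [], [2, 3], [1, 3]],
     [[], [0], [], [2], [2, 3], [0, 1]],
     [[], [0], [], [], [1, 2, 3], [2, 3]],
     [[], [0], [], [], [1, 2, 3], [0, 3]],
     [[], [0], [], [], [2, 3], [2, 3, 4]],
     [[], [0], [], [], [2, 3], [1, 3, 4]],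
     [[], [0], [], [], [2, 3], [0, 1, 4]],
     [[], [0], [], [], [2, 3], [0, 1, 3]],
     [[], [0], [], [], [1, 3], [1, 2, 4]],
     [[], [0], [], [], [1, 3], [1, 2, 3]],
     [[], [], [], [], [1, 2, 3], [0, 2, 3]]]"

lemma g6_6_2_check:
  "list_all2 (all_ext_check 1 2 2 g6_6) g5_4 [
     [(0, [0, 1, 2, 3, 4, 5])],
     [(1, [0, 1, 2, 3, 4, 5])],
     [(2, [0, 1, 2, 3, 4, 5]), (3, [0, 1, 2, 3, 4, 5]), (3, [0, 1, 3, 2, 4, 5])]]"
  by code_simp

lemma g6_6_3_check:
  "list_all2 (all_ext_check 1 3 3 g6_6) g5_3 [
     [(4, [0, 1, 2, 3, 4, 5]), (5, [0, 1, 2, 3, 4, 5]), (5, [0, 1, 3, 2, 4, 5]), (2, [0, 1, 2, 3, 5, 4]), (5, [1,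
      0, 2, 3, 4, 5]), (5, [1, 0, 3, 2, 4, 5]), (2, [1, 0, 2, 3, 5, 4]), (6, [0, 1, 2, 3, 4, 5]), (7, [0, 1, 2, 3,
      4, 5]), (7, [0, 1, 3, 2, 4, 5])],
     [(5, [0, 1, 2, 3, 5, 4]), (8, [0, 1, 2, 3, 4, 5]), (9, [0, 1, 2, 3, 4, 5]), (9, [2, 5, 3, 1, 0, 4]), (3, [1,
      0, 2, 3, 5, 4]), (5, [3, 4, 2, 0, 5, 1])],
     [(6, [0, 1, 2, 3, 5, 4]), (6, [0, 4, 2, 3, 5, 1]), (6, [1, 4, 2, 3, 5, 0])],
     [(10, [0, 1, 2, 3, 4, 5]), (10, [0, 2, 1, 3, 4, 5]), (10, [0, 3, 1, 2, 4, 5])]]"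
  by code_simp

definition g6_7 :: "nat list list list" where
  "g6_7 = [
     [[], [0], [0], [], [2, 3], [1, 3, 4]],
     [[], [0], [0], [], [2, 3], [1, 2, 3]],
     [[], [0], [], [2], [2, 3], [0, 1, 4]],
     [[], [0], [], [], [1, 2, 3], [0, 2, 3]]]"

lemma g6_7_3_check:
  "list_all2 (all_ext_check 2 3 3 g6_7) g5_4 [
     [(0, [0, 1, 2, 3, 4, 5]), (1, [0, 1, 2, 3, 4, 5]), (0, [4, 2, 3, 1, 5, 0])],
     [(2, [0, 1, 2, 3, 4, 5]), (2, [0, 1, 2, 4, 3, 5]), (2, [0, 1, 3, 4, 2, 5])],
     [(3, [0, 1, 2, 3, 4, 5])]]"
  by code_simp

definition g7_9 :: "nat list list list" where
  "g7_9 = [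
     [[], [0], [0], [], [2, 3], [1, 3], [3, 4, 5]],
     [[], [0], [0], [], [2, 3], [1, 3], [2, 4, 5]],
     [[], [0], [0], [], [2, 3], [1, 3], [1, 2, 3]],
     [[], [0], [], [2], [2, 3], [0, 1], [3, 4, 5]],
     [[], [0], [], [2], [2, 3], [0, 1], [2, 3, 4]],
     [[], [0], [], [], [1, 2, 3], [2, 3], [0, 2, 3]],
     [[], [0], [], [], [1, 2, 3], [2, 3], [0, 1, 5]],
     [[], [0], [], [], [1, 2, 3], [2, 3], [0, 1, 3]],
     [[], [0], [], [], [1, 2, 3], [0, 3], [1, 2, 5]],
     [[], [0], [], [], [1, 2, 3], [0, 3], [0, 2, 5]],
     [[], [0], [], [], [2, 3], [1, 3, 4], [0, 1, 2]]]"

lemma g7_9_3_check: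
  "list_all2 (all_ext_check 2 3 3 g7_9) g6_6 [
     [(0, [0, 1, 2, 3, 4, 5, 6]), (1, [0, 1, 2, 3, 4, 5, 6]), (1, [1, 0, 5, 4, 3, 2, 6]), (0, [1, 0, 5, 4, 3, 2,
      6]), (1, [0, 2, 1, 3, 5, 4, 6]), (0, [2, 0, 4, 5, 3, 1, 6]), (1, [2, 0, 4, 5, 3, 1, 6]), (1, [3, 4, 5, 0, 1,
      2, 6]), (1, [3, 5, 4, 0, 2, 1, 6]), (2, [0, 1, 2, 3, 4, 5, 6]), (2, [1, 5, 0, 4, 2, 3, 6]), (1, [4, 2, 3, 1,
      5, 0, 6]), (1, [5, 1, 3, 2, 4, 0, 6]), (1, [4, 3, 2, 1, 0, 5, 6]), (0, [5, 1, 3, 2, 4, 0, 6]), (1, [1, 5, 0,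
      4, 2, 3, 6]), (0, [4, 2, 3, 1, 5, 0, 6]), (1, [5, 3, 1, 2, 0, 4, 6]), (1, [2, 4, 0, 5, 1, 3, 6]), (0, [3, 4,
      5, 0, 1, 2, 6])],
     [(3, [0, 1, 2, 3, 4, 5, 6]), (3, [0, 1, 3, 2, 4, 5, 6]), (3, [0, 1, 4, 2, 3, 5, 6]), (4, [0, 1, 2, 3, 4, 5,
      6]), (3, [2, 3, 0, 1, 5, 4, 6]), (3, [2, 4, 0, 1, 5, 3, 6]), (3, [0, 5, 2, 3, 4, 1, 6]), (3, [3, 4, 0, 1, 5,
      2, 6]), (3, [0, 5, 3, 2, 4, 1, 6]), (3, [0, 5, 4, 2, 3, 1, 6]), (3, [2, 3, 1, 0, 5, 4, 6]), (3, [2, 4, 1, 0,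
      5, 3, 6]), (3, [1, 5, 2, 3, 4, 0, 6]), (3, [3, 4, 1, 0, 5, 2, 6]), (3, [1, 5, 3, 2, 4, 0, 6]), (3, [1, 5, 4,
      2, 3, 0, 6]), (4, [2, 3, 0, 1, 5, 4, 6]), (3, [2, 3, 5, 0, 1, 4, 6]), (3, [2, 4, 5, 0, 1, 3, 6]), (3, [3, 4,
      5, 0, 1, 2, 6])],
     [(1, [0, 1, 6, 2, 5, 4, 3]), (1, [0, 1, 6, 3, 5, 4, 2]), (5, [0, 1, 2, 3, 4, 5, 6]), (6, [0, 1, 2, 3, 4, 5,
      6]), (7, [0, 1, 2, 3, 4, 5, 6]), (7, [0, 1, 3, 2, 4, 5, 6])],
     [(1, [0, 1, 5, 2, 6, 4, 3]), (8, [0, 1, 2, 3, 4, 5, 6]), (5, [0, 5, 4, 6, 3, 2, 1]), (9, [0, 1, 2, 3, 4, 5,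
      6]), (8, [2, 6, 5, 1, 0, 4, 3]), (1, [5, 3, 0, 2, 6, 4, 1])],
     [(3, [0, 1, 2, 4, 5, 6, 3]), (3, [0, 1, 3, 4, 5, 6, 2])],
     [(1, [1, 0, 5, 2, 4, 6, 3]), (10, [0, 1, 2, 3, 4, 5, 6])],
     [(6, [0, 5, 2, 3, 4, 6, 1]), (6, [1, 5, 2, 3, 4, 6, 0])],
     [(3, [0, 1, 2, 4, 6, 5, 3]), (10, [0, 1, 3, 2, 4, 6, 5]), (7, [0, 1, 2, 3, 6, 4, 5]), (10, [1, 0, 3, 2, 4, 6,
      5]), (7, [1, 0, 2, 3, 6, 4, 5]), (0, [4, 2, 3, 0, 5, 6, 1])],
     [(9, [1, 0, 2, 3, 6, 4, 5])],
     [(8, [0, 1, 3, 2, 5, 6, 4]), (8, [2, 5, 4, 0, 1, 6, 3])],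
     [(2, [0, 5, 6, 4, 1, 2, 3]), (2, [0, 5, 6, 4, 1, 3, 2])]]"
  by code_simp

text \<open>The complete bipartite graph \<open>K_{3,3}\<close> with parts 0, 4, 5 and 1, 2,
  3.\<close>

definition np6_9 :: "nat list list list" where
  "np6_9 = [
     [[], [0], [0], [0], [1, 2, 3], [1, 2, 3]]]"

lemma np6_9_3_check:
  "list_all2 (ext_check 0 3 3 3 np6_9) g5_6 [
     ([], [(0, [0, 1, 2, 3, 4, 5])]),
     ([[7, 11, 6, 1, 4, 2]], []),
     ([], [])]"
  by code_simp

text \<open>\<open>K_{3,3}\<close> with one more edge, between 4 and 5.\<close>

definition np6_10 :: "nat list list list" where
  "np6_10 = [
     [[], [0], [0], [0], [1, 2, 3], [1, 2, 3, 4]]]"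

lemma np6_10_4_check:
  "list_all2 (ext_check 0 3 4 4 np6_10) g5_6 [
     ([], [(0, [0, 1, 2, 3, 4, 5]), (0, [4, 1, 2, 3, 0, 5])]),
     ([[6, 2, 11, 0, 1, 4]], []),
     ([[9, 4, 6, 8, 2, 3]], [])]"
  by code_simp

lemma np6_10_5_check:
  "list_all2 (ext_check 0 3 5 5 np6_10) g5_5 [
     ([[5, 8, 9, 6, 4, 3]], [])]"
  by code_simp

definition np7_9 :: "nat list list list" where
  "np7_9 = [
     [[], [0], [0], [0], [1, 2, 3], [1, 2, 3], []]]"

lemma np7_9_0_check:
  "list_all2 (all_ext_check 0 9 0 np7_9) np6_9 [
     [(0, [0, 1, 2, 3, 4, 5, 6])]]"
  by code_simp

definition np7_10 :: "nat list list list" where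
  "np7_10 = [
     [[], [], [0], [0], [1, 2, 3], [1, 2, 3], [0, 1]],
     [[], [0], [0], [0], [1, 2, 3], [1, 2, 3], [5]]]"

lemma np7_10_s_check:
  "list_all2 (child_check subdivide 1 9 np7_10) np6_9 [
     [(0, [0, 1, 2, 3, 4, 5, 6]), (0, [0, 2, 1, 3, 4, 5, 6]), (0, [0, 3, 1, 2, 4, 5, 6]), (0, [1, 4, 0, 5, 2, 3,
      6]), (0, [2, 4, 0, 5, 1, 3, 6]), (0, [3, 4, 0, 5, 1, 2, 6]), (0, [1, 5, 0, 4, 2, 3, 6]), (0, [2, 5, 0, 4, 1,
      3, 6]), (0, [3, 5, 0, 4, 1, 2, 6])]]"
  by code_simp

lemma np7_10_1_check:
  "list_all2 (all_ext_check 1 9 1 np7_10) np6_9 [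
     [(1, [0, 1, 2, 3, 4, 5, 6]), (1, [0, 1, 2, 3, 5, 4, 6]), (1, [1, 0, 4, 5, 2, 3, 6]), (1, [1, 0, 4, 5, 3, 2,
      6]), (1, [2, 0, 4, 5, 3, 1, 6]), (1, [4, 1, 2, 3, 5, 0, 6])]]"
  by code_simp

text \<open>All entries but the last have a vertex of degree two. The last one has minimum degree
  three and becomes \<open>K_{3,3}\<close> when its edge between 0 and 1 is contracted.\<close>

definition np7_11 :: "nat list list list" where
  "np7_11 = [
     [[], [], [0], [0], [1, 2, 3], [1, 2, 3, 4], [0, 1]],
     [[], [0], [0], [0], [2, 3], [1, 2, 3, 4], [1, 4]],
     [[], [0], [0], [0], [1, 2, 3], [1, 2, 3], [4, 5]],
     [[], [0], [0], [0], [1, 2, 3], [1, 2, 3], [0, 1]],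
     [[], [0], [], [], [1, 2, 3], [0, 2, 3], [0, 1, 2, 3]]]"

lemma np7_11_s_check:
  "list_all2 (child_check subdivide 2 9 np7_11) np6_10 [
     [(0, [0, 1, 2, 3, 4, 5, 6]), (0, [0, 2, 1, 3, 4, 5, 6]), (0, [0, 3, 1, 2, 4, 5, 6]), (1, [0, 1, 2, 3, 4, 5,
      6]), (1, [0, 2, 1, 3, 4, 5, 6]), (1, [0, 3, 1, 2, 4, 5, 6]), (1, [0, 1, 2, 3, 5, 4, 6]), (1, [0, 2, 1, 3, 5,
      4, 6]), (1, [0, 3, 1, 2, 5, 4, 6]), (2, [0, 1, 2, 3, 4, 5, 6])]]"
  by code_simp

lemma np7_11_e_check:
  "list_all2 (child_check add_ear 2 9 np7_11) np6_9 [
     [(3, [0, 1, 2, 3, 4, 5, 6]), (3, [0, 2, 1, 3, 4, 5, 6]), (3, [0, 3, 1, 2, 4, 5, 6]), (3, [1, 4, 0, 5, 2, 3,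
      6]), (3, [2, 4, 0, 5, 1, 3, 6]), (3, [3, 4, 0, 5, 1, 2, 6]), (3, [1, 5, 0, 4, 2, 3, 6]), (3, [2, 5, 0, 4, 1,
      3, 6]), (3, [3, 5, 0, 4, 1, 2, 6])]]"
  by code_simp

lemma np7_11_4_check:
  "list_all2 (ext_check 0 3 4 4 np7_11) g6_7 [
     ([[5, 9, 8, 6, 2, 4, 3]], []),
     ([[7, 11, 6, 9, 8, 4, 2]], []),
     ([[2, 6, 9, 3, 4, 11, 8]], []),
     ([], [(4, [0, 1, 2, 3, 4, 5, 6])])]"
  by code_simp

definition np8_10 :: "nat list list list" where
  "np8_10 = [
     [[], [0], [0], [0], [1, 2, 3], [1, 2, 3], [], [6]]]"

lemma np8_10_1_check:
  "list_all2 (all_ext_check 1 9 1 np8_10) np7_9 [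
     [(0, [0, 1, 2, 3, 4, 5, 6, 7])]]"
  by code_simp

definition np8_11 :: "nat list list list" where
  "np8_11 = [
     [[], [], [], [0], [1, 2, 3], [1, 2, 3], [0, 1], [0, 2]],
     [[], [], [0], [0], [1, 3], [1, 2, 3], [0, 1], [2, 4]],
     [[], [], [0], [0], [1, 2, 3], [1, 2, 3], [1], [0, 6]]]"

lemma np8_11_s_check:
  "list_all2 (child_check subdivide 2 9 np8_11) np7_10 [
     [(0, [0, 1, 2, 3, 4, 5, 6, 7]), (0, [0, 1, 3, 2, 4, 5, 6, 7]), (0, [1, 0, 4, 5, 2, 3, 6, 7]), (1, [0, 1, 2, 3,
      4, 5, 6, 7]), (1, [0, 1, 3, 2, 4, 5, 6, 7]), (0, [1, 0, 5, 4, 2, 3, 6, 7]), (1, [0, 1, 2, 3, 5, 4, 6, 7]), (1,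
      [0, 1, 3, 2, 5, 4, 6, 7]), (2, [0, 1, 2, 3, 4, 5, 6, 7]), (2, [1, 0, 4, 5, 2, 3, 6, 7])],
     []]"
  by code_simp

definition np8_12 :: "nat list list list" where
  "np8_12 = [
     [[], [], [], [0], [1, 2, 3], [1, 2, 3, 4], [0, 1], [0, 2]],
     [[], [], [0], [0], [2, 3], [1, 2, 3, 4], [0, 1], [1, 4]],
     [[], [], [0], [0], [1, 3], [1, 2, 3, 4], [0, 1], [2, 4]],
     [[], [], [0], [0], [1, 2, 3], [1, 2, 3], [0, 1], [4, 5]],
     [[], [], [0], [0], [1, 2, 3], [1, 2, 3, 4], [1], [0, 6]],
     [[], [0], [0], [0], [3], [1, 2, 3, 4], [1, 4], [2, 4]],
     [[], [0], [0], [0], [2, 3], [2, 3, 4], [1, 4], [1, 5]],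
     [[], [0], [0], [0], [2, 3], [1, 3, 4], [1, 4], [2, 5]],
     [[], [0], [0], [0], [2, 3], [1, 2, 3], [1, 4], [4, 5]],
     [[], [0], [0], [0], [2, 3], [1, 2, 3, 4], [4], [1, 6]],
     [[], [0], [0], [0], [1, 2, 3], [1, 2, 3], [5], [4, 6]],
     [[], [], [0], [0], [1, 2, 3], [1, 2, 3], [0, 1], [0, 1]],
     [[], [0], [], [0], [1, 2, 3], [1, 2, 3], [0, 1], [0, 2]],
     [[], [0], [0], [0], [1, 3], [1, 2, 3], [0, 1], [2, 4]],
     [[], [0], [0], [0], [1, 2, 3], [1, 2, 3], [1], [0, 6]],
     [[], [], [], [], [1, 2, 3], [0, 2, 3], [0, 1, 2, 3], [0, 1]],
     [[], [0], [], [], [2, 3], [0, 2, 3], [0, 1, 2, 3], [1, 4]],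
     [[], [0], [], [], [1, 3], [0, 2, 3], [0, 1, 2, 3], [2, 4]],
     [[], [0], [], [], [1, 2, 3], [0, 2, 3], [1, 2, 3], [0, 6]],
     [[], [0], [], [], [1, 2, 3], [0, 2, 3], [0, 1, 3], [2, 6]],
     [[], [], [0], [0], [1, 2, 3], [1, 2, 3], [0, 1], [0, 6]],
     [[], [0], [], [], [1, 2, 3], [2, 3], [0, 2, 3], [0, 1, 5]],
     [[], [0], [], [], [1, 2, 3], [0, 3], [1, 2, 5], [0, 2, 3]]]"

lemma np8_12_s_check:
  "list_all2 (child_check subdivide 2 4 np8_12) np7_11 [
     [(0, [0, 1, 2, 3, 4, 5, 6, 7]), (0, [0, 1, 3, 2, 4, 5, 6, 7]), (1, [0, 1, 2, 3, 4, 5, 6, 7]), (2, [0, 1, 2, 3,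
      4, 5, 6, 7]), (2, [0, 1, 3, 2, 4, 5, 6, 7]), (1, [0, 1, 2, 3, 5, 4, 6, 7]), (2, [0, 1, 2, 3, 5, 4, 6, 7]), (2,
      [0, 1, 3, 2, 5, 4, 6, 7]), (3, [0, 1, 2, 3, 4, 5, 6, 7]), (4, [0, 1, 2, 3, 4, 5, 6, 7]), (4, [0, 1, 2, 3, 4,
      5, 7, 6])],
     [(1, [0, 1, 2, 3, 4, 5, 7, 6]), (2, [0, 2, 1, 3, 4, 5, 7, 6]), (2, [0, 3, 1, 2, 4, 5, 7, 6]), (5, [0, 1, 2, 3,
      4, 5, 6, 7]), (5, [0, 1, 3, 2, 4, 5, 6, 7]), (6, [0, 1, 2, 3, 4, 5, 6, 7]), (7, [0, 1, 2, 3, 4, 5, 6, 7]), (7,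
      [0, 1, 3, 2, 4, 5, 6, 7]), (8, [0, 1, 2, 3, 4, 5, 6, 7]), (9, [0, 1, 2, 3, 4, 5, 6, 7]), (9, [0, 1, 2, 3, 4,
      5, 7, 6])],
     [(3, [0, 1, 2, 3, 4, 5, 7, 6]), (3, [0, 2, 1, 3, 4, 5, 7, 6]), (3, [0, 3, 1, 2, 4, 5, 7, 6]), (8, [0, 1, 2, 3,
      4, 5, 7, 6]), (8, [0, 2, 1, 3, 4, 5, 7, 6]), (8, [0, 3, 1, 2, 4, 5, 7, 6]), (8, [0, 1, 2, 3, 5, 4, 7, 6]), (8,
      [0, 2, 1, 3, 5, 4, 7, 6]), (8, [0, 3, 1, 2, 5, 4, 7, 6]), (10, [0, 1, 2, 3, 4, 5, 6, 7]), (10, [0, 1, 2, 3, 5,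
      4, 6, 7])],
     [(11, [0, 1, 2, 3, 4, 5, 6, 7]), (12, [0, 1, 2, 3, 4, 5, 6, 7]), (12, [0, 1, 3, 2, 4, 5, 6, 7]), (12, [1, 0,
      4, 5, 2, 3, 6, 7]), (13, [0, 1, 2, 3, 4, 5, 6, 7]), (13, [0, 1, 3, 2, 4, 5, 6, 7]), (12, [1, 0, 5, 4, 2, 3, 6,
      7]), (13, [0, 1, 2, 3, 5, 4, 6, 7]), (13, [0, 1, 3, 2, 5, 4, 6, 7]), (14, [0, 1, 2, 3, 4, 5, 6, 7]), (14, [1,
      0, 4, 5, 2, 3, 6, 7])],
     [(15, [0, 1, 2, 3, 4, 5, 6, 7]), (16, [0, 1, 2, 3, 4, 5, 6, 7]), (17, [0, 1, 2, 3, 4, 5, 6, 7]), (17, [0, 1,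
      3, 2, 4, 5, 6, 7]), (16, [1, 0, 2, 3, 5, 4, 6, 7]), (17, [1, 0, 2, 3, 5, 4, 6, 7]), (17, [1, 0, 3, 2, 5, 4, 6,
      7]), (18, [0, 1, 2, 3, 4, 5, 6, 7]), (18, [1, 0, 2, 3, 5, 4, 6, 7]), (19, [0, 1, 2, 3, 4, 5, 6, 7]), (19, [0,
      1, 3, 2, 4, 5, 6, 7])]]"
  by code_simp

lemma np8_12_e_check:
  "list_all2 (child_check add_ear 2 4 np8_12) np7_10 [
     [(12, [0, 2, 1, 3, 4, 5, 7, 6]), (12, [0, 3, 1, 2, 4, 5, 7, 6]), (12, [1, 4, 0, 5, 2, 3, 7, 6]), (13, [2, 4,
      0, 5, 1, 3, 7, 6]), (13, [3, 4, 0, 5, 1, 2, 7, 6]), (12, [1, 5, 0, 4, 2, 3, 7, 6]), (13, [2, 5, 0, 4, 1, 3, 7,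
      6]), (13, [3, 5, 0, 4, 1, 2, 7, 6]), (20, [0, 1, 2, 3, 4, 5, 6, 7]), (20, [1, 0, 4, 5, 2, 3, 6, 7])],
     []]"
  by code_simp

lemma np8_12_3_check:
  "list_all2 (ext_check 0 3 3 3 np8_12) g7_9 [
     ([[1, 0, 4, 6, 3, 2, 8, 10]], []),
     ([[9, 3, 4, 8, 2, 6, 11, 5]], []),
     ([[3, 6, 5, 2, 9, 11, 8, 4]], []),
     ([[5, 3, 2, 7, 11, 8, 6, 9]], []),
     ([[11, 7, 5, 8, 3, 2, 9, 6]], []),
     ([], [(21, [0, 1, 2, 3, 4, 5, 6, 7])]),
     ([], [(21, [0, 1, 2, 3, 4, 5, 7, 6])]),
     ([[1, 0, 7, 4, 2, 6, 10, 11]], []),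
     ([], [(22, [0, 1, 2, 3, 4, 5, 6, 7])]),
     ([], [(21, [0, 5, 4, 7, 3, 2, 1, 6])]),
     ([[3, 8, 11, 0, 1, 2, 6, 4]], [])]"
  by code_simp

definition np9_12 :: "nat list list list" where
  "np9_12 = [
     [[], [], [], [], [1, 2, 3], [1, 2, 3], [0, 1], [0, 2], [0, 3]],
     [[], [], [], [0], [2, 3], [1, 2, 3], [0, 1], [0, 2], [1, 4]],
     [[], [], [], [0], [1, 2], [1, 2, 3], [0, 1], [0, 2], [3, 4]],
     [[], [], [], [0], [1, 2, 3], [1, 2, 3], [1], [0, 2], [0, 6]],
     [[], [], [0], [0], [1, 3], [1, 2], [0, 1], [2, 4], [3, 5]],
     [[], [], [0], [0], [1, 3], [1, 2, 3], [1], [2, 4], [0, 6]],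
     [[], [], [0], [0], [1, 2, 3], [1, 2, 3], [], [0, 6], [1, 6]],
     [[], [0], [0], [0], [1, 2, 3], [1, 2, 3], [], [6], [6, 7]]]"

lemma np9_12_s_check:
  "list_all2 (child_check subdivide 2 3 np9_12) np8_11 [
     [(0, [0, 1, 2, 3, 4, 5, 6, 7, 8]), (1, [0, 1, 2, 3, 4, 5, 6, 7, 8]), (1, [0, 2, 1, 3, 4, 5, 7, 6, 8]), (2, [0,
      1, 2, 3, 4, 5, 6, 7, 8]), (1, [0, 1, 2, 3, 5, 4, 6, 7, 8]), (1, [0, 2, 1, 3, 5, 4, 7, 6, 8]), (2, [0, 1, 2, 3,
      5, 4, 6, 7, 8]), (3, [0, 1, 2, 3, 4, 5, 6, 7, 8]), (3, [0, 1, 2, 3, 4, 5, 8, 7, 6]), (3, [0, 2, 1, 3, 4, 5, 7,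
      6, 8]), (3, [0, 2, 1, 3, 4, 5, 8, 6, 7])],
     [(1, [0, 2, 1, 3, 4, 5, 8, 6, 7]), (2, [0, 1, 3, 2, 4, 5, 6, 8, 7]), (1, [1, 4, 0, 5, 2, 3, 8, 6, 7]), (2, [4,
      2, 3, 1, 0, 5, 7, 8, 6]), (2, [1, 0, 5, 4, 2, 3, 6, 8, 7]), (2, [2, 4, 5, 0, 1, 3, 7, 8, 6]), (4, [0, 1, 2, 3,
      4, 5, 6, 7, 8]), (5, [0, 1, 2, 3, 4, 5, 6, 7, 8]), (5, [1, 0, 4, 5, 2, 3, 6, 7, 8]), (5, [2, 4, 0, 5, 1, 3, 7,
      6, 8]), (5, [4, 2, 1, 3, 0, 5, 7, 6, 8])],
     [(3, [0, 1, 2, 3, 4, 5, 6, 8, 7]), (3, [0, 1, 3, 2, 4, 5, 6, 8, 7]), (3, [1, 0, 4, 5, 2, 3, 7, 8, 6]), (5, [0,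
      1, 2, 3, 4, 5, 6, 8, 7]), (5, [0, 1, 3, 2, 4, 5, 6, 8, 7]), (3, [1, 0, 5, 4, 2, 3, 7, 8, 6]), (5, [0, 1, 2, 3,
      5, 4, 6, 8, 7]), (5, [0, 1, 3, 2, 5, 4, 6, 8, 7]), (6, [0, 1, 2, 3, 4, 5, 6, 7, 8]), (6, [1, 0, 4, 5, 2, 3, 7,
      6, 8]), (6, [1, 0, 4, 5, 2, 3, 8, 6, 7])]]"
  by code_simp

lemma np9_12_e_check:
  "list_all2 (child_check add_ear 2 3 np9_12) np8_10 [
     [(7, [0, 1, 2, 3, 4, 5, 6, 7, 8])]]"
  by code_simp

text \<open>With the empty list as target, every candidate must be covered by a certificate: no such
  graph exists.\<close>

lemma na7_13_4_check:
  "list_all2 (ext_check 1 3 4 4 []) np6_9 [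
     ([[12, 11, 2, 10, 1, 4, 0], [12, 7, 1, 4, 11, 2, 6], [12, 9, 6, 3, 8, 4, 2], [7, 12, 11, 2, 1, 4, 6], [3, 12,
      8, 4, 6, 9, 2]], [])]"
  by code_simp

lemma na7_14_4_check:
  "list_all2 (ext_check 1 3 4 4 []) np6_10 [
     ([[3, 12, 9, 6, 8, 2, 4]], [])]"
  by code_simp

lemma na7_14_5_check:
  "list_all2 (ext_check 1 3 5 5 []) np6_9 [
     ([[7, 12, 11, 2, 1, 6, 4], [12, 3, 6, 9, 8, 4, 2], [12, 2, 9, 3, 8, 4, 6], [12, 4, 8, 2, 6, 9, 3], [10, 12, 1,
      4, 11, 2, 0], [7, 12, 11, 2, 4, 1, 6]], [])]"
  by code_simp

text \<open>For the second code there is no candidate at all: its vertex of degree one cannot reach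
  degree three by a single new edge.\<close>

lemma na8_14_4_check:
  "list_all2 (ext_check 1 3 4 4 []) np7_10 [
     ([[12, 8, 6, 4, 2, 3, 5, 9], [12, 11, 0, 10, 1, 4, 7, 2], [4, 12, 6, 2, 8, 7, 1, 11], [8, 12, 9, 6, 4, 2, 5,
      3]], []),
     ([], [])]"
  by code_simp

text \<open>The members of the Petersen family on seven vertices: \<open>K_6\<close> after one
  \<open>\<nabla>Y\<close> move, and \<open>K_{1,3,3}\<close>.\<close>

definition na7_15 :: "nat list list list" where
  "na7_15 = [
     [[], [0], [0], [0], [1, 2, 3], [1, 2, 3, 4], [1, 2, 3, 4, 5]],
     [[], [0], [0], [0], [1, 2, 3], [1, 2, 3], [0, 1, 2, 3, 4, 5]]]"

lemma na7_15_5_check: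
  "list_all2 (ext_check 1 3 5 5 na7_15) np6_10 [
     ([[12, 9, 1, 6, 4, 2, 11], [12, 2, 11, 10, 1, 4, 0], [12, 1, 6, 9, 4, 2, 11], [1, 12, 11, 2, 7, 6, 4], [9, 12,
      8, 4, 6, 2, 3]], [(0, [0, 1, 2, 3, 4, 5, 6])])]"
  by code_simp

lemma na7_15_6_check:
  "list_all2 (all_ext_check 3 6 6 na7_15) np6_9 [
     [(1, [0, 1, 2, 3, 4, 5, 6])]]"
  by code_simp

text \<open>\<open>K_{4,4}\<close> without an edge, and \<open>K_{1,3,3}\<close> after one
  \<open>\<nabla>Y\<close> move.\<close>

definition na8_15 :: "nat list list list" where
  "na8_15 = [
     [[], [0], [0], [0], [1, 2, 3], [1, 2, 3], [4, 5], [1, 2, 3, 6]],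
     [[], [], [0], [0], [1, 2, 3], [1, 2, 3], [0, 1], [2, 3, 4, 5, 6]]]"

lemma na8_15_4_check:
  "list_all2 (ext_check 1 3 4 4 na8_15) np7_11 [
     ([[2, 12, 1, 4, 10, 0, 7, 11]], []),
     ([[3, 12, 9, 6, 2, 8, 1, 4]], []),
     ([[3, 5, 8, 4, 12, 9, 2, 6], [11, 1, 7, 6, 12, 2, 9, 4], [1, 11, 0, 10, 12, 4, 6, 2]], [(0, [0, 1, 2, 3, 4, 5,
      6, 7])]),
     ([[12, 0, 9, 11, 4, 2, 10, 1], [12, 4, 8, 9, 3, 2, 11, 6], [6, 12, 2, 4, 9, 0, 11, 1], [11, 12, 1, 4, 0, 10,
      7, 2]], []),
     ([[2, 8, 12, 3, 5, 4, 6, 9]], [])]"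
  by code_simp

lemma na8_15_5_check:
  "list_all2 (ext_check 1 3 5 5 na8_15) np7_10 [
     ([[12, 4, 8, 7, 2, 6, 1, 11], [12, 11, 0, 10, 1, 4, 6, 2], [8, 12, 2, 3, 6, 4, 5, 9], [11, 12, 4, 1, 0, 10, 7,
      2]], [(1, [0, 1, 2, 3, 4, 5, 6, 7])]),
     ([], [])]"
  by code_simp

definition na8_16 :: "nat list list list" where
  "na8_16 = [
     [[], [], [0], [0], [1, 2, 3], [1, 2, 3, 4], [0, 1], [2, 3, 4, 5, 6]],
     [[], [0], [0], [0], [2, 3], [1, 2, 3, 4], [1, 4], [1, 2, 3, 5, 6]],
     [[], [0], [0], [0], [2, 3], [1, 2, 3, 4], [1, 4], [0, 2, 3, 5, 6]],
     [[], [0], [0], [0], [1, 2, 3], [1, 2, 3], [4, 5], [1, 2, 3, 5, 6]],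
     [[], [0], [0], [0], [1, 2, 3], [1, 2, 3], [4, 5], [0, 1, 2, 3, 6]],
     [[], [0], [0], [0], [1, 2, 3], [1, 2, 3], [0, 1], [2, 3, 4, 5, 6]],
     [[], [0], [], [], [1, 2, 3], [0, 2, 3], [0, 1, 2, 3], [0, 1, 2, 3, 6]],
     [[], [], [0], [0], [1, 2, 3], [1, 2, 3, 4], [1, 2, 3, 4, 5], [0, 1]],
     [[], [0], [0], [0], [2, 3], [1, 2, 3, 4], [1, 2, 3, 4, 5], [1, 4]],
     [[], [0], [0], [0], [1, 2, 3], [1, 2, 3], [1, 2, 3, 4, 5], [4, 5]]]"

lemma na8_16_5_check:
  "list_all2 (ext_check 1 3 5 5 na8_16) np7_11 [
     ([[12, 0, 9, 11, 4, 2, 10, 1], [12, 11, 0, 10, 1, 4, 7, 2], [4, 12, 6, 9, 3, 8, 0, 2], [4, 12, 9, 6, 8, 3, 1,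
      2]], [(0, [0, 1, 2, 3, 4, 5, 6, 7])]),
     ([[12, 4, 2, 5, 8, 9, 6, 3], [12, 9, 11, 3, 6, 4, 8, 2], [4, 12, 3, 2, 8, 6, 5, 9]], [(0, [0, 6, 2, 3, 4, 7,
      1, 5]), (1, [0, 1, 2, 3, 4, 5, 6, 7]), (2, [0, 1, 2, 3, 4, 5, 6, 7])]),
     ([[3, 9, 8, 4, 12, 2, 7, 6], [9, 2, 8, 3, 12, 6, 11, 4], [9, 8, 4, 3, 12, 6, 7, 2]], [(3, [0, 1, 2, 3, 4, 5,
      6, 7]), (3, [0, 1, 2, 3, 5, 4, 6, 7]), (4, [0, 1, 2, 3, 4, 5, 6, 7])]),
     ([[12, 6, 9, 1, 2, 4, 7, 11], [12, 3, 2, 6, 4, 8, 5, 9], [3, 12, 6, 9, 4, 2, 5, 8], [9, 12, 8, 4, 6, 2, 5,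
      3]], [(5, [0, 1, 2, 3, 4, 5, 6, 7])]),
     ([[3, 5, 6, 9, 12, 4, 8, 2], [3, 5, 4, 2, 12, 6, 9, 8], [3, 5, 2, 4, 12, 6, 9, 8], [0, 12, 11, 2, 7, 1, 4, 6],
      [6, 3, 12, 2, 9, 11, 8, 4], [12, 5, 3, 2, 9, 4, 8, 6]], [(1, [4, 1, 2, 3, 5, 7, 0, 6]), (1, [5, 0, 2, 3, 4, 7,
      1, 6]), (6, [0, 1, 2, 3, 4, 5, 6, 7])])]"
  by code_simp

lemma na8_16_s_check:
  "list_all2 (child_check subdivide 2 5 na8_16) na7_15 [
     [(7, [0, 1, 2, 3, 4, 5, 6, 7]), (7, [0, 2, 1, 3, 4, 5, 6, 7]), (7, [0, 3, 1, 2, 4, 5, 6, 7]), (8, [0, 1, 2, 3,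
      4, 5, 6, 7]), (8, [0, 2, 1, 3, 4, 5, 6, 7]), (8, [0, 3, 1, 2, 4, 5, 6, 7]), (8, [0, 1, 2, 3, 5, 4, 6, 7]), (8,
      [0, 2, 1, 3, 5, 4, 6, 7]), (8, [0, 3, 1, 2, 5, 4, 6, 7]), (9, [0, 1, 2, 3, 4, 5, 6, 7]), (8, [0, 1, 2, 3, 6,
      4, 5, 7]), (8, [0, 2, 1, 3, 6, 4, 5, 7]), (8, [0, 3, 1, 2, 6, 4, 5, 7]), (9, [0, 1, 2, 3, 4, 6, 5, 7]), (9,
      [0, 1, 2, 3, 5, 6, 4, 7])],
     []]"
  by code_simp

text \<open>The Petersen graph after one \<open>Y\<nabla>\<close> move.\<close>

definition na9_15 :: "nat list list list" where
  "na9_15 = [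
     [[], [], [0], [0], [1, 3], [1, 2, 3], [0, 1], [2, 4], [3, 5, 6, 7]]]"

lemma na9_15_4_check:
  "list_all2 (ext_check 1 3 4 4 na9_15) np8_11 [
     ([[12, 1, 6, 7, 11, 2, 10, 3, 4], [2, 12, 4, 8, 9, 3, 7, 11, 6], [3, 12, 6, 4, 2, 11, 5, 8, 9]], []),
     ([[12, 6, 0, 7, 11, 2, 3, 1, 4], [6, 12, 2, 11, 1, 7, 3, 0, 4]], [(0, [0, 1, 2, 3, 4, 5, 6, 7, 8])]),
     ([[12, 4, 8, 9, 3, 2, 11, 7, 6], [12, 4, 1, 7, 2, 11, 3, 8, 6], [4, 12, 11, 2, 6, 7, 0, 10, 1]], [])]"
  by code_simp

definition na9_16 :: "nat list list list" where
  "na9_16 = [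
     [[], [], [0], [0], [1, 2, 3], [1, 2, 3], [0, 1], [4, 5], [2, 3, 6, 7]],
     [[], [0], [0], [0], [2, 3], [2, 3, 4], [1, 4], [1, 5], [2, 3, 6, 7]],
     [[], [0], [0], [0], [2, 3], [1, 3, 4], [1, 4], [2, 5], [2, 3, 6, 7]],
     [[], [0], [0], [0], [2, 3], [1, 3, 4], [1, 4], [2, 5], [0, 3, 6, 7]],
     [[], [], [], [0], [1, 2, 3], [1, 2, 3], [0, 1], [0, 2], [3, 4, 5, 6, 7]],
     [[], [], [0], [0], [1, 3], [1, 2, 3], [0, 1], [2, 4], [3, 4, 5, 6, 7]],
     [[], [], [0], [0], [1, 2, 3], [1, 2, 3], [4, 5], [1, 2, 3, 6], [0, 1]],
     [[], [0], [0], [0], [2, 3], [1, 2, 3], [4, 5], [1, 2, 3, 6], [1, 4]],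
     [[], [], [], [0], [1, 2, 3], [1, 2, 3], [0, 1], [2, 3, 4, 5, 6], [0, 2]],
     [[], [], [0], [0], [1, 3], [1, 2, 3], [0, 1], [2, 3, 4, 5, 6], [2, 4]],
     [[], [], [0], [0], [1, 2, 3], [1, 2, 3], [1], [2, 3, 4, 5, 6], [0, 6]],
     [[], [], [0], [0], [1, 2, 3], [1, 2, 3], [0, 1], [3, 4, 5, 6], [2, 7]],
     [[], [], [0], [0], [1, 2, 3], [1, 2, 3], [0, 1], [2, 3, 4, 5], [6, 7]]]"

lemma na9_16_4_check:
  "list_all2 (ext_check 1 3 4 4 na9_16) np8_12 [
     ([[0, 12, 11, 2, 6, 7, 10, 1, 4]], []),
     ([[1, 12, 2, 11, 6, 7, 10, 3, 4]], []),
     ([[3, 12, 9, 6, 11, 4, 5, 2, 8]], []),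
     ([[3, 11, 8, 9, 12, 2, 6, 1, 4], [8, 11, 9, 3, 12, 4, 6, 1, 2]], [(0, [0, 1, 2, 3, 4, 5, 6, 7, 8])]),
     ([[1, 12, 2, 11, 7, 6, 10, 0, 4]], []),
     ([[3, 12, 6, 9, 2, 8, 1, 11, 4]], []),
     ([[12, 1, 5, 6, 8, 3, 2, 4, 11], [12, 11, 9, 5, 8, 3, 6, 4, 2]], [(1, [0, 1, 2, 3, 4, 5, 6, 7, 8])]),
     ([[12, 6, 9, 1, 4, 11, 3, 2, 8]], [(2, [0, 1, 2, 3, 4, 5, 6, 7, 8]), (2, [0, 2, 1, 3, 5, 4, 7, 6, 8]), (3, [0,
      1, 2, 3, 4, 5, 6, 7, 8])]),
     ([[8, 6, 5, 9, 12, 3, 7, 4, 2], [4, 9, 6, 1, 12, 2, 5, 8, 3]], [(0, [0, 6, 2, 3, 4, 8, 1, 7, 5])]),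
     ([[7, 12, 11, 2, 4, 1, 3, 8, 6]], []),
     ([[3, 5, 4, 8, 12, 9, 2, 7, 6], [6, 8, 7, 4, 12, 2, 9, 5, 3], [9, 12, 2, 3, 8, 4, 11, 6, 7]], []),
     ([[12, 8, 7, 11, 6, 2, 3, 9, 4], [12, 11, 0, 10, 4, 1, 6, 7, 2], [2, 12, 4, 8, 9, 3, 7, 11, 6]], []),
     ([[12, 0, 6, 9, 4, 2, 1, 7, 11], [2, 12, 6, 9, 8, 3, 0, 11, 4], [8, 12, 6, 2, 4, 11, 5, 3, 9]], []),
     ([[12, 11, 9, 3, 6, 4, 1, 8, 2], [0, 12, 2, 4, 6, 9, 1, 7, 11]], [(2, [2, 7, 0, 5, 3, 8, 4, 6, 1])]),
     ([[12, 2, 3, 8, 6, 9, 0, 10, 4], [12, 2, 8, 3, 9, 6, 11, 1, 4], [4, 12, 6, 9, 8, 3, 0, 1, 2]], []),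
     ([[2, 5, 12, 4, 3, 11, 9, 8, 6], [9, 3, 12, 11, 6, 2, 4, 5, 8], [11, 3, 12, 9, 5, 2, 4, 6, 8], [12, 1, 6, 2,
      4, 8, 11, 10, 0]], []),
     ([[8, 2, 12, 4, 11, 3, 9, 7, 6]], []),
     ([[9, 4, 6, 12, 1, 8, 3, 11, 2]], []),
     ([[7, 11, 10, 0, 1, 12, 4, 6, 2], [11, 6, 9, 5, 8, 12, 3, 4, 2], [12, 8, 4, 2, 9, 1, 6, 7, 11]], [(1, [5, 0,
      2, 3, 4, 8, 1, 7, 6]), (0, [7, 5, 6, 8, 2, 3, 0, 4, 1])]),
     ([[2, 7, 8, 4, 12, 9, 11, 6, 3], [8, 9, 11, 3, 4, 6, 5, 12, 2], [8, 12, 4, 2, 0, 9, 6, 11, 1], [12, 11, 9, 3,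
      4, 5, 6, 2, 8]], [(2, [4, 2, 1, 3, 8, 5, 7, 0, 6]), (2, [5, 2, 0, 3, 8, 4, 7, 1, 6]), (1, [7, 2, 6, 8, 1, 0,
      4, 5, 3])]),
     ([[12, 4, 1, 7, 11, 2, 3, 8, 6], [12, 4, 7, 1, 2, 11, 3, 8, 6], [9, 12, 2, 4, 0, 11, 3, 8, 6], [9, 12, 2, 4,
      11, 1, 8, 3, 6]], []),
     ([[6, 7, 10, 0, 12, 1, 4, 11, 2], [6, 7, 0, 10, 12, 1, 4, 11, 2], [11, 1, 12, 2, 0, 9, 7, 4, 6], [1, 11, 12,
      8, 6, 9, 2, 4, 3], [12, 7, 4, 1, 11, 2, 10, 6, 0], [4, 6, 2, 12, 7, 8, 1, 3, 11], [6, 2, 4, 12, 0, 3, 11, 8,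
      9]], []),
     ([[9, 5, 8, 11, 12, 4, 3, 2, 6], [5, 12, 4, 6, 11, 8, 2, 3, 9], [4, 11, 8, 5, 12, 3, 6, 9, 2], [11, 4, 5, 8,
      9, 6, 3, 12, 2], [12, 5, 6, 4, 3, 2, 8, 11, 9], [0, 12, 8, 9, 5, 4, 6, 2, 3], [8, 6, 12, 9, 4, 2, 7, 5, 3],
      [12, 11, 3, 9, 4, 2, 6, 5, 8]], [(3, [7, 0, 2, 8, 6, 1, 5, 4, 3]), (3, [4, 1, 3, 8, 5, 0, 6, 7, 2])])]"
  by code_simp

lemma na9_16_5_check:
  "list_all2 (ext_check 1 3 5 5 na9_16) np8_11 [
     ([[12, 6, 0, 9, 2, 4, 11, 10, 1], [2, 12, 4, 8, 9, 3, 7, 11, 6], [6, 12, 4, 8, 9, 3, 7, 11, 2], [12, 0, 6, 9,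
      4, 2, 10, 11, 1]], [(4, [0, 1, 2, 3, 4, 5, 6, 7, 8])]),
     ([[12, 8, 11, 7, 2, 6, 3, 1, 4], [6, 12, 11, 2, 0, 7, 3, 1, 4], [12, 2, 5, 8, 6, 9, 0, 3, 4], [12, 3, 2, 11,
      4, 6, 5, 9, 8]], [(5, [0, 1, 2, 3, 4, 5, 6, 7, 8]), (5, [1, 0, 4, 5, 2, 3, 6, 7, 8]), (5, [2, 4, 0, 5, 1, 3,
      7, 6, 8]), (5, [4, 2, 1, 3, 0, 5, 7, 6, 8])]),
     ([[12, 2, 8, 3, 6, 9, 0, 1, 4], [12, 4, 7, 1, 11, 2, 3, 8, 6], [4, 12, 2, 11, 1, 7, 8, 3, 6], [6, 12, 3, 2, 9,
      8, 1, 11, 4]], [])]"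
  by code_simp

lemma na9_16_s_check:
  "list_all2 (child_check subdivide 2 5 na9_16) na8_15 [
     [(6, [0, 1, 2, 3, 4, 5, 6, 7, 8]), (6, [0, 2, 1, 3, 4, 5, 6, 7, 8]), (6, [0, 3, 1, 2, 4, 5, 6, 7, 8]), (7, [0,
      1, 2, 3, 4, 5, 6, 7, 8]), (7, [0, 2, 1, 3, 4, 5, 6, 7, 8]), (7, [0, 3, 1, 2, 4, 5, 6, 7, 8]), (7, [0, 1, 2, 3,
      5, 4, 6, 7, 8]), (7, [0, 2, 1, 3, 5, 4, 6, 7, 8]), (7, [0, 3, 1, 2, 5, 4, 6, 7, 8]), (6, [6, 4, 5, 7, 1, 2, 0,
      3, 8]), (6, [6, 5, 4, 7, 1, 2, 0, 3, 8]), (7, [0, 1, 2, 3, 7, 4, 6, 5, 8]), (7, [0, 2, 1, 3, 7, 4, 6, 5, 8]),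
      (7, [0, 3, 1, 2, 7, 4, 6, 5, 8]), (6, [6, 7, 4, 5, 1, 2, 0, 3, 8])],
     [(8, [0, 1, 2, 3, 4, 5, 6, 7, 8]), (8, [0, 1, 3, 2, 4, 5, 6, 7, 8]), (8, [1, 0, 4, 5, 2, 3, 6, 7, 8]), (9, [0,
      1, 2, 3, 4, 5, 6, 7, 8]), (9, [0, 1, 3, 2, 4, 5, 6, 7, 8]), (8, [1, 0, 5, 4, 2, 3, 6, 7, 8]), (9, [0, 1, 2, 3,
      5, 4, 6, 7, 8]), (9, [0, 1, 3, 2, 5, 4, 6, 7, 8]), (10, [0, 1, 2, 3, 4, 5, 6, 7, 8]), (10, [1, 0, 4, 5, 2, 3,
      6, 7, 8]), (11, [0, 1, 2, 3, 4, 5, 6, 7, 8]), (11, [0, 1, 3, 2, 4, 5, 6, 7, 8]), (11, [1, 0, 4, 5, 2, 3, 6, 7,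
      8]), (11, [1, 0, 5, 4, 2, 3, 6, 7, 8]), (12, [0, 1, 2, 3, 4, 5, 6, 7, 8])]]"
  by code_simp

text \<open>The Petersen graph: cubic on ten vertices, without cycles of length three or
  four.\<close>

definition na10_15 :: "nat list list list" where
  "na10_15 = [
     [[], [], [0], [0], [1, 3], [1, 2], [0, 1], [2, 4], [3, 5], [6, 7, 8]]]"

lemma na10_15_3_check:
  "list_all2 (ext_check 1 3 3 3 na10_15) np9_12 [
     ([[3, 12, 6, 2, 7, 11, 5, 8, 4, 9]], []),
     ([[12, 9, 6, 5, 3, 8, 2, 7, 4, 11]], []),
     ([[7, 12, 9, 6, 3, 8, 11, 2, 4, 1]], []),
     ([[12, 4, 8, 5, 9, 3, 6, 2, 7, 11]], []),
     ([], [(0, [0, 1, 2, 3, 4, 5, 6, 7, 8, 9])]),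
     ([[12, 3, 6, 5, 9, 8, 4, 2, 11, 1]], []),
     ([[12, 9, 6, 3, 4, 8, 0, 10, 2, 1]], []),
     ([[12, 7, 6, 4, 2, 11, 3, 8, 5, 9]], [])]"
  by code_simp

definition na11_16 :: "nat list list list" where
  "na11_16 = [
     [[], [], [], [0], [1, 3], [1, 2], [0, 1], [2, 4], [3, 5], [6, 7, 8], [0, 2]]]"

lemma na11_16_s_check:
  "list_all2 (child_check subdivide 2 3 na11_16) na10_15 [
     [(0, [0, 1, 2, 3, 4, 5, 6, 7, 8, 9, 10]), (0, [0, 1, 3, 2, 5, 4, 6, 8, 7, 9, 10]), (0, [1, 0, 4, 5, 2, 3, 6,
      7, 8, 9, 10]), (0, [3, 5, 4, 0, 2, 1, 8, 7, 6, 9, 10]), (0, [1, 0, 5, 4, 3, 2, 6, 8, 7, 9, 10]), (0, [2, 4, 5,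
      0, 3, 1, 7, 8, 6, 9, 10]), (0, [0, 4, 6, 2, 7, 1, 3, 9, 5, 8, 10]), (0, [1, 2, 6, 4, 7, 0, 5, 9, 3, 8, 10]),
      (0, [2, 1, 7, 0, 6, 4, 5, 9, 3, 8, 10]), (0, [4, 0, 7, 1, 6, 2, 3, 9, 5, 8, 10]), (0, [3, 1, 8, 0, 6, 5, 4, 9,
      2, 7, 10]), (0, [5, 0, 8, 1, 6, 3, 2, 9, 4, 7, 10]), (0, [6, 4, 9, 0, 3, 7, 1, 8, 2, 5, 10]), (0, [7, 1, 9, 2,
      5, 6, 4, 8, 0, 3, 10]), (0, [8, 1, 9, 3, 4, 6, 5, 7, 0, 2, 10])]]"
  by code_simp

definition na12_17 :: "nat list list list" where
  "na12_17 = [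
     [[], [], [], [], [1, 3], [1, 2], [0, 1], [2, 4], [3, 5], [6, 7, 8], [0, 2], [0, 3]],
     [[], [], [], [0], [3], [1, 2], [0, 1], [2, 4], [3, 5], [6, 7, 8], [0, 2], [1, 4]],
     [[], [], [], [0], [1], [1, 2], [0, 1], [2, 4], [3, 5], [6, 7, 8], [0, 2], [3, 4]],
     [[], [], [], [0], [1, 3], [1, 2], [0, 1], [2, 4], [3, 5], [6, 7, 8], [2], [0, 10]]]"

lemma na12_17_s_check:
  "list_all2 (child_check subdivide 2 3 na12_17) na11_16 [
     [(0, [0, 1, 2, 3, 4, 5, 6, 7, 8, 9, 10, 11]), (1, [0, 1, 2, 3, 4, 5, 6, 7, 8, 9, 10, 11]), (2, [0, 1, 2, 3, 4,
      5, 6, 7, 8, 9, 10, 11]), (2, [2, 4, 0, 5, 1, 3, 7, 6, 8, 9, 10, 11]), (0, [2, 4, 0, 5, 1, 3, 7, 6, 8, 9, 10,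
      11]), (0, [0, 8, 2, 6, 9, 5, 3, 7, 1, 4, 10, 11]), (2, [0, 4, 2, 6, 1, 7, 3, 5, 9, 8, 10, 11]), (0, [2, 8, 0,
      7, 9, 3, 5, 6, 4, 1, 10, 11]), (2, [2, 1, 0, 7, 4, 6, 5, 3, 9, 8, 10, 11]), (2, [0, 9, 2, 3, 8, 7, 6, 5, 4, 1,
      10, 11]), (2, [2, 9, 0, 5, 8, 6, 7, 3, 1, 4, 10, 11]), (2, [0, 8, 2, 6, 9, 5, 3, 7, 1, 4, 10, 11]), (2, [2, 8,
      0, 7, 9, 3, 5, 6, 4, 1, 10, 11]), (1, [0, 8, 2, 6, 9, 5, 3, 7, 1, 4, 10, 11]), (3, [0, 1, 2, 3, 4, 5, 6, 7, 8,
      9, 10, 11]), (3, [2, 4, 0, 5, 1, 3, 7, 6, 8, 9, 10, 11])]]"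
  by code_simp

text \<open>The Petersen graph subdivided three times, and as last entry the Petersen graph with a
  separate triangle, the one shape that comes from an ear.\<close>

definition na13_18 :: "nat list list list" where
  "na13_18 = [
     [[], [], [], [], [3], [1, 2], [0, 1], [2, 4], [3, 5], [6, 7, 8], [0, 2], [0, 3], [1, 4]],
     [[], [], [], [], [1], [1, 2], [0, 1], [2, 4], [3, 5], [6, 7, 8], [0, 2], [0, 3], [3, 4]],
     [[], [], [], [], [1, 3], [1, 2], [1], [2, 4], [3, 5], [6, 7, 8], [0, 2], [0, 3], [0, 6]],
     [[], [], [], [], [1, 3], [1, 2], [0], [2, 4], [3, 5], [6, 7, 8], [0, 2], [0, 3], [1, 6]],
     [[], [], [], [], [1, 3], [1, 2], [0, 1], [2], [3, 5], [6, 7, 8], [0, 2], [0, 3], [4, 7]],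
     [[], [], [], [], [1, 3], [1, 2], [0, 1], [2, 4], [3, 5], [6, 7, 8], [2], [0, 3], [0, 10]],
     [[], [], [], [0], [3], [1, 2], [0, 1], [2, 4], [5], [6, 7, 8], [0, 2], [1, 4], [3, 8]],
     [[], [], [], [0], [3], [1, 2], [0, 1], [2, 4], [3, 5], [6, 7], [0, 2], [1, 4], [8, 9]],
     [[], [], [], [0], [3], [1, 2], [0, 1], [2, 4], [3, 5], [6, 7, 8], [2], [1, 4], [0, 10]],
     [[], [], [], [0], [1], [2], [0, 1], [2, 4], [3, 5], [6, 7, 8], [0, 2], [3, 4], [1, 5]],
     [[], [], [], [0], [1], [1, 2], [0], [2, 4], [3, 5], [6, 7, 8], [0, 2], [3, 4], [1, 6]],
     [[], [], [], [0], [1], [1, 2], [0, 1], [2, 4], [3, 5], [6, 7, 8], [2], [3, 4], [0, 10]],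
     [[], [], [], [0], [1, 3], [1, 2], [0, 1], [2, 4], [3, 5], [6, 7, 8], [], [0, 10], [2, 10]],
     [[], [], [0], [0], [1, 3], [1, 2], [0, 1], [2, 4], [3, 5], [6, 7, 8], [], [10], [10, 11]]]"

lemma na13_18_s_check:
  "list_all2 (child_check subdivide 2 3 na13_18) na12_17 [
     [(0, [0, 1, 2, 3, 4, 5, 6, 7, 8, 9, 10, 11, 12]), (1, [0, 1, 2, 3, 4, 5, 6, 7, 8, 9, 10, 11, 12]), (0, [0, 1,
      3, 2, 5, 4, 6, 8, 7, 9, 11, 10, 12]), (1, [0, 1, 3, 2, 5, 4, 6, 8, 7, 9, 11, 10, 12]), (2, [0, 1, 2, 3, 4, 5,
      6, 7, 8, 9, 10, 11, 12]), (3, [0, 1, 2, 3, 4, 5, 6, 7, 8, 9, 10, 11, 12]), (1, [0, 9, 3, 2, 7, 8, 6, 4, 5, 1,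
      11, 10, 12]), (4, [0, 1, 2, 3, 4, 5, 6, 7, 8, 9, 10, 11, 12]), (1, [0, 9, 2, 3, 8, 7, 6, 5, 4, 1, 10, 11,
      12]), (4, [0, 9, 2, 3, 8, 7, 6, 5, 4, 1, 10, 11, 12]), (3, [0, 9, 2, 3, 8, 7, 6, 5, 4, 1, 10, 11, 12]), (0,
      [0, 9, 3, 2, 7, 8, 6, 4, 5, 1, 11, 10, 12]), (0, [0, 9, 2, 3, 8, 7, 6, 5, 4, 1, 10, 11, 12]), (5, [0, 1, 2, 3,
      4, 5, 6, 7, 8, 9, 10, 11, 12]), (5, [0, 1, 2, 3, 4, 5, 6, 7, 8, 9, 12, 11, 10]), (5, [0, 1, 3, 2, 5, 4, 6, 8,
      7, 9, 11, 10, 12]), (5, [0, 1, 3, 2, 5, 4, 6, 8, 7, 9, 12, 10, 11])],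
     [(0, [0, 1, 2, 3, 4, 5, 6, 7, 8, 9, 10, 12, 11]), (0, [4, 2, 1, 3, 0, 5, 7, 6, 8, 9, 11, 12, 10]), (0, [1, 0,
      4, 5, 2, 3, 6, 7, 8, 9, 11, 12, 10]), (0, [2, 4, 0, 5, 1, 3, 7, 6, 8, 9, 10, 12, 11]), (0, [0, 4, 2, 6, 1, 7,
      3, 5, 9, 8, 10, 12, 11]), (0, [1, 2, 4, 6, 0, 7, 5, 3, 9, 8, 11, 12, 10]), (0, [2, 1, 0, 7, 4, 6, 5, 3, 9, 8,
      10, 12, 11]), (0, [4, 0, 1, 7, 2, 6, 3, 5, 9, 8, 11, 12, 10]), (6, [0, 1, 2, 3, 4, 5, 6, 7, 8, 9, 10, 11,
      12]), (6, [2, 4, 0, 5, 1, 3, 7, 6, 8, 9, 10, 11, 12]), (6, [0, 4, 2, 6, 1, 7, 3, 5, 9, 8, 10, 11, 12]), (6,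
      [2, 1, 0, 7, 4, 6, 5, 3, 9, 8, 10, 11, 12]), (7, [0, 1, 2, 3, 4, 5, 6, 7, 8, 9, 10, 11, 12]), (8, [0, 1, 2, 3,
      4, 5, 6, 7, 8, 9, 10, 11, 12]), (8, [2, 1, 0, 7, 4, 6, 5, 3, 9, 8, 10, 11, 12]), (8, [1, 0, 4, 5, 2, 3, 6, 7,
      8, 9, 11, 10, 12]), (8, [4, 0, 1, 7, 2, 6, 3, 5, 9, 8, 11, 10, 12])],
     [(1, [0, 1, 2, 3, 4, 5, 6, 7, 8, 9, 10, 12, 11]), (0, [4, 2, 1, 3, 0, 5, 7, 6, 8, 9, 12, 11, 10]), (9, [0, 1,
      2, 3, 4, 5, 6, 7, 8, 9, 10, 11, 12]), (0, [2, 4, 5, 0, 3, 1, 7, 8, 6, 9, 12, 10, 11]), (3, [0, 4, 2, 6, 1, 7,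
      3, 5, 9, 8, 10, 12, 11]), (10, [0, 1, 2, 3, 4, 5, 6, 7, 8, 9, 10, 11, 12]), (4, [2, 1, 0, 7, 4, 6, 5, 3, 9, 8,
      10, 12, 11]), (4, [4, 5, 3, 7, 2, 8, 1, 0, 9, 6, 11, 12, 10]), (3, [3, 2, 4, 8, 5, 7, 0, 1, 9, 6, 11, 12,
      10]), (10, [3, 5, 4, 0, 2, 1, 8, 7, 6, 9, 11, 10, 12]), (6, [3, 9, 4, 0, 6, 7, 8, 1, 2, 5, 11, 12, 10]), (10,
      [7, 3, 9, 2, 0, 8, 4, 6, 5, 1, 12, 10, 11]), (6, [0, 9, 2, 3, 8, 7, 6, 5, 4, 1, 10, 12, 11]), (11, [0, 1, 2,
      3, 4, 5, 6, 7, 8, 9, 10, 11, 12]), (11, [0, 1, 2, 3, 4, 5, 6, 7, 8, 9, 12, 11, 10]), (11, [3, 5, 4, 0, 2, 1,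
      8, 7, 6, 9, 11, 10, 12]), (11, [3, 5, 4, 0, 2, 1, 8, 7, 6, 9, 12, 10, 11])],
     [(5, [0, 1, 2, 3, 4, 5, 6, 7, 8, 9, 10, 12, 11]), (8, [0, 1, 2, 3, 4, 5, 6, 7, 8, 9, 10, 12, 11]), (11, [0, 1,
      2, 3, 4, 5, 6, 7, 8, 9, 10, 12, 11]), (11, [2, 4, 0, 5, 1, 3, 7, 6, 8, 9, 11, 12, 10]), (5, [2, 4, 0, 5, 1, 3,
      7, 6, 8, 9, 11, 12, 10]), (5, [0, 8, 2, 6, 9, 5, 3, 7, 1, 4, 10, 12, 11]), (11, [0, 4, 2, 6, 1, 7, 3, 5, 9, 8,
      10, 12, 11]), (5, [2, 8, 0, 7, 9, 3, 5, 6, 4, 1, 11, 12, 10]), (11, [2, 1, 0, 7, 4, 6, 5, 3, 9, 8, 11, 12,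
      10]), (11, [0, 9, 2, 3, 8, 7, 6, 5, 4, 1, 10, 12, 11]), (11, [2, 9, 0, 5, 8, 6, 7, 3, 1, 4, 11, 12, 10]), (11,
      [0, 8, 2, 6, 9, 5, 3, 7, 1, 4, 10, 12, 11]), (11, [2, 8, 0, 7, 9, 3, 5, 6, 4, 1, 11, 12, 10]), (8, [0, 8, 2,
      6, 9, 5, 3, 7, 1, 4, 10, 12, 11]), (12, [0, 1, 2, 3, 4, 5, 6, 7, 8, 9, 10, 11, 12]), (12, [2, 4, 0, 5, 1, 3,
      7, 6, 8, 9, 11, 10, 12]), (12, [2, 4, 0, 5, 1, 3, 7, 6, 8, 9, 12, 10, 11])]]"
  by code_simp

text \<open>The Petersen graph with an isolated vertex. The checks that follow complete this vertex
  first to a separate edge and then to a separate triangle.\<close>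

definition na11_15 :: "nat list list list" where
  "na11_15 = [
     [[], [], [0], [0], [1, 3], [1, 2], [0, 1], [2, 4], [3, 5], [6, 7, 8], []]]"

lemma na11_15_0_check:
  "list_all2 (all_ext_check 0 3 0 na11_15) na10_15 [
     [(0, [0, 1, 2, 3, 4, 5, 6, 7, 8, 9, 10])]]"
  by code_simp

definition na12_16 :: "nat list list list" where
  "na12_16 = [
     [[], [], [0], [0], [1, 3], [1, 2], [0, 1], [2, 4], [3, 5], [6, 7, 8], [], [10]]]"

lemma na12_16_1_check:
  "list_all2 (all_ext_check 0 3 1 na12_16) na11_15 [
     [(0, [0, 1, 2, 3, 4, 5, 6, 7, 8, 9, 10, 11])]]"
  by code_simp

lemma na13_18_2_check:
  "list_all2 (all_ext_check 0 3 2 na13_18) na12_16 [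
     [(13, [0, 1, 2, 3, 4, 5, 6, 7, 8, 9, 10, 11, 12])]]"
  by code_simp

text \<open>\<open>K_7\<close> after one \<open>\<nabla>Y\<close> move.\<close>

definition n2a8 :: "nat list list list" where
  "n2a8 = [
     [[], [0], [0], [0], [1, 2, 3], [1, 2, 3, 4], [1, 2, 3, 4, 5], [1, 2, 3, 4, 5, 6]]]"

lemma n2a8_6_check:
  "list_all2 (ext_check 2 3 6 6 n2a8) na7_15 [
     ([[12, 1, 7, 4, 13, 11, 2, 6], [12, 10, 11, 2, 13, 1, 4, 0], [12, 4, 7, 8, 13, 6, 2, 11], [1, 12, 13, 11, 7,
      2, 6, 4], [3, 12, 13, 6, 11, 7, 2, 4], [1, 12, 13, 11, 2, 6, 7, 4]], [(0, [0, 1, 2, 3, 4, 5, 6, 7])]),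
     ([[12, 13, 4, 8, 2, 3, 9, 6]], [])]"
  by code_simp

definition n2a9 :: "nat list list list" where
  "n2a9 = [
     [[], [0], [0], [0], [1, 2, 3], [1, 2, 3], [0, 1], [2, 3, 4, 5, 6], [2, 3, 4, 5, 6]],
     [[], [0], [0], [0], [1, 2, 3], [1, 2, 3], [4, 5], [1, 2, 3, 6], [1, 2, 3, 4, 5, 7]],
     [[], [], [0], [0], [1, 2, 3], [1, 2, 3], [0, 1], [2, 3, 4, 5, 6], [2, 3, 4, 5, 6, 7]]]"

lemma n2a9_5_check:
  "list_all2 (ext_check 2 3 5 5 n2a9) na8_16 [
     ([[3, 12, 13, 6, 11, 7, 9, 2, 4]], []),
     ([[6, 12, 13, 8, 9, 5, 4, 3, 2]], []),
     ([[6, 12, 13, 8, 9, 5, 4, 3, 2]], []),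
     ([[7, 12, 13, 6, 4, 8, 9, 3, 2]], []),
     ([[11, 12, 13, 4, 6, 9, 8, 2, 3], [6, 11, 2, 3, 12, 13, 9, 4, 8], [8, 9, 5, 6, 12, 13, 4, 3, 2], [3, 12, 13,
      6, 7, 11, 2, 8, 4], [6, 12, 13, 4, 0, 10, 1, 11, 2], [12, 6, 9, 1, 13, 4, 0, 2, 3]], []),
     ([[12, 9, 5, 6, 13, 8, 4, 3, 2], [12, 6, 5, 4, 13, 3, 2, 9, 8], [1, 12, 13, 11, 7, 6, 0, 2, 4], [1, 12, 13,
      11, 6, 7, 0, 2, 4], [12, 13, 4, 8, 3, 2, 5, 9, 6]], [(0, [0, 1, 2, 3, 4, 5, 6, 7, 8])]),
     ([[12, 9, 13, 6, 3, 11, 8, 2, 4]], []),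
     ([[6, 12, 13, 8, 9, 5, 3, 4, 2]], []),
     ([[9, 12, 13, 2, 11, 1, 4, 6, 8]], []),
     ([[5, 12, 13, 3, 4, 8, 6, 2, 9]], [])]"
  by code_simp

lemma n2a9_6_check:
  "list_all2 (ext_check 2 3 6 6 n2a9) na8_15 [
     ([[2, 6, 8, 4, 12, 13, 5, 3, 9], [3, 8, 9, 4, 12, 13, 7, 2, 6], [4, 3, 2, 6, 12, 13, 5, 8, 9], [5, 12, 13, 3,
      6, 4, 2, 8, 9], [5, 12, 13, 3, 9, 4, 2, 6, 8], [1, 12, 13, 2, 7, 4, 6, 8, 11]], [(1, [0, 1, 2, 3, 4, 5, 6, 7,
      8])]),
     ([[12, 6, 10, 0, 13, 4, 11, 1, 2], [12, 1, 6, 7, 13, 11, 0, 2, 4], [11, 12, 13, 1, 10, 0, 6, 4, 2], [8, 12,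
      13, 6, 11, 3, 9, 4, 2], [6, 12, 13, 4, 10, 2, 11, 1, 0], [5, 6, 12, 9, 13, 4, 8, 2, 3], [12, 9, 7, 4, 13, 2,
      3, 6, 11]], [(2, [0, 1, 2, 3, 4, 5, 6, 7, 8])])]"
  by code_simp

definition n2a10 :: "nat list list list" where
  "n2a10 = [
     [[], [0], [0], [0], [2, 3], [1, 3, 4], [1, 4], [2, 5], [2, 3, 6, 7], [0, 3, 4, 6, 7]],
     [[], [0], [0], [0], [2, 3], [1, 3, 4], [1, 4], [2, 5], [0, 3, 6, 7], [1, 2, 3, 6, 7]],
     [[], [0], [0], [0], [2, 3], [1, 2, 3], [4, 5], [1, 2, 3, 6], [1, 4], [2, 3, 5, 7, 8]],
     [[], [], [0], [0], [1, 2, 3], [1, 2, 3], [0, 1], [2, 3, 4, 5], [6, 7], [2, 3, 4, 5, 8]],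
     [[], [], [0], [0], [1, 3], [1, 2, 3], [0, 1], [2, 4], [3, 5, 6, 7], [2, 3, 4, 5, 6, 8]]]"

lemma n2a10_5_check:
  "list_all2 (ext_check 2 3 5 5 n2a10) na9_16 [
     ([[11, 12, 13, 6, 8, 3, 1, 9, 2, 4], [11, 12, 13, 4, 3, 9, 7, 8, 2, 6], [4, 8, 3, 11, 12, 6, 9, 7, 13, 2], [4,
      7, 2, 3, 12, 13, 6, 5, 8, 9], [12, 7, 1, 9, 13, 2, 6, 0, 4, 11], [7, 8, 12, 6, 13, 3, 2, 4, 11, 9], [7, 9, 12,
      6, 13, 3, 2, 4, 11, 8]], []),
     ([[12, 1, 8, 3, 13, 9, 11, 4, 6, 2], [12, 11, 3, 8, 13, 9, 7, 4, 6, 2], [4, 0, 12, 3, 5, 9, 13, 2, 6, 8], [5,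
      12, 13, 3, 6, 8, 11, 2, 4, 9], [7, 11, 12, 13, 9, 8, 4, 6, 3, 2], [5, 12, 13, 9, 3, 4, 6, 11, 2, 8]], []),
     ([[12, 9, 7, 3, 13, 4, 8, 11, 6, 2], [1, 11, 12, 2, 7, 6, 13, 3, 9, 4], [5, 12, 8, 13, 2, 9, 11, 3, 6, 4],
      [12, 11, 5, 2, 13, 6, 4, 3, 9, 8], [7, 12, 13, 6, 4, 3, 1, 9, 2, 11], [1, 2, 12, 13, 5, 8, 9, 6, 4, 3], [5,
      12, 8, 13, 2, 4, 7, 3, 6, 9], [12, 9, 11, 13, 1, 4, 2, 6, 7, 0]], [(0, [0, 1, 2, 3, 4, 5, 6, 7, 8, 9])]),
     ([[12, 1, 3, 7, 13, 11, 0, 6, 2, 4], [12, 11, 5, 13, 3, 6, 4, 8, 9, 2], [12, 11, 5, 13, 3, 6, 4, 8, 2, 9],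
      [12, 4, 5, 8, 13, 3, 11, 9, 2, 6], [5, 12, 9, 13, 2, 11, 8, 4, 3, 6], [5, 3, 12, 13, 11, 4, 6, 9, 8, 2], [5,
      12, 8, 3, 6, 4, 11, 2, 13, 9], [5, 12, 3, 13, 6, 11, 2, 4, 9, 8], [2, 11, 12, 9, 3, 13, 6, 5, 8, 4], [6, 12,
      11, 3, 13, 9, 5, 2, 8, 4]], [(1, [0, 1, 2, 3, 4, 5, 6, 7, 8, 9])]),
     ([[9, 11, 7, 8, 12, 6, 4, 13, 3, 2]], []),
     ([[7, 8, 11, 12, 9, 13, 6, 4, 3, 2]], []),
     ([[1, 6, 0, 10, 12, 13, 9, 4, 11, 2], [11, 12, 13, 6, 8, 3, 9, 2, 1, 4], [11, 12, 13, 4, 3, 9, 8, 2, 7, 6],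
      [12, 0, 6, 11, 13, 4, 9, 2, 10, 1], [11, 12, 13, 6, 3, 2, 9, 8, 1, 4]], []),
     ([[1, 11, 10, 0, 12, 4, 6, 13, 7, 2], [11, 6, 1, 7, 12, 2, 0, 13, 3, 4], [10, 12, 13, 4, 6, 9, 2, 0, 11, 1],
      [7, 12, 6, 13, 4, 8, 9, 3, 11, 2], [5, 12, 13, 3, 4, 9, 2, 8, 11, 6]], [(2, [0, 1, 2, 3, 4, 5, 6, 7, 8, 9])]),
     ([[11, 8, 12, 4, 13, 3, 2, 9, 7, 6]], []),
     ([[8, 11, 12, 9, 13, 4, 6, 3, 7, 2]], []),
     ([[3, 1, 12, 6, 13, 11, 2, 7, 9, 4]], []),
     ([[12, 11, 9, 3, 4, 13, 7, 6, 8, 2], [3, 12, 13, 6, 7, 11, 9, 2, 1, 4], [11, 12, 13, 1, 0, 10, 6, 4, 9, 2],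
      [12, 11, 2, 3, 13, 6, 1, 4, 9, 8], [1, 12, 13, 11, 7, 4, 0, 2, 8, 6]], [(2, [1, 6, 4, 5, 2, 7, 8, 9, 0, 3])]),
     ([[12, 6, 5, 9, 13, 8, 11, 3, 4, 2], [12, 2, 3, 5, 13, 8, 11, 9, 4, 6], [4, 12, 13, 11, 1, 7, 3, 2, 8, 6], [2,
      12, 13, 8, 3, 5, 11, 9, 4, 6]], [(3, [0, 1, 2, 3, 4, 5, 6, 7, 8, 9])])]"
  by code_simp

lemma n2a10_6_check:
  "list_all2 (ext_check 2 3 6 6 n2a10) na9_15 [
     ([[11, 8, 6, 12, 5, 13, 2, 3, 4, 9], [12, 8, 7, 3, 13, 6, 9, 11, 4, 2], [5, 6, 8, 12, 7, 13, 3, 2, 4, 9], [3,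
      12, 13, 6, 11, 7, 9, 1, 2, 4], [12, 3, 10, 11, 13, 4, 9, 0, 2, 1], [9, 11, 8, 12, 1, 6, 4, 13, 3, 2], [9, 12,
      2, 13, 10, 11, 3, 0, 4, 1], [5, 12, 8, 13, 0, 6, 9, 2, 4, 3], [12, 6, 1, 5, 3, 13, 2, 4, 9, 8]], [(4, [0, 1,
      2, 3, 4, 5, 6, 7, 8, 9]), (4, [2, 4, 0, 5, 1, 3, 7, 6, 8, 9])])]"
  by code_simp

text \<open>The Heawood graph, the incidence graph of the Fano plane: any two of the vertices 3, 5,
  6, 7, 10, 11, 12 have exactly one common neighbour.\<close>

definition n2a14 :: "nat list list list" where
  "n2a14 = [
     [[], [], [], [0], [3], [1, 2], [0, 1], [2, 4], [3, 5], [6, 7], [0, 2], [1, 4], [8, 9], [10, 11, 12]]]"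

lemma n2a14_3_check:
  "list_all2 (ext_check 2 3 3 3 n2a14) na13_18 [
     ([[12, 13, 4, 7, 2, 3, 5, 9, 6, 8, 10, 11, 0, 1]], []),
     ([[12, 13, 4, 2, 7, 3, 5, 6, 9, 8, 10, 0, 11, 1]], []),
     ([[4, 12, 13, 2, 9, 5, 7, 3, 8, 6, 10, 0, 11, 1]], []),
     ([[9, 12, 13, 1, 10, 7, 3, 0, 11, 4, 5, 2, 6, 8]], []),
     ([[12, 13, 11, 9, 5, 1, 10, 2, 4, 0, 7, 3, 8, 6]], []),
     ([[12, 13, 2, 4, 3, 7, 5, 9, 6, 8, 0, 11, 10, 1]], []),
     ([[12, 13, 4, 7, 11, 9, 5, 6, 8, 3, 10, 1, 2, 0]], []),
     ([], [(0, [0, 1, 2, 3, 4, 5, 6, 7, 8, 9, 10, 11, 12, 13])]),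
     ([[12, 13, 9, 11, 7, 4, 10, 2, 1, 0, 5, 6, 8, 3]], []),
     ([[12, 13, 11, 8, 7, 4, 5, 6, 9, 3, 1, 2, 10, 0]], []),
     ([[11, 12, 13, 7, 9, 8, 4, 5, 6, 3, 1, 2, 10, 0]], []),
     ([[12, 13, 6, 0, 7, 3, 10, 11, 4, 1, 8, 2, 5, 9]], []),
     ([[12, 13, 3, 11, 7, 9, 5, 6, 2, 8, 1, 10, 4, 0]], []),
     ([[12, 13, 6, 0, 10, 2, 7, 4, 1, 11, 3, 9, 5, 8]], [])]"
  by code_simp

subsection \<open>Small graphs\<close>

definition sized :: "nat \<Rightarrow> nat \<Rightarrow> nat \<Rightarrow> nat \<Rightarrow> 'a sgraph \<Rightarrow> bool" where
  "sized n m lo hi G \<longleftrightarrow> finite_sgraph G \<and> card (verts G) = n \<and> card (edges G) = m \<and>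
     (\<forall>u\<in>verts G. lo \<le> deg G u \<and> deg G u \<le> hi)"

lemma sizedD:
  assumes "sized n m lo hi G"
  shows "finite_sgraph G" "card (verts G) = n" "card (edges G) = m"
    "u \<in> verts G \<Longrightarrow> lo \<le> deg G u \<and> deg G u \<le> hi"
  using assms by (auto simp: sized_def)

lemma sized_mono: "sized n m lo hi G \<Longrightarrow> lo' \<le> lo \<Longrightarrow> hi \<le> hi' \<Longrightarrow> sized n m lo' hi' G"
  by (force simp: sized_def)

lemma sized_del_vert:
  assumes s: "sized n m lo hi G" and v: "v \<in> verts G"
  shows "sized (n - 1) (m - deg G v) (lo - 1) hi (del_verts G {v})"
proof -
  note D = sizedD[OF s]
  have "lo - 1 \<le> deg (del_verts G {v}) u \<and> deg (del_verts G {v}) u \<le> hi" if u: "u \<in> verts (del_verts G {v})" for u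
  proof -
    have "u \<in> verts G" using u by simp
    then show ?thesis using deg_del_vert_bounds[OF D(1) u v] D(4)[of u] by linarith
  qed
  then show ?thesis
    using D card_verts_del_vert[OF D(1) v] card_edges_del_vert[OF D(1), of v] finite_sgraph_del_verts[OF D(1)]
    by (auto simp: sized_def)
qed

lemma sized_del:
  assumes "sized n m lo hi G" "v \<in> verts G" "deg G v = d" "n' = n - 1" "m' = m - d" "lo' = lo - 1"
  shows "sized n' m' lo' hi (del_verts G {v})"
  using sized_del_vert[OF assms(1,2)] assms(3-6) by simp

lemma sized_smooth:
  assumes s: "sized n m lo hi G" and v: "v \<in> verts G"
    and N: "neighbours G v = {x, y}" "x \<noteq> y" "{x, y} \<notin> edges G"
  shows "sized (n - 1) (m - 1) lo hi (smooth G v x y)"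
proof -
  note D = sizedD[OF s]
  have "{x, y} \<subseteq> verts G - {v}" using neighbours_subset[OF D(1), of v] N(1) by simp
  then have "finite_sgraph (smooth G v x y)" using finite_sgraph_smooth[OF D(1)] N(2) by blast
  moreover have "verts (smooth G v x y) = verts G - {v}" by (simp add: smooth_def)
  ultimately show ?thesis
    using D card_verts_smooth[OF D(1) v, of x y] card_edges_smooth[OF D(1) N] deg_smooth[OF D(1) N]
    by (auto simp: sized_def)
qed

lemma deg_sum_lower:
  assumes s: "sized n m lo hi G" and v: "v \<in> verts G"
  shows "deg G v + lo * (n - 1) \<le> 2 * m"
proof -
  note D = sizedD[OF s]
  have fin: "finite (verts G)" using finite_sgraph_edgesD(1)[OF D(1)] .
  have "lo * card (verts G - {v}) \<le> (\<Sum>u\<in>verts G - {v}. deg G u)"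
    using sum_bounded_below[of "verts G - {v}" lo "deg G"] D(4) by (auto simp: mult.commute)
  then show ?thesis
    using sum_deg[OF D(1)] sum.remove[OF fin v, of "deg G"] D v fin by (simp add: card_Diff_singleton)
qed

text \<open>The vertex of largest degree is the one to be removed. Its degree becomes the new upper
  bound, which narrows the candidates for its neighbourhood; the average degree bounds it from
  below, the degrees of the other vertices from above.\<close>

lemma sized_max_deg:
  assumes s: "sized n m lo hi G" and n: "0 < n"
  obtains v where "v \<in> verts G" "sized n m lo (deg G v) G" "2 * m \<le> deg G v * n" "deg G v + lo * (n - 1) \<le> 2 * m"
    "deg G v < n" "lo \<le> deg G v" "deg G v \<le> hi"
proof -
  note D = sizedD[OF s]
  have "verts G \<noteq> {}" using D(2) n by auto
  then obtain v where v: "v \<in> verts G" "\<And>u. u \<in> verts G \<Longrightarrow> deg G u \<le> deg G v" "2 * card (edges G) \<le> deg G v * card (verts G)"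
    using max_deg_vertex[OF D(1)] by metis
  then show thesis
    using that[of v] D D(4)[of v] deg_less[OF D(1), of v] deg_sum_lower[OF s, of v] by (auto simp: sized_def)
qed

text \<open>The average equals the upper bound, so a vertex of smaller degree could not be
  compensated.\<close>

lemma sized_regular:
  assumes s: "sized n m lo hi G" and r: "hi * n = 2 * m"
  shows "sized n m hi hi G"
proof -
  note D = sizedD[OF s]
  have fin: "finite (verts G)" using finite_sgraph_edgesD(1)[OF D(1)] .
  have "hi \<le> deg G w" if w: "w \<in> verts G" for w
  proof -
    have "(\<Sum>u\<in>verts G - {w}. deg G u) \<le> hi * card (verts G - {w})"
      using sum_bounded_above[of "verts G - {w}" "deg G" hi] D(4) by (auto simp: mult.commute)
    then have "hi * n \<le> deg G w + hi * (n - 1)"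
      using sum.remove[OF fin w, of "deg G"] sum_deg[OF D(1)] D(2,3) r w fin by (simp add: card_Diff_singleton)
    moreover have "0 < n" using w fin D(2) card_gt_0_iff by blast
    ultimately show ?thesis by (cases n) auto
  qed
  then show ?thesis using D by (auto simp: sized_def)
qed

lemma sized_low_vertex:
  assumes s: "sized n m lo hi G" and "2 * m < 3 * n"
  obtains v where "v \<in> verts G" "deg G v \<le> 2" "lo \<le> deg G v"
proof -
  have "2 * card (edges G) < 3 * card (verts G)" using sizedD(2,3)[OF s] assms(2) by simp
  then obtain v where "v \<in> verts G" "deg G v \<le> 2" using low_deg_vertex[OF sizedD(1)[OF s]] by blast
  then show thesis using that sizedD(4)[OF s] by blast
qed

lemma deg_2_neighbours:
  assumes "finite_sgraph G" "deg G v = 2"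
  obtains x y where "neighbours G v = {x, y}" "x \<noteq> y"
proof -
  obtain x y where "neighbours G v = {x, y}" "x \<noteq> y" using assms(2) unfolding card_2_iff by (elim exE conjE)
  then show thesis by (rule that)
qed

lemma not_apex_del_vert: "\<not> apex (Suc k) G \<Longrightarrow> v \<in> verts G \<Longrightarrow> \<not> apex k (del_verts G {v})"
  using apex_Suc[of v G k] by argo

lemma not_apex_ear:
  assumes G: "finite_sgraph G" "v \<in> verts G" "neighbours G v = {x, y}" "x \<noteq> y" "{x, y} \<in> edges G" and ap: "\<not> apex k G"
  shows "\<not> apex k (del_verts G {v})"
proof -
  have "v \<notin> {x, y}" using neighbours_irrefl[OF G(1), of v] G(3) by simp
  then have "smooth G v x y = del_verts G {v}" using G(5) by (intro smooth_adjacent) auto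
  then show ?thesis using apex_smooth[OF G(1-4)] ap by metis
qed

text \<open>A vertex of degree at most one is deleted. A vertex of degree two is deleted if its
  neighbours are adjacent and smoothed otherwise. No degree grows, and an edge is lost unless
  \<open>v\<close> is isolated.\<close>

lemma reduce:
  assumes G: "finite_sgraph G" "v \<in> verts G" "deg G v \<le> 2" and ap: "\<not> apex k G"
  obtains H :: "'a sgraph" where "finite_sgraph H" "\<not> apex k H" "card (verts H) = card (verts G) - 1"
    "card (edges H) \<le> card (edges G) - (if deg G v = 0 then 0 else 1)"
    "verts H = verts G - {v}" "\<And>u. u \<in> verts H \<Longrightarrow> deg H u \<le> deg G u"
proof (cases "deg G v \<le> 1")
  case True
  show thesis
  proof (rule that[of "del_verts G {v}"])
    show "\<not> apex k (del_verts G {v})" using apex_del_vert_degree_le_1[OF G(1,2) True] ap by blast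
    show "card (edges (del_verts G {v})) \<le> card (edges G) - (if deg G v = 0 then 0 else 1)"
      using card_edges_del_vert[OF G(1), of v] by auto
    show "deg (del_verts G {v}) u \<le> deg G u" if "u \<in> verts (del_verts G {v})" for u
      using deg_del_vert_bounds(2)[OF G(1) that G(2)] .
  qed (use G card_verts_del_vert[OF G(1,2)] finite_sgraph_del_verts[OF G(1)] in auto)
next
  case False
  then have "deg G v = 2" using G(3) by simp
  then obtain x y where N: "neighbours G v = {x, y}" "x \<noteq> y" using deg_2_neighbours[OF G(1)] by blast
  show thesis
  proof (cases "{x, y} \<in> edges G")
    case True
    show thesis
    proof (rule that[of "del_verts G {v}"])
      show "\<not> apex k (del_verts G {v})" using not_apex_ear[OF G(1,2) N True ap] .
      show "card (edges (del_verts G {v})) \<le> card (edges G) - (if deg G v = 0 then 0 else 1)"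
        using card_edges_del_vert[OF G(1), of v] by auto
      show "deg (del_verts G {v}) u \<le> deg G u" if "u \<in> verts (del_verts G {v})" for u
        using deg_del_vert_bounds(2)[OF G(1) that G(2)] .
    qed (use G card_verts_del_vert[OF G(1,2)] finite_sgraph_del_verts[OF G(1)] in auto)
  next
    case new: False
    have xy: "{x, y} \<subseteq> verts G - {v}" using neighbours_subset[OF G(1), of v] N(1) by simp
    show thesis
    proof (rule that[of "smooth G v x y"])
      show "finite_sgraph (smooth G v x y)" by (rule finite_sgraph_smooth[OF G(1) xy N(2)])
      show "\<not> apex k (smooth G v x y)" using apex_smooth[OF G(1,2) N] ap by blast
      show "card (verts (smooth G v x y)) = card (verts G) - 1" by (rule card_verts_smooth[OF G(1,2)])
      show "card (edges (smooth G v x y)) \<le> card (edges G) - (if deg G v = 0 then 0 else 1)"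
        using card_edges_smooth[OF G(1) N new] \<open>deg G v = 2\<close> by simp
      show "verts (smooth G v x y) = verts G - {v}" by (simp add: smooth_def)
      then show "deg (smooth G v x y) u \<le> deg G u" if "u \<in> verts (smooth G v x y)" for u
        using that deg_smooth[OF G(1) N new, of u] by auto
    qed
  qed
qed

text \<open>Such a graph is contained in \<open>K_5\<close> without an edge, which is found in
  \<open>host\<close>; the numbers 3 and 4 stand for the missing edge.\<close>

lemma planar_5_9:
  assumes G: "finite_sgraph G" and n: "card (verts G) \<le> 5" and m: "card (edges G) \<le> 9"
  shows "planar G"
proof -
  note fin = finite_sgraph_edgesD[OF G]
  have "\<exists>g. inj_on g (verts G) \<and> g ` verts G \<subseteq> {..<5::nat} \<and> (\<forall>e\<in>edges G. g ` e \<noteq> {3, 4})"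
  proof (cases "card (verts G) = 5")
    case False
    then have le: "card (verts G) \<le> 4" using n by simp
    obtain g where g: "bij_betw g (verts G) {0..<card (verts G)}"
      using ex_bij_betw_finite_nat[OF fin(1)] by blast
    then have sub: "g ` verts G \<subseteq> {..<4}" using le by (auto simp: bij_betw_def)
    have "g ` e \<noteq> {3, 4}" if "e \<in> edges G" for e
    proof
      assume "g ` e = {3, 4}"
      then have "4 \<in> g ` verts G" using fin(3)[OF that] by blast
      then show False using sub by auto
    qed
    moreover have "g ` verts G \<subseteq> {..<5}" using sub by force
    moreover have "inj_on g (verts G)" using g by (simp add: bij_betw_def)
    ultimately show ?thesis by (intro exI[of _ g]) simp
  next
    case True
    \<comment> \<open>Five vertices have ten pairs, so some pair \<open>u\<close>, \<open>w\<close>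
      is not an edge; it is sent to 3 and 4.\<close>
    define P where "P = {e. e \<subseteq> verts G \<and> card e = 2}"
    have "card P = 10" unfolding P_def using n_subsets[OF fin(1), of 2] True by (simp add: choose_two)
    moreover have "finite P" unfolding P_def using fin(1) by simp
    moreover have "edges G \<subseteq> P" using fin(3,4) by (auto simp: P_def)
    ultimately have "edges G \<noteq> P" using m by auto
    then obtain e where "e \<in> P" "e \<notin> edges G" using \<open>edges G \<subseteq> P\<close> by blast
    then obtain u w where uw: "u \<in> verts G" "w \<in> verts G" "u \<noteq> w" "{u, w} \<notin> edges G"
      by (auto simp: P_def card_2_iff)
    have "card (verts G - {u, w}) = 3" using uw True fin(1) by (simp add: card_Diff_subset)
    then obtain g where g: "bij_betw g (verts G - {u, w}) {0..<3::nat}"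
      using ex_bij_betw_finite_nat[of "verts G - {u, w}"] fin(1) by auto
    define h where "h = g(u := 3, w := 4)"
    have h: "h u = 3" "h w = 4" "\<And>x. x \<in> verts G - {u, w} \<Longrightarrow> h x = g x \<and> g x < 3"
      using g uw by (auto simp: h_def bij_betw_def)
    have inj: "inj_on h (verts G)"
    proof (rule inj_onI)
      fix x y assume xy: "x \<in> verts G" "y \<in> verts G" "h x = h y"
      show "x = y"
      proof (cases "x \<in> {u, w} \<or> y \<in> {u, w}")
        case True
        then show ?thesis using xy h(1,2) h(3)[of x] h(3)[of y] by (cases "x \<in> {u, w}"; cases "y \<in> {u, w}") auto
      next
        case False
        then have "g x = g y" using xy h(3)[of x] h(3)[of y] by auto
        then show ?thesis using g xy False by (auto simp: bij_betw_def dest: inj_onD)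
      qed
    qed
    have sub: "h ` verts G \<subseteq> {..<5}"
    proof
      fix t assume "t \<in> h ` verts G"
      then obtain x where "x \<in> verts G" "t = h x" by blast
      then show "t \<in> {..<5}" using h(1,2) h(3)[of x] by (cases "x \<in> {u, w}") auto
    qed
    have "h ` e \<noteq> {3, 4}" if e: "e \<in> edges G" for e
    proof
      assume "h ` e = {3, 4}"
      then have "h ` e = h ` {u, w}" using h by simp
      then have "e = {u, w}" using inj_on_image_eq_iff[OF inj fin(3)[OF e], of "{u, w}"] uw by simp
      then show False using uw e by simp
    qed
    then show ?thesis using inj sub by (intro exI[of _ h]) simp
  qed
  then obtain g where "inj_on g (verts G) \<and> g ` verts G \<subseteq> {..<5::nat} \<and> (\<forall>e\<in>edges G. g ` e \<noteq> {3, 4})" ..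
  then have g: "inj_on g (verts G)" "g ` verts G \<subseteq> {..<5}" "\<And>e. e \<in> edges G \<Longrightarrow> g ` e \<noteq> {3, 4}"
    by simp_all
  \<comment> \<open>The vertices 0, 1, 4, 10, 2 of \<open>host\<close> are pairwise adjacent except
    for 10 and 2, which stand at positions 3 and 4.\<close>
  define c where "c = (!) [0, 1, 4, 10, 2::nat]"
  have c: "inj_on c {..<5}" "c ` {..<5} \<subseteq> verts (graph_of host)"
  proof -
    have "bij_betw ((!) [0, 1, 4, 10, 2::nat]) {..<5} {0, 1, 4, 10, 2}" by (intro bij_betw_nth) auto
    then show "inj_on c {..<5}" "c ` {..<5} \<subseteq> verts (graph_of host)"
      by (auto simp: bij_betw_def c_def graph_of_def host_def)
  qed
  have "\<forall>j\<in>set [0..<5]. \<forall>i\<in>set [0..<j]. (i = 3 \<and> j = 4) \<or> adj host ([0, 1, 4, 10, 2] ! i) ([0, 1, 4, 10, 2] ! j)"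
    by code_simp
  then have adj: "adj host (c i) (c j)" if "i < j" "j < 5" "\<not> (i = 3 \<and> j = 4)" for i j
    using that unfolding c_def set_upt by (meson atLeastLessThan_iff le0)
  show ?thesis
  proof (rule planar_embed[OF planar_host, of "c \<circ> g"])
    show "inj_on (c \<circ> g) (verts G)" using g c by (auto intro: comp_inj_on inj_on_subset)
    show "(c \<circ> g) ` verts G \<subseteq> verts (graph_of host)" using g c by force
    fix e assume e: "e \<in> edges G"
    obtain u w where uw: "e = {u, w}" "u \<noteq> w" using fin(4)[OF e] by (auto simp: card_2_iff)
    then have V: "u \<in> verts G" "w \<in> verts G" using fin(3)[OF e] by auto
    define i j where "i = g u" and "j = g w"
    have ij: "i \<noteq> j" "i < 5" "j < 5" "{i, j} \<noteq> {3, 4}"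
      using V uw(2) g(1,2) g(3)[OF e] uw(1) by (auto simp: i_def j_def dest: inj_onD)
    have ne: "\<not> (i = 3 \<and> j = 4)" "\<not> (j = 3 \<and> i = 4)" using ij(4) by auto
    have "adj host (c i) (c j)"
    proof (cases "i < j")
      case True then show ?thesis using adj[of i j] ij ne by simp
    next
      case False
      then have "adj host (c j) (c i)" using adj[of j i] ij ne by simp
      then show ?thesis by (simp add: adj_sym)
    qed
    moreover have "c i < length host" "c j < length host" using c(2) ij by (auto simp: graph_of_def)
    ultimately have "{c i, c j} \<in> edges (graph_of host)" by (auto simp: graph_of_def)
    then show "e \<subseteq> verts G \<and> (c \<circ> g) ` e \<in> edges (graph_of host)"
      using V uw by (simp add: i_def j_def)
  qed
qed

text \<open>On six or more vertices the degree sum is at most 16 < 18, so some vertex has degree at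
  most two and \<open>reduce\<close> applies. The bound is sharp because of
  \<open>K_{3,3}\<close>.\<close>

lemma planar_le_8_edges:
  assumes "finite_sgraph G" "card (edges G) \<le> 8"
  shows "planar G"
  using assms
proof (induction "card (verts G)" arbitrary: G rule: less_induct)
  case less
  show ?case
  proof (cases "card (verts G) \<le> 5")
    case True
    show ?thesis by (rule planar_5_9[OF less.prems(1) True]) (use less.prems(2) in simp)
  next
    case False
    show ?thesis
    proof (rule ccontr)
      assume "\<not> planar G"
      then have ap: "\<not> apex 0 G" by (simp add: apex_0)
      obtain v where "v \<in> verts G" "deg G v \<le> 2"
        using low_deg_vertex[OF less.prems(1)] less.prems(2) False by auto
      then show False
      proof (rule reduce[OF less.prems(1) _ _ ap])
        fix H :: "'a sgraph" assume H: "finite_sgraph H" "\<not> apex 0 H" "card (verts H) = card (verts G) - 1"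
          "card (edges H) \<le> card (edges G) - (if deg G v = 0 then 0 else 1)"
        then have "card (verts H) < card (verts G)" "card (edges H) \<le> 8" using False less.prems(2) by auto
        then show False using less.hyps[of H] H(1,2) by (simp add: apex_0)
      qed
    qed
  qed
qed

text \<open>A vertex of degree at most two would be removed by \<open>reduce\<close>, against
  \<open>small\<close>. With \<open>lo = 0\<close> this vertex may be isolated, and then no edge is
  lost; hence the case distinction in the bound.\<close>

lemma min_deg_3:
  fixes G :: "'a sgraph"
  assumes s: "sized n m lo hi G" and ap: "\<not> apex k G"
    and small: "\<And>H :: 'a sgraph. finite_sgraph H \<Longrightarrow> card (verts H) = n - 1 \<Longrightarrow>
      card (edges H) \<le> m - (if lo = 0 then 0 else 1) \<Longrightarrow> apex k H"
  shows "sized n m 3 hi G"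
proof -
  note D = sizedD[OF s]
  have "3 \<le> deg G v" if v: "v \<in> verts G" for v
  proof (rule ccontr)
    assume "\<not> 3 \<le> deg G v"
    then have low: "deg G v \<le> 2" by simp
    show False
    proof (rule reduce[OF D(1) v low ap])
      fix H :: "'a sgraph" assume "finite_sgraph H" "\<not> apex k H" "card (verts H) = card (verts G) - 1"
        "card (edges H) \<le> card (edges G) - (if deg G v = 0 then 0 else 1)"
      then show False using small[of H] D(2,3) D(4)[OF v] by (cases "lo = 0"; cases "deg G v = 0") auto
    qed
  qed
  then show ?thesis using D by (auto simp: sized_def)
qed

lemma deg_sum_lower2:
  assumes s: "sized n m lo hi G" and v: "v \<in> verts G" "w \<in> verts G" "v \<noteq> w"
  shows "deg G v + deg G w + lo * (n - 2) \<le> 2 * m"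
proof -
  note D = sizedD[OF s]
  have fin: "finite (verts G)" using finite_sgraph_edgesD(1)[OF D(1)] .
  have "lo * card (verts G - {v} - {w}) \<le> (\<Sum>u\<in>verts G - {v} - {w}. deg G u)"
    using sum_bounded_below[of "verts G - {v} - {w}" lo "deg G"] D(4) by (auto simp: mult.commute)
  moreover have "card (verts G - {v} - {w}) = n - 2" using v fin D(2) by (simp add: card_Diff_singleton)
  moreover have "2 * m = deg G v + (deg G w + (\<Sum>u\<in>verts G - {v} - {w}. deg G u))"
    using sum_deg[OF D(1)] D(3) sum.remove[OF fin v(1), of "deg G"]
      sum.remove[of "verts G - {v}" w "deg G"] v fin by simp
  ultimately show ?thesis by simp
qed

text \<open>Smoothing costs one edge and keeps all degrees. Removing an ear costs two edges and
  lowers the degrees at its ends, hence the weaker bound \<open>lo - 1\<close>.\<close>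

lemma deg_2_cases:
  assumes s: "sized n m lo hi G" and v: "v \<in> verts G" "deg G v = 2" and ap: "\<not> apex k G"
  obtains (smooth) x y where "neighbours G v = {x, y}" "x \<noteq> y" "{x, y} \<notin> edges G"
      "sized (n - 1) (m - 1) lo hi (smooth G v x y)" "\<not> apex k (smooth G v x y)"
  | (ear) x y where "neighbours G v = {x, y}" "x \<noteq> y" "{x, y} \<in> edges G"
      "sized (n - 1) (m - 2) (lo - 1) hi (del_verts G {v})" "\<not> apex k (del_verts G {v})"
proof -
  note D = sizedD[OF s]
  obtain x y where N: "neighbours G v = {x, y}" "x \<noteq> y" using deg_2_neighbours[OF D(1) v(2)] by blast
  show thesis
  proof (cases "{x, y} \<in> edges G")
    case True
    then show thesis using ear[OF N True] sized_del_vert[OF s v(1)] v(2) not_apex_ear[OF D(1) v(1) N True ap] by simp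
  next
    case False
    then show thesis using smooth[OF N False sized_smooth[OF s v(1) N False]] apex_smooth[OF D(1) v(1) N] ap by blast
  qed
qed

text \<open>Otherwise the minimum degree would be three, since every reduction leaves at most eight
  edges; but nine edges support this on at most six vertices.\<close>

lemma nonplanar_9_edges:
  assumes s: "sized n 9 lo hi G" "0 < lo" "7 \<le> n"
  shows "apex 0 G"
proof (rule ccontr)
  assume ap: "\<not> apex 0 G"
  note D = sizedD[OF s(1)]
  have "sized n 9 3 hi G"
    by (rule min_deg_3[OF s(1) ap]) (use s(2) in \<open>auto simp: apex_0 intro: planar_le_8_edges\<close>)
  then show False using sum_deg_lower[OF D(1), of 3] D(2,3) s(3) by (auto simp: sized_def)
qed

text \<open>There is a vertex of degree two. Smoothing it leaves at most nine edges on at least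
  seven vertices, removing an ear leaves at most eight edges, and both results are planar.\<close>

lemma nonplanar_10_edges:
  assumes s: "sized n m lo hi G" "1 < lo" "8 \<le> n" "m \<le> 10"
  shows "apex 0 G"
proof (rule ccontr)
  assume ap: "\<not> apex 0 G"
  obtain v where v: "v \<in> verts G" "deg G v \<le> 2" "lo \<le> deg G v"
    using sized_low_vertex[OF s(1)] s(3,4) by auto
  then have v2: "deg G v = 2" using s(2) by simp
  show False
  proof (cases rule: deg_2_cases[OF s(1) v(1) v2 ap, case_names smooth ear])
    case (smooth x y)
    then have "m - 1 = 9"
      using planar_le_8_edges[OF sizedD(1)[OF smooth(4)]] sizedD(3)[OF smooth(4)] s(4) by (force simp: apex_0)
    then show False using nonplanar_9_edges[of "n - 1" lo hi "smooth G v x y"] smooth(4,5) s(2,3) by fastforce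
  next
    case (ear x y)
    then show False
      using planar_le_8_edges[OF sizedD(1)[OF ear(4)]] sizedD(3)[OF ear(4)] s(4) by (simp add: apex_0)
  qed
qed

subsection \<open>Lists of small graphs\<close>

lemma all_ext_step:
  assumes s: "sized n m lo hi G" and v: "v \<in> verts G" "deg G v = d"
    and "listed L' (del_verts G {v})" "list_all2 (all_ext_check lo hi d L) L' W"
  shows "listed L G"
  using listed_all_extension[OF sizedD(1)[OF s] v sizedD(4)[OF s]] assms(4,5) by blast

lemma ext_step:
  assumes s: "sized n m lo hi G" and v: "v \<in> verts G" "deg G v = d" and ap: "\<not> apex k G"
    and "listed L' (del_verts G {v})" "list_all2 (ext_check k lo hi d L) L' W"
  shows "listed L G"
  using listed_extension[OF sizedD(1)[OF s] v sizedD(4)[OF s] ap] assms(5,6) by blast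

lemma smooth_step:
  assumes s: "sized n m lo hi G" and v: "v \<in> verts G"
    and "neighbours G v = {x, y}" "x \<noteq> y" "{x, y} \<notin> edges G"
    and "listed L' (smooth G v x y)" "list_all2 (child_check subdivide lo hi L) L' W"
  shows "listed L G"
  using listed_smooth[OF sizedD(1)[OF s] v assms(3-5) sizedD(4)[OF s]] assms(6,7) by blast

lemma ear_step:
  assumes s: "sized n m lo hi G" and v: "v \<in> verts G"
    and "neighbours G v = {x, y}" "x \<noteq> y" "{x, y} \<in> edges G"
    and "listed L' (del_verts G {v})" "list_all2 (child_check add_ear lo hi L) L' W"
  shows "listed L G"
  using listed_ear[OF sizedD(1)[OF s] v assms(3-5) sizedD(4)[OF s]] assms(6,7) by blast

lemma listed_4: "sized 4 m lo hi G \<Longrightarrow> listed (with_edges m (all_codes 4)) G"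
  using listed_with_edges[of G "all_codes 4"] listed_all_codes[of G 4] sizedD(1,2,3)[of 4 m lo hi G] by simp

lemma listed_5_6:
  assumes s: "sized 5 6 2 hi G"
  shows "listed g5_6 G"
proof -
  obtain v where v: "v \<in> verts G" and t: "sized 5 6 2 (deg G v) G" and d: "2 * 6 \<le> deg G v * 5" "deg G v + 2 * (5 - 1) \<le> 2 * 6" "deg G v < 5" "deg G v \<le> hi"
    by (rule sized_max_deg[OF s], simp, rule that; assumption)
  consider "deg G v = 3" | "deg G v = 4" using d by linarith
  then show ?thesis
  proof cases
    case 1
    have "sized 4 3 1 3 (del_verts G {v})" by (rule sized_del[OF t[unfolded 1] v 1]) simp_all
    from all_ext_step[OF t[unfolded 1] v 1 listed_4[OF this] g5_6_3_check] show ?thesis .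
  next
    case 2
    have "sized 4 2 1 4 (del_verts G {v})" by (rule sized_del[OF t[unfolded 2] v 2]) simp_all
    from all_ext_step[OF t[unfolded 2] v 2 listed_4[OF this] g5_6_4_check] show ?thesis .
  qed
qed

lemma listed_5_5:
  assumes s: "sized 5 5 2 hi G"
  shows "listed g5_5 G"
proof -
  obtain v where v: "v \<in> verts G" and t: "sized 5 5 2 (deg G v) G" and d: "2 * 5 \<le> deg G v * 5" "deg G v + 2 * (5 - 1) \<le> 2 * 5" "deg G v < 5" "deg G v \<le> hi"
    by (rule sized_max_deg[OF s], simp, rule that; assumption)
  have dv: "deg G v = 2" using d by linarith
  have "sized 4 3 1 2 (del_verts G {v})" by (rule sized_del[OF t[unfolded dv] v dv]) simp_all
  from all_ext_step[OF t[unfolded dv] v dv listed_4[OF this] g5_5_2_check] show ?thesis .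
qed

lemma listed_5_3:
  assumes s: "sized 5 3 0 3 G"
  shows "listed g5_3 G"
proof -
  obtain v where v: "v \<in> verts G" and t: "sized 5 3 0 (deg G v) G" and d: "2 * 3 \<le> deg G v * 5" "deg G v + 0 * (5 - 1) \<le> 2 * 3" "deg G v < 5" "deg G v \<le> 3"
    by (rule sized_max_deg[OF s], simp, rule that; assumption)
  consider "deg G v = 2" | "deg G v = 3" using d by linarith
  then show ?thesis
  proof cases
    case 1
    have "sized 4 1 0 2 (del_verts G {v})" by (rule sized_del[OF t[unfolded 1] v 1]) simp_all
    from all_ext_step[OF t[unfolded 1] v 1 listed_4[OF this] g5_3_2_check] show ?thesis .
  next
    case 2
    have "sized 4 0 0 3 (del_verts G {v})" by (rule sized_del[OF t[unfolded 2] v 2]) simp_all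
    from all_ext_step[OF t[unfolded 2] v 2 listed_4[OF this] g5_3_3_check] show ?thesis .
  qed
qed

lemma listed_5_4:
  assumes s: "sized 5 4 1 3 G"
  shows "listed g5_4 G"
proof -
  obtain v where v: "v \<in> verts G" and t: "sized 5 4 1 (deg G v) G" and d: "2 * 4 \<le> deg G v * 5" "deg G v + 1 * (5 - 1) \<le> 2 * 4" "deg G v < 5" "deg G v \<le> 3"
    by (rule sized_max_deg[OF s], simp, rule that; assumption)
  consider "deg G v = 2" | "deg G v = 3" using d by linarith
  then show ?thesis
  proof cases
    case 1
    have "sized 4 2 0 2 (del_verts G {v})" by (rule sized_del[OF t[unfolded 1] v 1]) simp_all
    from all_ext_step[OF t[unfolded 1] v 1 listed_4[OF this] g5_4_2_check] show ?thesis .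
  next
    case 2
    have "sized 4 1 0 3 (del_verts G {v})" by (rule sized_del[OF t[unfolded 2] v 2]) simp_all
    from all_ext_step[OF t[unfolded 2] v 2 listed_4[OF this] g5_4_3_check] show ?thesis .
  qed
qed

lemma listed_6_6:
  assumes s: "sized 6 6 1 3 G"
  shows "listed g6_6 G"
proof -
  obtain v where v: "v \<in> verts G" and t: "sized 6 6 1 (deg G v) G" and d: "2 * 6 \<le> deg G v * 6" "deg G v + 1 * (6 - 1) \<le> 2 * 6" "deg G v < 6" "deg G v \<le> 3"
    by (rule sized_max_deg[OF s], simp, rule that; assumption)
  consider "deg G v = 2" | "deg G v = 3" using d by linarith
  then show ?thesis
  proof cases
    case 1
    \<comment> \<open>With largest degree two the graph is 2-regular. The raised lower bound
      provides minimum degree one after the removal, as \<open>listed_5_4\<close> demands.\<close>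
    have "sized 6 6 2 2 G" using sized_regular[OF t[unfolded 1]] by simp
    then have "sized 5 4 1 2 (del_verts G {v})" by (rule sized_del[OF _ v 1]) simp_all
    then have "sized 5 4 1 3 (del_verts G {v})" by (rule sized_mono) simp_all
    from all_ext_step[OF t[unfolded 1] v 1 listed_5_4[OF this] g6_6_2_check] show ?thesis .
  next
    case 2
    have "sized 5 3 0 3 (del_verts G {v})" by (rule sized_del[OF t[unfolded 2] v 2]) simp_all
    from all_ext_step[OF t[unfolded 2] v 2 listed_5_3[OF this] g6_6_3_check] show ?thesis .
  qed
qed

lemma listed_6_7:
  assumes s: "sized 6 7 2 3 G"
  shows "listed g6_7 G"
proof -
  obtain v where v: "v \<in> verts G" and t: "sized 6 7 2 (deg G v) G" and d: "2 * 7 \<le> deg G v * 6" "deg G v + 2 * (6 - 1) \<le> 2 * 7" "deg G v < 6" "deg G v \<le> 3"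
    by (rule sized_max_deg[OF s], simp, rule that; assumption)
  have dv: "deg G v = 3" using d by linarith
  have "sized 5 4 1 3 (del_verts G {v})" by (rule sized_del[OF t[unfolded dv] v dv]) simp_all
  from all_ext_step[OF t[unfolded dv] v dv listed_5_4[OF this] g6_7_3_check] show ?thesis .
qed

lemma listed_7_9:
  assumes s: "sized 7 9 2 3 G"
  shows "listed g7_9 G"
proof -
  obtain v where v: "v \<in> verts G" and t: "sized 7 9 2 (deg G v) G" and d: "2 * 9 \<le> deg G v * 7" "deg G v + 2 * (7 - 1) \<le> 2 * 9" "deg G v < 7" "deg G v \<le> 3"
    by (rule sized_max_deg[OF s], simp, rule that; assumption)
  have dv: "deg G v = 3" using d by linarith
  have "sized 6 6 1 3 (del_verts G {v})" by (rule sized_del[OF t[unfolded dv] v dv]) simp_all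
  from all_ext_step[OF t[unfolded dv] v dv listed_6_6[OF this] g7_9_3_check] show ?thesis .
qed

subsection \<open>Lists of nonplanar graphs\<close>

lemma listed_np6_9:
  assumes s: "sized 6 9 lo hi G" and ap: "\<not> apex 0 G"
  shows "listed np6_9 G"
proof -
  have s3: "sized 6 9 3 hi G"
    by (rule min_deg_3[OF s ap]) (auto simp: apex_0 intro: planar_5_9 split: if_splits)
  obtain v where v: "v \<in> verts G" and t: "sized 6 9 3 (deg G v) G"
    and d: "deg G v + 3 * (6 - 1) \<le> 2 * 9" "3 \<le> deg G v"
    by (rule sized_max_deg[OF s3], simp, rule that; assumption)
  have dv: "deg G v = 3" using d by linarith
  have "sized 5 6 2 3 (del_verts G {v})" by (rule sized_del[OF t[unfolded dv] v dv]) simp_all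
  from ext_step[OF t[unfolded dv] v dv ap listed_5_6[OF this] np6_9_3_check] show ?thesis .
qed

text \<open>The lower bound 1 excludes \<open>K_5\<close> with an isolated vertex, which has the
  same numbers of vertices and edges.\<close>

lemma listed_np6_10:
  assumes s: "sized 6 10 1 hi G" and ap: "\<not> apex 0 G"
  shows "listed np6_10 G"
proof -
  have s3: "sized 6 10 3 hi G"
    by (rule min_deg_3[OF s ap]) (auto simp: apex_0 intro: planar_5_9)
  obtain v where v: "v \<in> verts G" and t: "sized 6 10 3 (deg G v) G"
    and d: "2 * 10 \<le> deg G v * 6" "deg G v < 6"
    by (rule sized_max_deg[OF s3], simp, rule that; assumption)
  consider "deg G v = 4" | "deg G v = 5" using d by linarith
  then show ?thesis
  proof cases
    case 1
    have "sized 5 6 2 4 (del_verts G {v})" by (rule sized_del[OF t[unfolded 1] v 1]) simp_all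
    from ext_step[OF t[unfolded 1] v 1 ap listed_5_6[OF this] np6_10_4_check] show ?thesis .
  next
    case 2
    have "sized 5 5 2 5 (del_verts G {v})" by (rule sized_del[OF t[unfolded 2] v 2]) simp_all
    from ext_step[OF t[unfolded 2] v 2 ap listed_5_5[OF this] np6_10_5_check] show ?thesis .
  qed
qed

lemma not_planar_8: "sized n m lo hi G \<Longrightarrow> m \<le> 8 \<Longrightarrow> apex 0 G"
  using planar_le_8_edges[of G] by (simp add: sized_def apex_0)

lemma listed_np7_9:
  assumes s: "sized 7 9 0 9 G" and ap: "\<not> apex 0 G"
  shows "listed np7_9 G"
proof -
  note D = sizedD[OF s]
  obtain v where v: "v \<in> verts G" "deg G v \<le> 2" using sized_low_vertex[OF s] by auto
  \<comment> \<open>Otherwise \<open>reduce\<close> loses an edge and leaves at most eight.\<close>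
  have dv: "deg G v = 0"
  proof (rule ccontr)
    assume nz: "deg G v \<noteq> 0"
    show False
    proof (rule reduce[OF D(1) v ap])
      fix H :: "'a sgraph" assume "finite_sgraph H" "\<not> apex 0 H"
        "card (edges H) \<le> card (edges G) - (if deg G v = 0 then 0 else 1)"
      then show False using planar_le_8_edges[of H] D(3) nz by (simp add: apex_0)
    qed
  qed
  have "\<not> apex 0 (del_verts G {v})" using apex_del_vert_degree_le_1[OF D(1) v(1), of 0] dv ap by auto
  moreover have "sized 6 9 0 9 (del_verts G {v})" by (rule sized_del[OF s v(1) dv]) simp_all
  ultimately have "listed np6_9 (del_verts G {v})" by (intro listed_np6_9)
  from all_ext_step[OF s v(1) dv this np7_9_0_check] show ?thesis .
qed

lemma listed_np7_10:
  assumes s: "sized 7 10 1 9 G" and ap: "\<not> apex 0 G"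
  shows "listed np7_10 G"
proof -
  note D = sizedD[OF s]
  obtain v where v: "v \<in> verts G" "deg G v \<le> 2" "1 \<le> deg G v" using sized_low_vertex[OF s] by auto
  consider "deg G v = 1" | "deg G v = 2" using v by linarith
  then show ?thesis
  proof cases
    case 1
    have "\<not> apex 0 (del_verts G {v})" using apex_del_vert_degree_le_1[OF D(1) v(1), of 0] 1 ap by auto
    moreover have "sized 6 9 0 9 (del_verts G {v})" by (rule sized_del[OF s v(1) 1]) simp_all
    ultimately have "listed np6_9 (del_verts G {v})" by (intro listed_np6_9)
    from all_ext_step[OF s v(1) 1 this np7_10_1_check] show ?thesis .
  next
    case 2
    show ?thesis
    proof (cases rule: deg_2_cases[OF s v(1) 2 ap, case_names smooth ear])
      case (smooth x y)
      from smooth(4) have "sized 6 9 1 9 (smooth G v x y)" by simp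
      from smooth_step[OF s v(1) smooth(1-3) listed_np6_9[OF this smooth(5)] np7_10_s_check] show ?thesis .
    next
      case (ear x y)
      then show ?thesis using not_planar_8[OF ear(4)] by simp
    qed
  qed
qed

lemma listed_np7_11:
  assumes s: "sized 7 11 2 9 G" and ap: "\<not> apex 0 G"
  shows "listed np7_11 G"
proof (cases "\<exists>v\<in>verts G. deg G v = 2")
  case True
  then obtain v where v: "v \<in> verts G" "deg G v = 2" by blast
  show ?thesis
  proof (cases rule: deg_2_cases[OF s v ap, case_names smooth ear])
    case (smooth x y)
    from smooth(4) have "sized 6 10 2 9 (smooth G v x y)" by simp
    then have "sized 6 10 1 9 (smooth G v x y)" by (rule sized_mono) simp_all
    from smooth_step[OF s v(1) smooth(1-3) listed_np6_10[OF this smooth(5)] np7_11_s_check] show ?thesis .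
  next
    case (ear x y)
    from ear(4) have "sized 6 9 1 9 (del_verts G {v})" by simp
    from ear_step[OF s v(1) ear(1-3) listed_np6_9[OF this ear(5)] np7_11_e_check] show ?thesis .
  qed
next
  case False
  then have s3: "sized 7 11 3 9 G" using s by (force simp: sized_def)
  obtain v where v: "v \<in> verts G" and t: "sized 7 11 3 (deg G v) G"
    and d: "2 * 11 \<le> deg G v * 7" "deg G v + 3 * (7 - 1) \<le> 2 * 11"
    by (rule sized_max_deg[OF s3], simp, rule that; assumption)
  have dv: "deg G v = 4" using d by linarith
  have H: "sized 6 7 2 4 (del_verts G {v})" by (rule sized_del[OF t[unfolded dv] v dv]) simp_all
  \<comment> \<open>The degrees add up to 22 = 4 + 6 * 3, so \<open>v\<close> is the only vertex of
    degree four.\<close>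
  have "deg (del_verts G {v}) u \<le> 3" if u: "u \<in> verts (del_verts G {v})" for u
    using deg_sum_lower2[OF s3 v, of u] deg_del_vert_bounds(2)[OF sizedD(1)[OF s] u v] u dv by auto
  then have "sized 6 7 2 3 (del_verts G {v})" using H by (simp add: sized_def)
  from ext_step[OF t[unfolded dv] v dv ap listed_6_7[OF this] np7_11_4_check] show ?thesis .
qed

lemma listed_np8_10:
  assumes s: "sized 8 10 1 9 G" and ap: "\<not> apex 0 G"
  shows "listed np8_10 G"
proof -
  note D = sizedD[OF s]
  obtain v where v: "v \<in> verts G" "deg G v \<le> 2" "1 \<le> deg G v" using sized_low_vertex[OF s] by auto
  consider "deg G v = 1" | "deg G v = 2" using v by linarith
  then show ?thesis
  proof cases
    case 1
    have "\<not> apex 0 (del_verts G {v})" using apex_del_vert_degree_le_1[OF D(1) v(1), of 0] 1 ap by auto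
    moreover have "sized 7 9 0 9 (del_verts G {v})" by (rule sized_del[OF s v(1) 1]) simp_all
    ultimately have "listed np7_9 (del_verts G {v})" by (intro listed_np7_9)
    from all_ext_step[OF s v(1) 1 this np8_10_1_check] show ?thesis .
  next
    case 2
    show ?thesis
    proof (cases rule: deg_2_cases[OF s v(1) 2 ap, case_names smooth ear])
      case (smooth x y)
      from smooth(4) have "sized 7 9 1 9 (smooth G v x y)" by simp
      then show ?thesis using nonplanar_9_edges[of 7 1 9 "smooth G v x y"] smooth(5) by simp
    next
      case (ear x y)
      then show ?thesis using not_planar_8[OF ear(4)] by simp
    qed
  qed
qed

lemma listed_np8_11:
  assumes s: "sized 8 11 2 9 G" and ap: "\<not> apex 0 G"
  shows "listed np8_11 G"
proof -
  obtain v where v: "v \<in> verts G" "deg G v \<le> 2" "2 \<le> deg G v" using sized_low_vertex[OF s] by auto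
  then have dv: "deg G v = 2" by simp
  show ?thesis
  proof (cases rule: deg_2_cases[OF s v(1) dv ap, case_names smooth ear])
    case (smooth x y)
    from smooth(4) have "sized 7 10 2 9 (smooth G v x y)" by simp
    then have "sized 7 10 1 9 (smooth G v x y)" by (rule sized_mono) simp_all
    from smooth_step[OF s v(1) smooth(1-3) listed_np7_10[OF this smooth(5)] np8_11_s_check] show ?thesis .
  next
    case (ear x y)
    from ear(4) have "sized 7 9 1 9 (del_verts G {v})" by simp
    then show ?thesis using nonplanar_9_edges[of 7 1 9 "del_verts G {v}"] ear(5) by simp
  qed
qed

lemma listed_np8_12:
  assumes s: "sized 8 12 2 4 G" and ap: "\<not> apex 0 G"
  shows "listed np8_12 G"
proof (cases "\<exists>v\<in>verts G. deg G v = 2")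
  case True
  then obtain v where v: "v \<in> verts G" "deg G v = 2" by blast
  show ?thesis
  proof (cases rule: deg_2_cases[OF s v ap, case_names smooth ear])
    case (smooth x y)
    from smooth(4) have "sized 7 11 2 4 (smooth G v x y)" by simp
    then have "sized 7 11 2 9 (smooth G v x y)" by (rule sized_mono) simp_all
    from smooth_step[OF s v(1) smooth(1-3) listed_np7_11[OF this smooth(5)] np8_12_s_check] show ?thesis .
  next
    case (ear x y)
    from ear(4) have "sized 7 10 1 4 (del_verts G {v})" by simp
    then have "sized 7 10 1 9 (del_verts G {v})" by (rule sized_mono) simp_all
    from ear_step[OF s v(1) ear(1-3) listed_np7_10[OF this ear(5)] np8_12_e_check] show ?thesis .
  qed
next
  case False
  then have s3: "sized 8 12 3 4 G" using s by (force simp: sized_def)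
  obtain v where v: "v \<in> verts G" and t: "sized 8 12 3 (deg G v) G"
    and d: "deg G v + 3 * (8 - 1) \<le> 2 * 12" "3 \<le> deg G v"
    by (rule sized_max_deg[OF s3], simp, rule that; assumption)
  have dv: "deg G v = 3" using d by linarith
  have "sized 7 9 2 3 (del_verts G {v})" by (rule sized_del[OF t[unfolded dv] v dv]) simp_all
  from ext_step[OF t[unfolded dv] v dv ap listed_7_9[OF this] np8_12_3_check] show ?thesis .
qed

lemma listed_np9_12:
  assumes s: "sized 9 12 2 3 G" and ap: "\<not> apex 0 G"
  shows "listed np9_12 G"
proof -
  obtain v where v: "v \<in> verts G" "deg G v \<le> 2" "2 \<le> deg G v" using sized_low_vertex[OF s] by auto
  then have dv: "deg G v = 2" by simp
  show ?thesis
  proof (cases rule: deg_2_cases[OF s v(1) dv ap, case_names smooth ear])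
    case (smooth x y)
    from smooth(4) have "sized 8 11 2 3 (smooth G v x y)" by simp
    then have "sized 8 11 2 9 (smooth G v x y)" by (rule sized_mono) simp_all
    from smooth_step[OF s v(1) smooth(1-3) listed_np8_11[OF this smooth(5)] np9_12_s_check] show ?thesis .
  next
    case (ear x y)
    from ear(4) have "sized 8 10 1 3 (del_verts G {v})" by simp
    then have "sized 8 10 1 9 (del_verts G {v})" by (rule sized_mono) simp_all
    from ear_step[OF s v(1) ear(1-3) listed_np8_10[OF this ear(5)] np9_12_e_check] show ?thesis .
  qed
qed

subsection \<open>Lists of graphs that are not apex\<close>

lemma not_listed_Nil: "\<not> listed [] G"
  by (simp add: listed_def)

lemma apex_mono: "apex k G \<Longrightarrow> k \<le> l \<Longrightarrow> apex l G"
  unfolding apex_def using le_trans by blast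

text \<open>A counterexample with fewest vertices has minimum degree three, hence at most nine
  vertices. Deleting a vertex of largest degree leaves a nonplanar graph, thus at least nine edges,
  and few parameters remain. The bound is sharp because of the Petersen family.\<close>

lemma apex_1_le_14_edges:
  assumes "finite_sgraph G" "card (edges G) \<le> 14"
  shows "apex 1 G"
  using assms
proof (induction "card (verts G)" arbitrary: G rule: less_induct)
  case less
  show ?case
  proof (rule ccontr)
    assume ap: "\<not> apex 1 G"
    define n m where "n = card (verts G)" and "m = card (edges G)"
    have m: "m \<le> 14" using less.prems by (simp add: m_def)
    have s: "sized n m 0 n G" using deg_less[OF less.prems(1)] less.prems(1) by (auto simp: sized_def n_def m_def intro: less_imp_le)
    have "verts G \<noteq> {}"
    proof
      assume "verts G = {}"
      then have "planar G" using planar_5_9[of G] s sizedD(3)[OF s] sum_deg[OF less.prems(1)] less.prems(1) by simp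
      then show False using ap apex_mono[of 0 G 1] by (simp add: apex_0)
    qed
    then have n0: "0 < n" using finite_sgraph_edgesD(1)[OF less.prems(1)] by (simp add: n_def card_gt_0_iff)
    have s3: "sized n m 3 n G"
    proof (rule min_deg_3[OF s ap])
      fix H :: "'a sgraph" assume "finite_sgraph H" "card (verts H) = n - 1" "card (edges H) \<le> m - (if 0 = (0::nat) then 0 else 1)"
      then show "apex 1 H" using less.hyps[of H] m n0 by (simp add: n_def)
    qed
    obtain v where v: "v \<in> verts G" and t: "sized n m 3 (deg G v) G"
      and d: "2 * m \<le> deg G v * n" "deg G v + 3 * (n - 1) \<le> 2 * m" "3 \<le> deg G v" "deg G v < n"
      using sized_max_deg[OF s3 n0] by blast
    have n9: "n \<le> 9" using d m by linarith
    have n4: "4 \<le> n" using d by linarith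
    have H: "sized (n - 1) (m - deg G v) 2 (deg G v) (del_verts G {v})"
      by (rule sized_del[OF t v refl]) simp_all
    have apH: "\<not> apex 0 (del_verts G {v})" using not_apex_del_vert[of 0 G v] ap v by simp
    have mH: "9 \<le> m - deg G v" using not_planar_8[OF H] apH by linarith
    consider "n \<le> 6" | "n = 7" | "n = 8" | "n = 9" using n9 by linarith
    then show False
    proof cases
      case 1
      \<comment> \<open>On at most six vertices the largest degree is at least a third of
        \<open>m\<close>, so at most two thirds of 14 edges survive.\<close>
      have "m - deg G v \<le> 9"
      proof -
        have "2 * m \<le> deg G v * 6" using d(1) 1 mult_le_mono2[OF 1, of "deg G v"] by linarith
        then show ?thesis using m by linarith
      qed
      then show False using planar_5_9[OF sizedD(1)[OF H]] sizedD(2,3)[OF H] 1 apH by (simp add: apex_0)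
    next
      case 2
      have "2 * m \<le> deg G v * 7" using d(1) 2 by simp
      \<comment> \<open>The only solutions of \<open>2 * m \<le> 7 * deg G v\<close> and
        \<open>deg G v + 9 \<le> m \<le> 14\<close>.\<close>
      then consider "deg G v = 4" "m = 13" | "deg G v = 4" "m = 14" | "deg G v = 5" "m = 14"
        using m mH by linarith
      then show False
      proof cases
        case a: 1
        have "sized 6 9 2 4 (del_verts G {v})" using H a 2 by simp
        moreover have "sized 7 13 3 4 G" using t a 2 by simp
        ultimately show False
          using ext_step[OF _ v a(1) ap listed_np6_9[OF _ apH] na7_13_4_check] not_listed_Nil by blast
      next
        case a: 2
        have "sized 6 10 2 4 (del_verts G {v})" using H a 2 by simp
        then have "sized 6 10 1 4 (del_verts G {v})" by (rule sized_mono) simp_all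
        moreover have "sized 7 14 3 4 G" using t a 2 by simp
        ultimately show False
          using ext_step[OF _ v a(1) ap listed_np6_10[OF _ apH] na7_14_4_check] not_listed_Nil by blast
      next
        case a: 3
        have "sized 6 9 2 5 (del_verts G {v})" using H a 2 by simp
        moreover have "sized 7 14 3 5 G" using t a 2 by simp
        ultimately show False
          using ext_step[OF _ v a(1) ap listed_np6_9[OF _ apH] na7_14_5_check] not_listed_Nil by blast
      qed
    next
      case 3
      have "2 * m \<le> deg G v * 8" using d(1) 3 by simp
      then consider "m - deg G v = 9" | "deg G v = 4" "m = 14"
        using m mH by linarith
      then show False
      proof cases
        case a: 1
        have "sized 7 9 2 (deg G v) (del_verts G {v})" using H a 3 by simp
        then show False using nonplanar_9_edges[of 7 2 "deg G v" "del_verts G {v}"] apH by simp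
      next
        case a: 2
        have "sized 7 10 2 4 (del_verts G {v})" using H a 3 by simp
        then have "sized 7 10 1 9 (del_verts G {v})" by (rule sized_mono) simp_all
        moreover have "sized 8 14 3 4 G" using t a 3 by simp
        ultimately show False
          using ext_step[OF _ v a(1) ap listed_np7_10[OF _ apH] na8_14_4_check] not_listed_Nil by blast
      qed
    next
      case 4
      have "2 * m \<le> deg G v * 9" using d(1) 4 by simp
      \<comment> \<open>Minimum degree three on nine vertices forces 14 edges, so the average degree
        exceeds three; a vertex of degree at least four leaves at most ten edges.\<close>
      moreover have "27 \<le> 2 * m" using d 4 by linarith
      ultimately have "m - deg G v \<le> 10" using m by linarith
      moreover have "sized 8 (m - deg G v) 2 (deg G v) (del_verts G {v})" using H 4 by simp
      ultimately show False using nonplanar_10_edges[of 8 "m - deg G v" 2 "deg G v" "del_verts G {v}"] apH by simp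
    qed
  qed
qed

lemma apex_1_sized: "sized n m lo hi G \<Longrightarrow> m \<le> 14 \<Longrightarrow> apex 1 G"
  using apex_1_le_14_edges[of G] by (simp add: sized_def)

lemma min_deg_3_not_apex_1:
  fixes G :: "'a sgraph"
  assumes s: "sized n 15 lo hi G" "0 < lo" and ap: "\<not> apex 1 G"
  shows "sized n 15 3 hi G"
proof (rule min_deg_3[OF s(1) ap])
  fix H :: "'a sgraph" assume "finite_sgraph H" "card (edges H) \<le> 15 - (if lo = 0 then 0 else 1)"
  then show "apex 1 H" using s(2) by (intro apex_1_le_14_edges) auto
qed

lemma listed_na7_15:
  assumes s: "sized 7 15 2 hi G" and ap: "\<not> apex 1 G"
  shows "listed na7_15 G"
proof -
  have s3: "sized 7 15 3 hi G" by (rule min_deg_3_not_apex_1[OF s _ ap]) simp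
  obtain v where v: "v \<in> verts G" and t: "sized 7 15 3 (deg G v) G"
    and d: "2 * 15 \<le> deg G v * 7" "deg G v < 7"
    by (rule sized_max_deg[OF s3], simp, rule that; assumption)
  have apH: "\<not> apex 0 (del_verts G {v})" using not_apex_del_vert[of 0 G v] ap v by simp
  consider "deg G v = 5" | "deg G v = 6" using d by linarith
  then show ?thesis
  proof cases
    case 1
    have "sized 6 10 2 5 (del_verts G {v})" by (rule sized_del[OF t[unfolded 1] v 1]) simp_all
    then have "sized 6 10 1 5 (del_verts G {v})" by (rule sized_mono) simp_all
    from ext_step[OF t[unfolded 1] v 1 ap listed_np6_10[OF this apH] na7_15_5_check] show ?thesis .
  next
    case 2
    have "sized 6 9 2 6 (del_verts G {v})" by (rule sized_del[OF t[unfolded 2] v 2]) simp_all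
    from all_ext_step[OF t[unfolded 2] v 2 listed_np6_9[OF this apH] na7_15_6_check] show ?thesis .
  qed
qed

lemma listed_na8_15:
  assumes s: "sized 8 15 2 hi G" and ap: "\<not> apex 1 G"
  shows "listed na8_15 G"
proof -
  have s3: "sized 8 15 3 hi G" by (rule min_deg_3_not_apex_1[OF s _ ap]) simp
  obtain v where v: "v \<in> verts G" and t: "sized 8 15 3 (deg G v) G"
    and d: "2 * 15 \<le> deg G v * 8" "deg G v < 8"
    by (rule sized_max_deg[OF s3], simp, rule that; assumption)
  have apH: "\<not> apex 0 (del_verts G {v})" using not_apex_del_vert[of 0 G v] ap v by simp
  have H: "sized 7 (15 - deg G v) 2 (deg G v) (del_verts G {v})" by (rule sized_del[OF t v refl]) simp_all
  consider "deg G v = 4" | "deg G v = 5" | "deg G v = 6" | "deg G v = 7" using d by linarith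
  then show ?thesis
  proof cases
    case 1
    have "sized 7 11 2 4 (del_verts G {v})" using H 1 by simp
    then have "sized 7 11 2 9 (del_verts G {v})" by (rule sized_mono) simp_all
    from ext_step[OF t[unfolded 1] v 1 ap listed_np7_11[OF this apH] na8_15_4_check] show ?thesis .
  next
    case 2
    have "sized 7 10 2 5 (del_verts G {v})" using H 2 by simp
    then have "sized 7 10 1 9 (del_verts G {v})" by (rule sized_mono) simp_all
    from ext_step[OF t[unfolded 2] v 2 ap listed_np7_10[OF this apH] na8_15_5_check] show ?thesis .
  next
    case 3
    then show ?thesis using nonplanar_9_edges[of 7 2 6 "del_verts G {v}"] H apH by simp
  next
    case 4
    then show ?thesis using not_planar_8[OF H] apH by simp
  qed
qed

text \<open>Removing a vertex of degree five leaves 11 edges on seven vertices, for which a list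
  exists. Without such a vertex the graph would be 4-regular, and 12 edges would be left.\<close>

lemma listed_na8_16:
  assumes s: "sized 8 16 2 5 G" and ap: "\<not> apex 1 G" and v: "v \<in> verts G" "deg G v = 5"
  shows "listed na8_16 G"
proof (cases "\<exists>v\<in>verts G. deg G v = 2")
  case True
  then obtain w where w: "w \<in> verts G" "deg G w = 2" by blast
  show ?thesis
  proof (cases rule: deg_2_cases[OF s w ap, case_names smooth ear])
    case (smooth x y)
    from smooth(4) have "sized 7 15 2 5 (smooth G w x y)" by simp
    from smooth_step[OF s w(1) smooth(1-3) listed_na7_15[OF this smooth(5)] na8_16_s_check] show ?thesis .
  next
    case (ear x y)
    then show ?thesis using apex_1_sized[OF ear(4)] by simp
  qed
next
  case False
  then have s3: "sized 8 16 3 5 G" using s by (force simp: sized_def)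
  have apH: "\<not> apex 0 (del_verts G {v})" using not_apex_del_vert[of 0 G v] ap v by simp
  have "sized 7 11 2 5 (del_verts G {v})" by (rule sized_del[OF s3 v]) simp_all
  then have "sized 7 11 2 9 (del_verts G {v})" by (rule sized_mono) simp_all
  from ext_step[OF s3 v ap listed_np7_11[OF this apH] na8_16_5_check] show ?thesis .
qed

lemma listed_na9_15:
  assumes s: "sized 9 15 2 hi G" and ap: "\<not> apex 1 G"
  shows "listed na9_15 G"
proof -
  have s3: "sized 9 15 3 hi G" by (rule min_deg_3_not_apex_1[OF s _ ap]) simp
  obtain v where v: "v \<in> verts G" and t: "sized 9 15 3 (deg G v) G"
    and d: "2 * 15 \<le> deg G v * 9" "deg G v < 9"
    by (rule sized_max_deg[OF s3], simp, rule that; assumption)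
  have apH: "\<not> apex 0 (del_verts G {v})" using not_apex_del_vert[of 0 G v] ap v by simp
  have H: "sized 8 (15 - deg G v) 2 (deg G v) (del_verts G {v})" by (rule sized_del[OF t v refl]) simp_all
  show ?thesis
  proof (cases "deg G v = 4")
    case True
    have "sized 8 11 2 4 (del_verts G {v})" using H True by simp
    then have "sized 8 11 2 9 (del_verts G {v})" by (rule sized_mono) simp_all
    from ext_step[OF t[unfolded True] v True ap listed_np8_11[OF this apH] na9_15_4_check] show ?thesis .
  next
    case False
    then have "15 - deg G v \<le> 10" using d by linarith
    from nonplanar_10_edges[OF H _ _ this] apH show ?thesis by simp
  qed
qed

lemma listed_na9_16:
  assumes s: "sized 9 16 2 5 G" and ap: "\<not> apex 1 G"
  shows "listed na9_16 G"
proof (cases "\<exists>v\<in>verts G. deg G v = 2")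
  case True
  then obtain w where w: "w \<in> verts G" "deg G w = 2" by blast
  show ?thesis
  proof (cases rule: deg_2_cases[OF s w ap, case_names smooth ear])
    case (smooth x y)
    from smooth(4) have "sized 8 15 2 5 (smooth G w x y)" by simp
    from smooth_step[OF s w(1) smooth(1-3) listed_na8_15[OF this smooth(5)] na9_16_s_check] show ?thesis .
  next
    case (ear x y)
    then show ?thesis using apex_1_sized[OF ear(4)] by simp
  qed
next
  case False
  then have s3: "sized 9 16 3 5 G" using s by (force simp: sized_def)
  obtain v where v: "v \<in> verts G" and t: "sized 9 16 3 (deg G v) G"
    and d: "2 * 16 \<le> deg G v * 9" "deg G v \<le> 5"
    by (rule sized_max_deg[OF s3], simp, rule that; assumption)
  have apH: "\<not> apex 0 (del_verts G {v})" using not_apex_del_vert[of 0 G v] ap v by simp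
  consider "deg G v = 4" | "deg G v = 5" using d by linarith
  then show ?thesis
  proof cases
    case 1
    have "sized 8 12 2 4 (del_verts G {v})" by (rule sized_del[OF t[unfolded 1] v 1]) simp_all
    from ext_step[OF t[unfolded 1] v 1 ap listed_np8_12[OF this apH] na9_16_4_check] show ?thesis .
  next
    case 2
    have "sized 8 11 2 5 (del_verts G {v})" by (rule sized_del[OF t[unfolded 2] v 2]) simp_all
    then have "sized 8 11 2 9 (del_verts G {v})" by (rule sized_mono) simp_all
    from ext_step[OF t[unfolded 2] v 2 ap listed_np8_11[OF this apH] na9_16_5_check] show ?thesis .
  qed
qed

lemma listed_na10_15:
  assumes s: "sized 10 15 2 3 G" and ap: "\<not> apex 1 G"
  shows "listed na10_15 G"
proof -
  have s3: "sized 10 15 3 3 G" by (rule min_deg_3_not_apex_1[OF s _ ap]) simp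
  obtain v where v: "v \<in> verts G" and d: "3 \<le> deg G v" "deg G v \<le> 3"
    by (rule sized_max_deg[OF s3], simp, rule that; assumption)
  have dv: "deg G v = 3" using d by simp
  have apH: "\<not> apex 0 (del_verts G {v})" using not_apex_del_vert[of 0 G v] ap v by simp
  have "sized 9 12 2 3 (del_verts G {v})" by (rule sized_del[OF s3 v dv]) simp_all
  from ext_step[OF s3 v dv ap listed_np9_12[OF this apH] na10_15_3_check] show ?thesis .
qed

text \<open>Reductions never raise a degree, so the vertices of degree three that survive had degree
  three before. What remains in the end is cubic with at least 15 edges, hence with at least ten
  vertices.\<close>

lemma subcubic_not_apex_1:
  assumes "finite_sgraph G" "\<And>u. u \<in> verts G \<Longrightarrow> deg G u \<le> 3" "\<not> apex 1 G"
  shows "10 \<le> card {u \<in> verts G. deg G u = 3}"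
  using assms
proof (induction "card (verts G)" arbitrary: G rule: less_induct)
  case less
  note G = less.prems(1)
  note fin = finite_sgraph_edgesD(1)[OF G]
  show ?case
  proof (cases "\<exists>v\<in>verts G. deg G v \<le> 2")
    case True
    then obtain v where v: "v \<in> verts G" "deg G v \<le> 2" by blast
    show ?thesis
    proof (rule reduce[OF G v less.prems(3)])
      fix H :: "'a sgraph" assume H: "finite_sgraph H" "\<not> apex 1 H" "card (verts H) = card (verts G) - 1"
        "verts H = verts G - {v}" and le: "\<And>u. u \<in> verts H \<Longrightarrow> deg H u \<le> deg G u"
      have "0 < card (verts G)" using v fin card_gt_0_iff by blast
      moreover have "deg H u \<le> 3" if "u \<in> verts H" for u
        using le[OF that] less.prems(2)[of u] that H(4) by simp
      ultimately have "10 \<le> card {u \<in> verts H. deg H u = 3}" using less.hyps[of H] H(1,2,3) by simp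
      also have "\<dots> \<le> card {u \<in> verts G. deg G u = 3}"
      proof (rule card_mono)
        show "{u \<in> verts H. deg H u = 3} \<subseteq> {u \<in> verts G. deg G u = 3}"
        proof
          fix u assume "u \<in> {u \<in> verts H. deg H u = 3}"
          then show "u \<in> {u \<in> verts G. deg G u = 3}" using le[of u] less.prems(2)[of u] H(4) by simp
        qed
      qed (use fin in simp)
      finally show ?thesis .
    qed
  next
    case False
    then have all: "deg G u = 3" if "u \<in> verts G" for u using less.prems(2)[OF that] that by force
    have "15 \<le> card (edges G)" using apex_1_le_14_edges[OF G] less.prems(3) by linarith
    moreover have "2 * card (edges G) \<le> 3 * card (verts G)" by (rule sum_deg_upper[OF G]) (simp add: all)
    moreover have "{u \<in> verts G. deg G u = 3} = verts G" using all by blast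
    ultimately show ?thesis by simp
  qed
qed

lemma card_deg_3:
  assumes s: "sized n m 2 3 G"
  shows "card {u \<in> verts G. deg G u = 3} + 2 * n = 2 * m"
proof -
  note D = sizedD[OF s]
  have fin: "finite (verts G)" using finite_sgraph_edgesD(1)[OF D(1)] .
  have "2 * m = (\<Sum>u\<in>verts G. deg G u)" using sum_deg[OF D(1)] D(3) by simp
  also have "\<dots> = (\<Sum>u\<in>verts G. 2 + (if deg G u = 3 then 1 else 0))"
  proof (rule sum.cong)
    fix u assume "u \<in> verts G"
    then show "deg G u = 2 + (if deg G u = 3 then 1 else 0)" using D(4)[of u] by auto
  qed simp
  also have "\<dots> = 2 * n + card {u \<in> verts G. deg G u = 3}"
    using fin D(2) by (simp only: sum.distrib) (simp add: sum.If_cases Int_def)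
  finally show ?thesis by simp
qed

text \<open>A subcubic graph that is not apex and has exactly ten vertices of degree three has no ear
  on an edge that meets one of these: removing the ear would leave too few of them.\<close>

lemma ear_deg_2:
  assumes s: "sized n m 2 3 G" and m: "m = n + 5" and N: "neighbours G v = {x, y}" and v: "v \<in> verts G"
    and ap: "\<not> apex 1 (del_verts G {v})"
  shows "deg G x = 2"
proof (rule ccontr)
  assume "deg G x \<noteq> 2"
  note D = sizedD[OF s]
  have fin: "finite (verts G)" using finite_sgraph_edgesD(1)[OF D(1)] .
  have x: "x \<in> verts G" "x \<noteq> v" using neighbours_subset[OF D(1), of v] N by auto
  then have dx: "deg G x = 3" using D(4)[OF x(1)] \<open>deg G x \<noteq> 2\<close> by simp
  let ?H = "del_verts G {v}"
  have H: "deg ?H u \<le> deg G u" if "u \<in> verts ?H" for u using deg_del_vert_bounds(2)[OF D(1) that v] .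
  have "v \<in> neighbours G x" using N neighbours_sym[of v G x] by simp
  then have dHx: "deg ?H x = 2" using deg_del_vert[OF D(1) x(2)] dx by simp
  have "10 \<le> card {u \<in> verts ?H. deg ?H u = 3}"
  proof (rule subcubic_not_apex_1[OF finite_sgraph_del_verts[OF D(1)] _ ap])
    fix u assume "u \<in> verts ?H"
    then show "deg ?H u \<le> 3" using H[of u] D(4)[of u] by simp
  qed
  also have "\<dots> \<le> card ({u \<in> verts G. deg G u = 3} - {x})"
  proof (rule card_mono)
    show "{u \<in> verts ?H. deg ?H u = 3} \<subseteq> {u \<in> verts G. deg G u = 3} - {x}"
    proof
      fix u assume u: "u \<in> {u \<in> verts ?H. deg ?H u = 3}"
      then show "u \<in> {u \<in> verts G. deg G u = 3} - {x}" using H[of u] D(4)[of u] dHx by auto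
    qed
  qed (use fin in simp)
  also have "\<dots> = card {u \<in> verts G. deg G u = 3} - 1" using x dx fin by (simp add: card_Diff_singleton)
  \<comment> \<open>\<open>m = n + 5\<close> makes the number of vertices of degree three in
    \<open>G\<close> exactly ten, but without \<open>x\<close> only nine are available.\<close>
  finally show False using card_deg_3[OF s] m by simp
qed

lemma listed_na11_16:
  assumes s: "sized 11 16 2 3 G" and ap: "\<not> apex 1 G"
  shows "listed na11_16 G"
proof -
  obtain v where v: "v \<in> verts G" "deg G v \<le> 2" "2 \<le> deg G v" using sized_low_vertex[OF s] by auto
  then have dv: "deg G v = 2" by simp
  show ?thesis
  proof (cases rule: deg_2_cases[OF s v(1) dv ap, case_names smooth ear])
    case (smooth x y)
    from smooth(4) have "sized 10 15 2 3 (smooth G v x y)" by simp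
    from smooth_step[OF s v(1) smooth(1-3) listed_na10_15[OF this smooth(5)] na11_16_s_check] show ?thesis .
  next
    case (ear x y)
    then show ?thesis using apex_1_sized[OF ear(4)] by simp
  qed
qed

text \<open>By \<open>ear_deg_2\<close> an ear would have both ends of degree two. Together with
  \<open>v\<close> these are three vertices outside the cubic ones, which leaves nine places for
  ten.\<close>

lemma listed_na12_17:
  assumes s: "sized 12 17 2 3 G" and ap: "\<not> apex 1 G"
  shows "listed na12_17 G"
proof -
  note D = sizedD[OF s]
  obtain v where v: "v \<in> verts G" "deg G v \<le> 2" "2 \<le> deg G v" using sized_low_vertex[OF s] by auto
  then have dv: "deg G v = 2" by simp
  show ?thesis
  proof (cases rule: deg_2_cases[OF s v(1) dv ap, case_names smooth ear])
    case (smooth x y)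
    from smooth(4) have "sized 11 16 2 3 (smooth G v x y)" by simp
    from smooth_step[OF s v(1) smooth(1-3) listed_na11_16[OF this smooth(5)] na12_17_s_check] show ?thesis .
  next
    case (ear x y)
    have N': "neighbours G v = {y, x}" using ear(1) by auto
    have fin: "finite (verts G)" using finite_sgraph_edgesD(1)[OF D(1)] .
    have d: "deg G x = 2" "deg G y = 2"
      using ear_deg_2[OF s _ ear(1) v(1) ear(5)] ear_deg_2[OF s _ N' v(1) ear(5)] by simp_all
    have xy: "x \<in> verts G" "y \<in> verts G" "x \<noteq> v" "y \<noteq> v" using neighbours_subset[OF D(1), of v] ear(1) by auto
    have "{u \<in> verts G. deg G u = 3} \<subseteq> verts G - {v, x, y}" using d dv by auto
    then have "card {u \<in> verts G. deg G u = 3} \<le> card (verts G - {v, x, y})" using fin by (intro card_mono) auto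
    also have "\<dots> = 9" using v(1) xy ear(2) fin D(2) by (simp add: card_Diff_subset)
    finally show ?thesis using card_deg_3[OF s] by simp
  qed
qed

text \<open>With one vertex more an ear becomes possible: \<open>v\<close>, \<open>x\<close>,
  \<open>y\<close> form a separate triangle, and the other ten vertices carry a graph listed in
  \<open>na10_15\<close>.\<close>

lemma listed_na13_18:
  assumes s: "sized 13 18 2 3 G" and ap: "\<not> apex 1 G"
  shows "listed na13_18 G"
proof -
  note D = sizedD[OF s]
  obtain v where v: "v \<in> verts G" "deg G v \<le> 2" "2 \<le> deg G v" using sized_low_vertex[OF s] by auto
  then have dv: "deg G v = 2" by simp
  show ?thesis
  proof (cases rule: deg_2_cases[OF s v(1) dv ap, case_names smooth ear])
    case (smooth x y)
    from smooth(4) have "sized 12 17 2 3 (smooth G v x y)" by simp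
    from smooth_step[OF s v(1) smooth(1-3) listed_na12_17[OF this smooth(5)] na13_18_s_check] show ?thesis .
  next
    case (ear x y)
    have N': "neighbours G v = {y, x}" using ear(1) by auto
    have d: "deg G x = 2" "deg G y = 2"
      using ear_deg_2[OF s _ ear(1) v(1) ear(5)] ear_deg_2[OF s _ N' v(1) ear(5)] by simp_all
    have xy: "x \<in> verts G" "y \<in> verts G" "x \<noteq> v" "y \<noteq> v" using neighbours_subset[OF D(1), of v] ear(1) by auto
    have Nx: "neighbours G x = {v, y}"
    proof (rule card_subset_eq[symmetric])
      show "{v, y} \<subseteq> neighbours G x" using ear(1,3) neighbours_sym[of v G x] by (auto simp: neighbours_def)
    qed (use finite_neighbours[OF D(1)] d(1) xy in auto)
    have Ny: "neighbours G y = {v, x}"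
    proof (rule card_subset_eq[symmetric])
      show "{v, x} \<subseteq> neighbours G y" using ear(1,3) neighbours_sym[of v G y] by (auto simp: neighbours_def insert_commute)
    qed (use finite_neighbours[OF D(1)] d(2) xy in auto)
    \<comment> \<open>The triangle is removed vertex by vertex, at degrees 2, 1 and 0. In between
      its remains have degree below two, so the lower bound drops to 0 and is restored for
      \<open>?H3\<close>.\<close>
    let ?H1 = "del_verts G {v}" let ?H2 = "del_verts ?H1 {x}" let ?H3 = "del_verts ?H2 {y}"
    have dx: "deg ?H1 x = 1" using Nx xy ear(2) by (simp add: neighbours_del_verts card_insert_if)
    have dy: "deg ?H2 y = 0" using Ny xy ear(2) by (simp add: neighbours_del_verts)
    have V1: "x \<in> verts ?H1" and V2: "y \<in> verts ?H2" using xy ear(2) by auto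
    have H1: "sized 12 16 0 3 ?H1" by (rule sized_del[OF sized_mono[OF s, of 0 3] v(1) dv]) simp_all
    have H2: "sized 11 15 0 3 ?H2" by (rule sized_del[OF H1 V1 dx]) simp_all
    have H3: "sized 10 15 0 3 ?H3" by (rule sized_del[OF H2 V2 dy]) simp_all
    have "deg ?H2 y \<le> 1" using dy by simp
    note step1 = apex_del_vert_degree_le_1[OF sizedD(1)[OF H1] V1 eq_refl[OF dx], of 1]
      and step2 = apex_del_vert_degree_le_1[OF sizedD(1)[OF H2] V2 this, of 1]
    have ap2: "\<not> apex 1 ?H2" using step1 ear(5) by argo
    have ap3: "\<not> apex 1 ?H3" using step2 ap2 by argo
    have "2 \<le> deg ?H3 u" if u: "u \<in> verts ?H3" for u
    proof -
      have u': "u \<in> verts G" "u \<noteq> v" "u \<noteq> x" "u \<noteq> y" using u by auto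
      then have "v \<notin> neighbours G u" "x \<notin> neighbours G u" "y \<notin> neighbours G u"
        using ear(1) Nx Ny neighbours_sym[of _ G u] by auto
      then have "neighbours ?H3 u = neighbours G u" using u' by (auto simp: neighbours_del_verts)
      then show ?thesis using D(4)[OF u'(1)] by simp
    qed
    then have "sized 10 15 2 3 ?H3" using H3 by (simp add: sized_def)
    from all_ext_step[OF H2 V2 dy listed_na10_15[OF this ap3] na11_15_0_check] have "listed na11_15 ?H2" .
    from all_ext_step[OF H1 V1 dx this na12_16_1_check] have l1: "listed na12_16 ?H1" .
    have "sized 13 18 0 3 G" using s by (rule sized_mono) simp_all
    from all_ext_step[OF this v(1) dv l1 na13_18_2_check] show ?thesis .
  qed
qed

subsection \<open>Graphs with 21 edges that are not 2-apex\<close>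

lemma not_apex_1_del_vert: "\<not> apex 2 G \<Longrightarrow> v \<in> verts G \<Longrightarrow> \<not> apex 1 (del_verts G {v})"
  using not_apex_del_vert[of 1 G v] by (simp add: numeral_2_eq_2)

lemma listed_n2a8:
  assumes s: "sized 8 21 3 hi G" and ap: "\<not> apex 2 G"
  shows "listed n2a8 G"
proof -
  obtain v where v: "v \<in> verts G" and t: "sized 8 21 3 (deg G v) G"
    and d: "2 * 21 \<le> deg G v * 8" "deg G v < 8"
    by (rule sized_max_deg[OF s], simp, rule that; assumption)
  note apH = not_apex_1_del_vert[OF ap v]
  \<comment> \<open>A vertex of degree seven leaves 14 edges, always a 1-apex graph.\<close>
  have "deg G v \<noteq> 7"
  proof
    assume dv: "deg G v = 7"
    have "sized 7 14 2 7 (del_verts G {v})" by (rule sized_del[OF t[unfolded dv] v dv]) simp_all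
    then show False using apex_1_sized apH by blast
  qed
  then have dv: "deg G v = 6" using d by linarith
  have "sized 7 15 2 6 (del_verts G {v})" by (rule sized_del[OF t[unfolded dv] v dv]) simp_all
  from ext_step[OF t[unfolded dv] v dv ap listed_na7_15[OF this apH] n2a8_6_check] show ?thesis .
qed

text \<open>At least six vertices have degree five, as 42 = 4 * 9 + 6. If they were pairwise
  adjacent they would be a component \<open>K_6\<close>, and the other three vertices would have
  degree at most two.\<close>

lemma nonadjacent_deg_5:
  assumes s: "sized 9 21 3 5 G"
  obtains a b where "a \<in> verts G" "b \<in> verts G" "a \<noteq> b" "b \<notin> neighbours G a" "deg G a = 5" "deg G b = 5"
proof -
  note D = sizedD[OF s]
  have fin: "finite (verts G)" using finite_sgraph_edgesD(1)[OF D(1)] .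
  define F where "F = {u \<in> verts G. deg G u = 5}"
  have F: "F \<subseteq> verts G" "finite F" unfolding F_def using fin by auto
  have cF: "(\<Sum>u\<in>verts G. if deg G u = 5 then 1 else 0) = card F"
    unfolding F_def card_eq_sum by (rule sum.inter_filter[OF fin, symmetric])
  have "2 * 21 = (\<Sum>u\<in>verts G. deg G u)" using sum_deg[OF D(1)] D(3) by simp
  also have "\<dots> \<le> (\<Sum>u\<in>verts G. 4 + (if deg G u = 5 then 1 else 0))"
  proof (rule sum_mono)
    fix u assume "u \<in> verts G"
    then show "deg G u \<le> 4 + (if deg G u = 5 then 1 else 0)" using D(4)[of u] by auto
  qed
  also have "\<dots> = 36 + card F"
    unfolding sum.distrib cF using D(2) by simp
  finally have F6: "6 \<le> card F" by linarith
  have "\<exists>a\<in>F. \<exists>b\<in>F. a \<noteq> b \<and> b \<notin> neighbours G a"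
  proof (rule ccontr)
    assume "\<not> ?thesis"
    then have no: "\<forall>a\<in>F. \<forall>b\<in>F. a \<noteq> b \<longrightarrow> b \<in> neighbours G a" by auto
    have NF: "neighbours G a = F - {a}" and F6': "card F = 6" if a: "a \<in> F" for a
    proof -
      have sub: "F - {a} \<subseteq> neighbours G a"
      proof
        fix b assume "b \<in> F - {a}"
        then show "b \<in> neighbours G a" using bspec[OF bspec[OF no a], of b] by auto
      qed
      have da: "deg G a = 5" using a by (simp add: F_def)
      have "card (F - {a}) \<le> 5" using card_mono[OF finite_neighbours[OF D(1)] sub] da by simp
      then show c: "card F = 6" using F6 a F(2) by (simp add: card_Diff_singleton)
      show "neighbours G a = F - {a}"
        using card_subset_eq[OF finite_neighbours[OF D(1)] sub] da c a F(2) by (simp add: card_Diff_singleton)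
    qed
    obtain a where "a \<in> F" using F6 by fastforce
    then have "card F = 6" using F6' by blast
    then have rest: "card (verts G - F) = 3" using D(2) F fin by (simp add: card_Diff_subset)
    then have "verts G - F \<noteq> {}" by (metis card.empty zero_neq_numeral)
    then obtain w where w: "w \<in> verts G - F" by blast
    have "neighbours G w \<subseteq> verts G - F - {w}"
    proof
      fix u assume u: "u \<in> neighbours G w"
      then have "w \<in> neighbours G u" using neighbours_sym[of u G w] by simp
      then have "u \<notin> F" using NF[of u] w by blast
      then show "u \<in> verts G - F - {w}" using u neighbours_subset[OF D(1), of w] by blast
    qed
    then have "deg G w \<le> card (verts G - F - {w})" using fin by (intro card_mono) auto
    also have "\<dots> = 2" using rest w fin by (simp add: card_Diff_singleton)
    finally show False using D(4)[of w] w by simp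
  qed
  then show thesis using that unfolding F_def by blast
qed

lemma listed_n2a9:
  assumes s: "sized 9 21 3 hi G" and ap: "\<not> apex 2 G"
  shows "listed n2a9 G"
proof -
  obtain v where v: "v \<in> verts G" and t: "sized 9 21 3 (deg G v) G"
    and d: "2 * 21 \<le> deg G v * 9" "deg G v < 9"
    by (rule sized_max_deg[OF s], simp, rule that; assumption)
  note apH = not_apex_1_del_vert[OF ap v]
  have H: "sized 8 (21 - deg G v) 2 (deg G v) (del_verts G {v})" by (rule sized_del[OF t v refl]) simp_all
  consider "deg G v = 5" | "deg G v = 6" | "7 \<le> deg G v" using d by linarith
  then show ?thesis
  proof cases
    case 1
    \<comment> \<open>Instead of \<open>v\<close> the vertex \<open>a\<close> is removed:
      \<open>b\<close> then still has degree five, as \<open>listed_na8_16\<close> demands.\<close>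
    obtain a b where ab: "a \<in> verts G" "b \<in> verts G" "a \<noteq> b" "b \<notin> neighbours G a" "deg G a = 5" "deg G b = 5"
      by (rule nonadjacent_deg_5[OF t[unfolded 1]])
    have H: "sized 8 16 2 5 (del_verts G {a})" by (rule sized_del[OF t[unfolded 1] ab(1,5)]) simp_all
    have "a \<notin> neighbours G b" using ab(4) neighbours_sym[of a G b] by simp
    then have b: "deg (del_verts G {a}) b = 5" "b \<in> verts (del_verts G {a})"
      using deg_del_vert[OF sizedD(1)[OF s], of b a] ab by auto
    from ext_step[OF t[unfolded 1] ab(1,5) ap listed_na8_16[OF H not_apex_1_del_vert[OF ap ab(1)] b(2,1)] n2a9_5_check]
    show ?thesis .
  next
    case 2
    have "sized 8 15 2 6 (del_verts G {v})" by (rule sized_del[OF t[unfolded 2] v 2]) simp_all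
    from ext_step[OF t[unfolded 2] v 2 ap listed_na8_15[OF this apH] n2a9_6_check] show ?thesis .
  next
    case 3
    then have "21 - deg G v \<le> 14" by linarith
    from apex_1_sized[OF H this] apH show ?thesis by simp
  qed
qed

lemma listed_n2a10:
  assumes s: "sized 10 21 3 hi G" and ap: "\<not> apex 2 G"
  shows "listed n2a10 G"
proof -
  obtain v where v: "v \<in> verts G" and t: "sized 10 21 3 (deg G v) G"
    and d: "2 * 21 \<le> deg G v * 10" "deg G v < 10"
    by (rule sized_max_deg[OF s], simp, rule that; assumption)
  note apH = not_apex_1_del_vert[OF ap v]
  have H: "sized 9 (21 - deg G v) 2 (deg G v) (del_verts G {v})" by (rule sized_del[OF t v refl]) simp_all
  consider "deg G v = 5" | "deg G v = 6" | "7 \<le> deg G v" using d by linarith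
  then show ?thesis
  proof cases
    case 1
    have "sized 9 16 2 5 (del_verts G {v})" by (rule sized_del[OF t[unfolded 1] v 1]) simp_all
    from ext_step[OF t[unfolded 1] v 1 ap listed_na9_16[OF this apH] n2a10_5_check] show ?thesis .
  next
    case 2
    have "sized 9 15 2 6 (del_verts G {v})" by (rule sized_del[OF t[unfolded 2] v 2]) simp_all
    from ext_step[OF t[unfolded 2] v 2 ap listed_na9_15[OF this apH] n2a10_6_check] show ?thesis .
  next
    case 3
    then have "21 - deg G v \<le> 14" by linarith
    from apex_1_sized[OF H this] apH show ?thesis by simp
  qed
qed

lemma listed_n2a14:
  assumes s: "sized 14 21 3 hi G" and ap: "\<not> apex 2 G"
  shows "listed n2a14 G"
proof -
  obtain v where v: "v \<in> verts G" and t: "sized 14 21 3 (deg G v) G"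
    and d: "deg G v + 3 * (14 - 1) \<le> 2 * 21" "3 \<le> deg G v"
    by (rule sized_max_deg[OF s], simp, rule that; assumption)
  have dv: "deg G v = 3" using d by linarith
  have "sized 13 18 2 3 (del_verts G {v})" by (rule sized_del[OF t[unfolded dv] v dv]) simp_all
  from ext_step[OF t[unfolded dv] v dv ap listed_na13_18[OF this not_apex_1_del_vert[OF ap v]] n2a14_3_check]
  show ?thesis .
qed

subsection \<open>The Heawood family\<close>

definition in_heawood :: "nat list list \<Rightarrow> bool" where
  "in_heawood A \<longleftrightarrow> (\<exists>H\<in>heawood_family. finite_sgraph H \<and> codes A H)"

lemma sgraph_iso_codes:
  assumes G: "finite_sgraph G" "codes A G" and H: "codes A H"
  shows "sgraph_iso G H"
proof -
  obtain f g where f: "coding A G f" and g: "coding A H g" using G(2) H by (auto simp: codes_def)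
  define h where "h = g \<circ> the_inv_into {..<length A} f"
  have "bij_betw h (verts G) (verts H)"
    unfolding h_def using f g by (intro bij_betw_trans[OF bij_betw_the_inv_into]) (auto simp: coding_def)
  moreover have "{u, v} \<in> edges G \<longleftrightarrow> {h u, h v} \<in> edges H" if uv: "u \<in> verts G" "v \<in> verts G" for u v
  proof -
    obtain i where i: "i < length A" "u = f i" by (rule coding_surj[OF f uv(1)])
    obtain j where j: "j < length A" "v = f j" by (rule coding_surj[OF f uv(2)])
    have "inj_on f {..<length A}" using f by (auto simp: coding_def bij_betw_def)
    then have "h u = g i" "h v = g j" using i j by (simp_all add: h_def the_inv_into_f_f)
    then show ?thesis using f g i j by (simp add: coding_def)
  qed
  ultimately show ?thesis unfolding sgraph_iso_def by blast
qed

text \<open>For \<open>a < b < c\<close> the edge \<open>ab\<close> is recorded in entry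
  \<open>b\<close>, the edges \<open>ac\<close> and \<open>bc\<close> in entry \<open>c\<close>. The
  last entry is the new vertex.\<close>

definition to_Y :: "nat list list \<Rightarrow> nat \<Rightarrow> nat \<Rightarrow> nat \<Rightarrow> nat list list" where
  "to_Y A a b c = A[b := removeAll a (A ! b), c := removeAll a (removeAll b (A ! c))] @ [[a, b, c]]"

definition nabla_Y_check where
  "nabla_Y_check A a b c B q \<longleftrightarrow> a < b \<and> b < c \<and> c < length A \<and> a \<in> set (A ! b) \<and> a \<in> set (A ! c) \<and> b \<in> set (A ! c) \<and>
     iso_check (to_Y A a b c) B q"

lemma in_heawood_nabla_Y:
  assumes "in_heawood A" and chk: "nabla_Y_check A a b c B q"
  shows "in_heawood B"
proof -
  obtain H f where H: "H \<in> heawood_family" "finite_sgraph H" and f: "coding A H f"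
    using assms(1) by (auto simp: in_heawood_def codes_def)
  have abc: "a < b" "b < c" "c < length A" "a \<in> set (A ! b)" "a \<in> set (A ! c)" "b \<in> set (A ! c)"
    and iso: "iso_check (to_Y A a b c) B q"
    using chk by (auto simp: nabla_Y_check_def)
  obtain v where v: "v \<notin> verts H"
    using ex_new_if_finite[OF infinite_UNIV_nat finite_sgraph_edgesD(1)[OF H(2)]] by blast
  have inj: "inj_on f {..<length A}" and im: "f ` {..<length A} = verts H"
    using f by (auto simp: coding_def bij_betw_def)
  have ne: "f a \<noteq> f b" "f b \<noteq> f c" "f a \<noteq> f c" using abc(1-3) by (simp_all add: inj_on_eq_iff[OF inj])
  define T where "T = {{f a, f b}, {f b, f c}, {f a, f c}}"
  have T: "T \<subseteq> edges H" using f abc by (auto simp: T_def coding_def adj_def)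
  define H' where "H' = (insert v (verts H), (edges H - T) \<union> {{v, f a}, {v, f b}, {v, f c}})"
  have "nabla_Y H H'"
    unfolding H'_def T_def by (rule nabla_Y.intros) (use ne T v in \<open>auto simp: T_def\<close>)
  then have H': "H' \<in> heawood_family" by (rule heawood_family.nabla_Y[OF H(1)])
  have fV: "f a \<in> verts H" "f b \<in> verts H" "f c \<in> verts H" using im abc(1-3) by auto
  have "v \<noteq> f a" "v \<noteq> f b" "v \<noteq> f c" using fV v by auto
  then have fin: "finite_sgraph H'"
    using H(2) fV by (auto simp: finite_sgraph_def H'_def)
  have v_out: "v \<notin> e" if "e \<in> edges H" for e using finite_sgraph_edgesD(3)[OF H(2) that] v by blast
  have del: "del_verts H' {v} = (verts H, edges H - T)"
    using v v_out by (auto simp: del_verts_def H'_def)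
  have N: "neighbours H' v = {f a, f b, f c}"
    using v_out ne fV v by (auto simp: neighbours_def H'_def doubleton_eq_iff)
  define A' where "A' = A[b := removeAll a (A ! b), c := removeAll a (removeAll b (A ! c))]"
  have len: "length A' = length A" by (simp add: A'_def)
  have "coding A' (del_verts H' {v}) f"
    unfolding coding_def del len
  proof (intro conjI allI impI)
    show "bij_betw f {..<length A} (verts (verts H, edges H - T))" using f by (simp add: coding_def)
    fix i j assume ij: "i < length A" "j < length A"
    have "{f i, f j} \<in> edges H \<longleftrightarrow> adj A i j" using f ij by (simp add: coding_def)
    moreover have "{f i, f j} \<in> T \<longleftrightarrow> {i, j} = {a, b} \<or> {i, j} = {b, c} \<or> {i, j} = {a, c}"
      using inj abc(1-3) ij unfolding T_def by (auto simp: doubleton_eq_iff inj_on_def)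
    moreover have "adj A' i j \<longleftrightarrow> adj A i j \<and> \<not> ({i, j} = {a, b} \<or> {i, j} = {b, c} \<or> {i, j} = {a, c})"
      using abc(1-3) ij by (auto simp: A'_def adj_def nth_list_update doubleton_eq_iff)
    ultimately show "{f i, f j} \<in> edges (verts H, edges H - T) \<longleftrightarrow> adj A' i j" by simp
  qed
  moreover have "set [a, b, c] = {i. i < length A' \<and> f i \<in> neighbours H' v}"
    using inj abc(1-3) unfolding N len by (auto simp: inj_on_def)
  ultimately have "coding (A' @ [[a, b, c]]) H' (f(length A' := v))"
    by (intro coding_add_vertex[OF fin]) (auto simp: H'_def)
  then have "codes (to_Y A a b c) H'" unfolding codes_def to_Y_def A'_def by blast
  then show ?thesis using codes_iso_check[OF _ iso] H' fin unfolding in_heawood_def by blast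
qed

text \<open>A neighbour that was present already is then entered twice, which \<open>adj\<close>
  ignores; this agrees with the convention that no parallel edges arise.\<close>

definition to_nabla :: "nat list list \<Rightarrow> nat \<Rightarrow> nat \<Rightarrow> nat \<Rightarrow> nat list list" where
  "to_nabla A a b c = A[b := a # A ! b, c := a # b # A ! c]"

text \<open>The relabelling \<open>p\<close> moves the vertex of degree three to the end, so that
  its removal amounts to dropping the last entry.\<close>

definition Y_nabla_check where
  "Y_nabla_check A C a b c p B q \<longleftrightarrow> a < b \<and> b < c \<and> c < length C \<and>
     iso_check A (C @ [[a, b, c]]) p \<and> iso_check (to_nabla C a b c) B q"

lemma in_heawood_Y_nabla:
  assumes "in_heawood A" and chk: "Y_nabla_check A C a b c p B q"
  shows "in_heawood B"
proof -
  have abc: "a < b" "b < c" "c < length C" and iso: "iso_check A (C @ [[a, b, c]]) p" "iso_check (to_nabla C a b c) B q"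
    using chk by (auto simp: Y_nabla_check_def)
  let ?n = "length C"
  obtain H where H: "H \<in> heawood_family" "finite_sgraph H" "codes (C @ [[a, b, c]]) H"
    using assms(1) codes_iso_check[OF _ iso(1)] unfolding in_heawood_def by blast
  obtain f where f: "coding (C @ [[a, b, c]]) H f" using H(3) by (auto simp: codes_def)
  have inj: "inj_on f {..<Suc ?n}" and im: "f ` {..<Suc ?n} = verts H"
    using f by (auto simp: coding_def bij_betw_def)
  define v where "v = f ?n"
  have v: "v \<in> verts H" using im by (auto simp: v_def)
  have ne: "distinct [f a, f b, f c]" using abc by (simp add: inj_on_eq_iff[OF inj])
  have "{j. j < Suc ?n \<and> adj (C @ [[a, b, c]]) ?n j} = {a, b, c}"
    using abc by (auto simp: adj_def)
  then have N: "neighbours H v = {f a, f b, f c}"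
    using coding_neighbours[OF H(2) f, of ?n] by (simp add: v_def)
  define T where "T = {{f a, f b}, {f b, f c}, {f a, f c}}"
  define H' where "H' = (verts H - {v}, {e \<in> edges H. v \<notin> e} \<union> T)"
  have "Y_nabla H H'" unfolding H'_def T_def by (rule Y_nabla.intros[OF v ne N])
  then have H': "H' \<in> heawood_family" by (rule heawood_family.Y_nabla[OF H(1)])
  have "f a \<in> verts H - {v}" "f b \<in> verts H - {v}" "f c \<in> verts H - {v}"
    using neighbours_subset[OF H(2), of v] N by auto
  then have fin: "finite_sgraph H'"
    using H(2) ne by (auto simp: finite_sgraph_def H'_def T_def)
  have "coding (to_nabla C a b c) H' f"
    unfolding coding_def
  proof (intro conjI allI impI)
    have "f ` {..<?n} = verts H - {v}"
    proof -
      have "f ` ({..<Suc ?n} - {?n}) = f ` {..<Suc ?n} - f ` {?n}"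
        by (rule inj_on_image_set_diff[OF inj]) auto
      moreover have "{..<Suc ?n} - {?n} = {..<?n}" by auto
      ultimately show ?thesis using im by (simp add: v_def)
    qed
    moreover have "inj_on f {..<?n}" using inj by (rule inj_on_subset) auto
    ultimately show "bij_betw f {..<length (to_nabla C a b c)} (verts H')"
      by (simp add: bij_betw_def to_nabla_def H'_def)
    fix i j assume "i < length (to_nabla C a b c)" "j < length (to_nabla C a b c)"
    then have ij: "i < ?n" "j < ?n" by (simp_all add: to_nabla_def)
    have lt: "a < ?n" "b < ?n" "c < ?n" using abc by auto
    have inj': "f k = f l \<longleftrightarrow> k = l" if "k < ?n" "l < ?n" for k l
      using that by (simp add: inj_on_eq_iff[OF inj])
    have "f i \<noteq> v" "f j \<noteq> v" using inj ij by (auto simp: v_def inj_on_def)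
    then have "{f i, f j} \<in> edges H' \<longleftrightarrow> {f i, f j} \<in> edges H \<or> {f i, f j} \<in> T" by (auto simp: H'_def)
    moreover have "{f i, f j} \<in> edges H \<longleftrightarrow> adj (C @ [[a, b, c]]) i j" using f ij by (simp add: coding_def)
    moreover have "adj (C @ [[a, b, c]]) i j \<longleftrightarrow> adj C i j" using ij by (auto simp: adj_def nth_append)
    moreover have "{f i, f j} \<in> T \<longleftrightarrow> {i, j} = {a, b} \<or> {i, j} = {b, c} \<or> {i, j} = {a, c}"
      using ij lt by (simp add: T_def doubleton_eq_iff inj')
    moreover have "adj (to_nabla C a b c) i j \<longleftrightarrow> adj C i j \<or> {i, j} = {a, b} \<or> {i, j} = {b, c} \<or> {i, j} = {a, c}"
      using abc(1-3) ij by (auto simp: to_nabla_def adj_def nth_list_update doubleton_eq_iff)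
    ultimately show "{f i, f j} \<in> edges H' \<longleftrightarrow> adj (to_nabla C a b c) i j" by simp
  qed
  then have "codes (to_nabla C a b c) H'" unfolding codes_def by blast
  then show ?thesis using codes_iso_check[OF _ iso(2)] H' fin unfolding in_heawood_def by blast
qed

definition K7_code :: "nat list list" where
  "K7_code = [[], [0], [0, 1], [0, 1, 2], [0, 1, 2, 3], [0, 1, 2, 3, 4], [0, 1, 2, 3, 4, 5]]"

lemma codes_K7:
  assumes G: "finite_sgraph G" and n: "card (verts G) = 7"
    and E: "\<And>u v. u \<in> verts G \<Longrightarrow> v \<in> verts G \<Longrightarrow> u \<noteq> v \<Longrightarrow> {u, v} \<in> edges G"
  shows "codes K7_code G"
proof -
  have len: "length K7_code = 7" by (simp add: K7_code_def)
  have all: "\<forall>i\<in>set [0..<7]. \<forall>j\<in>set [0..<7]. adj K7_code i j = (i \<noteq> j)" by code_simp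
  have adj: "adj K7_code i j = (i \<noteq> j)" if "i < 7" "j < 7" for i j
    by (rule bspec[OF bspec[OF all]]) (use that in simp_all)
  obtain g where "bij_betw g (verts G) {0..<7::nat}"
    using ex_bij_betw_finite_nat[OF finite_sgraph_edgesD(1)[OF G]] n by auto
  then obtain f where f: "bij_betw f {0..<7::nat} (verts G)" using bij_betw_inv by blast
  have edge: "{f i, f j} \<in> edges G \<longleftrightarrow> i \<noteq> j" if "i < 7" "j < 7" for i j
  proof (cases "i = j")
    case True
    have "{f i} \<notin> edges G" using finite_sgraph_edgesD(4)[OF G, of "{f i}"] by auto
    then show ?thesis using True by simp
  next
    case False
    then have "f i \<noteq> f j" "f i \<in> verts G" "f j \<in> verts G" using f that by (auto simp: bij_betw_def inj_on_def)
    then show ?thesis using E False by simp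
  qed
  have "coding K7_code G f"
    unfolding coding_def len
  proof (intro conjI allI impI)
    show "bij_betw f {..<7} (verts G)" using f by (simp only: atLeast0LessThan)
    show "{f i, f j} \<in> edges G \<longleftrightarrow> adj K7_code i j" if "i < 7" "j < 7" for i j
      unfolding edge[OF that] adj[OF that] by (rule refl)
  qed
  then show ?thesis unfolding codes_def by blast
qed

lemma in_heawood_K7: "in_heawood K7_code"
proof -
  have "finite_sgraph (complete_graph {0..<7::nat})" by (simp add: finite_sgraph_def complete_graph_def)
  moreover have "codes K7_code (complete_graph {0..<7::nat})"
    by (rule codes_K7[OF calculation]) (auto simp: complete_graph_def)
  ultimately show ?thesis unfolding in_heawood_def using heawood_family.K7 by blast
qed

section \<open>Derivation of the listed graphs from \<open>K_7\<close>\<close>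

lemma heawood_8_1: "in_heawood
     [[], [0], [0], [0], [1, 2, 3], [1, 2, 3, 4], [1, 2, 3, 4, 5], [1, 2, 3, 4, 5, 6]]"
  by (rule in_heawood_nabla_Y[OF in_heawood_K7, where a = 0 and b = 1 and c = 2 and q = "[7, 0, 1, 2, 3, 4, 5, 6]"]) code_simp

lemma heawood_9_1: "in_heawood
     [[], [], [0], [0], [1, 2, 3], [1, 2, 3], [0, 1], [2, 3, 4, 5, 6], [2, 3, 4, 5, 6, 7]]"
  by (rule in_heawood_nabla_Y[OF heawood_8_1, where a = 1 and b = 4 and c = 5 and q = "[0, 8, 2, 3, 4, 5, 1, 6, 7]"]) code_simp

lemma heawood_9_2: "in_heawood
     [[], [0], [0], [0], [1, 2, 3], [1, 2, 3], [4, 5], [1, 2, 3, 6], [1, 2, 3, 4, 5, 7]]"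
  by (rule in_heawood_nabla_Y[OF heawood_8_1, where a = 4 and b = 5 and c = 6 and q = "[0, 1, 2, 3, 4, 5, 8, 6, 7]"]) code_simp

lemma heawood_10_1: "in_heawood
     [[], [], [0], [0], [1, 3], [1, 2, 3], [0, 1], [2, 4], [3, 5, 6, 7], [2, 3, 4, 5, 6, 8]]"
  by (rule in_heawood_nabla_Y[OF heawood_9_1, where a = 2 and b = 4 and c = 7 and q = "[0, 1, 2, 3, 4, 5, 6, 9, 7, 8]"]) code_simp

lemma heawood_10_2: "in_heawood
     [[], [0], [0], [0], [2, 3], [1, 2, 3], [4, 5], [1, 2, 3, 6], [1, 4], [2, 3, 5, 7, 8]]"
  by (rule in_heawood_nabla_Y[OF heawood_9_1, where a = 2 and b = 7 and c = 8 and q = "[1, 6, 4, 5, 2, 7, 9, 8, 0, 3]"]) code_simp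

lemma heawood_10_3: "in_heawood
     [[], [], [0], [0], [1, 2, 3], [1, 2, 3], [0, 1], [2, 3, 4, 5], [6, 7], [2, 3, 4, 5, 8]]"
  by (rule in_heawood_nabla_Y[OF heawood_9_1, where a = 6 and b = 7 and c = 8 and q = "[0, 1, 2, 3, 4, 5, 6, 7, 9, 8]"]) code_simp

text \<open>On no list itself: it leads up to \<open>heawood_12_1\<close> and down to
  \<open>heawood_10_4\<close>.\<close>

lemma heawood_11_1: "in_heawood
     [[], [], [0], [0], [1, 3], [1, 3], [0, 1], [2, 4], [3, 5, 6, 7], [3, 4, 6, 8], [2, 5, 9]]"
  by (rule in_heawood_nabla_Y[OF heawood_10_1, where a = 2 and b = 5 and c = 9 and q = "[0, 1, 2, 3, 4, 5, 6, 7, 8, 9, 10]"]) code_simp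

text \<open>Reached from above: vertex 6 of the graph in \<open>heawood_10_3\<close> is dissolved,
  with \<open>p\<close> placing it last.\<close>

lemma heawood_9_3: "in_heawood
     [[], [0], [0], [0], [1, 2, 3], [1, 2, 3], [0, 1], [2, 3, 4, 5, 6], [2, 3, 4, 5, 6]]"
  by (rule in_heawood_Y_nabla[OF heawood_10_3, where C = "[[], [], [0], [0], [1, 2, 3], [1, 2, 3], [2, 3, 4, 5], [6], [2, 3, 4, 5, 7]]" and a = 0 and b = 1 and c = 7
     and p = "[0, 1, 2, 3, 4, 5, 7, 8, 9, 6]" and q = "[0, 1, 2, 3, 4, 5, 7, 6, 8]"]) code_simp

lemma heawood_12_1: "in_heawood
     [[], [], [0], [0], [1], [1, 3], [0, 1], [2, 4], [3, 5, 6, 7], [6, 8], [2, 5, 9], [3, 4, 9]]"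
  by (rule in_heawood_nabla_Y[OF heawood_11_1, where a = 3 and b = 4 and c = 9 and q = "[0, 1, 2, 3, 4, 5, 6, 7, 8, 9, 10, 11]"]) code_simp

lemma heawood_10_4: "in_heawood
     [[], [0], [0], [0], [2, 3], [1, 3, 4], [1, 4], [2, 5], [2, 3, 6, 7], [0, 3, 4, 6, 7]]"
  by (rule in_heawood_Y_nabla[OF heawood_11_1, where C = "[[], [], [0], [1, 2], [1, 2], [0, 1], [3], [2, 4, 5, 6], [2, 3, 5, 7], [4, 8]]" and a = 0 and b = 6 and c = 9
     and p = "[0, 1, 3, 4, 5, 6, 7, 8, 9, 10, 2]" and q = "[3, 1, 6, 2, 7, 4, 5, 9, 0, 8]"]) code_simp

lemma heawood_13_1: "in_heawood
     [[], [], [0], [0], [1], [1], [0, 1], [2, 4], [6, 7], [6, 8], [2, 5, 9], [3, 4, 9], [3, 5, 8]]"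
  by (rule in_heawood_nabla_Y[OF heawood_12_1, where a = 3 and b = 5 and c = 8 and q = "[0, 1, 2, 3, 4, 5, 6, 7, 8, 9, 10, 11, 12]"]) code_simp

text \<open>A station on the way down from twelve vertices to \<open>heawood_10_5\<close>.\<close>

lemma heawood_11_2: "in_heawood
     [[], [], [0], [1], [1, 2], [0, 1], [0, 3], [2, 4, 5, 6], [5, 7], [0, 4, 6, 8], [2, 3, 8]]"
  by (rule in_heawood_Y_nabla[OF heawood_12_1, where C = "[[], [], [0], [1], [1, 2], [0, 1], [3], [2, 4, 5, 6], [5, 7], [4, 8], [2, 3, 8]]" and a = 0 and b = 6 and c = 9
     and p = "[0, 1, 3, 4, 5, 6, 7, 8, 9, 10, 11, 2]" and q = "[0, 1, 2, 3, 4, 5, 6, 7, 8, 9, 10]"]) code_simp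

lemma heawood_14_1: "in_heawood
     [[], [], [], [0], [3], [1, 2], [0, 1], [2, 4], [3, 5], [6, 7], [0, 2], [1, 4], [8, 9], [10, 11, 12]]"
  by (rule in_heawood_nabla_Y[OF heawood_13_1, where a = 6 and b = 8 and c = 9 and q = "[0, 11, 13, 2, 7, 9, 3, 8, 10, 12, 6, 4, 5, 1]"]) code_simp

lemma heawood_10_5: "in_heawood
     [[], [0], [0], [0], [2, 3], [1, 3, 4], [1, 4], [2, 5], [0, 3, 6, 7], [1, 2, 3, 6, 7]]"
  by (rule in_heawood_Y_nabla[OF heawood_11_2, where C = "[[], [], [0], [1, 2], [0, 1], [0], [2, 3, 4, 5], [4, 6], [0, 3, 5, 7], [2, 7]]" and a = 1 and b = 5 and c = 9
     and p = "[0, 1, 2, 4, 5, 6, 7, 8, 9, 10, 3]" and q = "[0, 2, 4, 5, 1, 9, 3, 7, 8, 6]"]) code_simp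

lemma in_heawood_n2a: "A \<in> set n2a8 \<union> set n2a9 \<union> set n2a10 \<union> set n2a14 \<Longrightarrow> in_heawood A"
  unfolding n2a8_def n2a9_def n2a10_def n2a14_def
    list.set
  by (elim UnE insertE emptyE; simp only: heawood_8_1 heawood_9_1 heawood_9_2 heawood_9_3
    heawood_10_1 heawood_10_2 heawood_10_3 heawood_10_4 heawood_10_5 heawood_14_1)

text \<open>Deleting \<open>v\<close>, or contracting one of its two edges, is a minor step and so
  gives a 2-apex graph; the lemmas on vertices of small degree carry this back to
  \<open>G\<close>.\<close>

lemma MMN2A_min_deg:
  assumes G: "finite_sgraph G" and mm: "MMN2A G" and v: "v \<in> verts G"
  shows "3 \<le> deg G v"
proof (rule ccontr)
  assume "\<not> 3 \<le> deg G v"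
  then have "deg G v \<le> 1 \<or> deg G v = 2" by linarith
  moreover have ap: "\<not> apex 2 G" using mm by (simp add: MMN2A_def N2A_def two_apex_iff)
  have minor: "apex 2 H" if "minor_step G H" for H
  proof -
    have "proper_minor H G" unfolding proper_minor_def using that by (rule tranclp.r_into_trancl)
    then have "\<not> N2A H" by (rule mm[unfolded MMN2A_def, THEN conjunct2, THEN spec, THEN mp])
    then show ?thesis by (simp add: N2A_def two_apex_iff)
  qed
  ultimately show False
  proof (elim disjE)
    assume d: "deg G v \<le> 1"
    show False
      using ap apex_del_vert_degree_le_1[OF G v d minor[OF minor_step.del_vert[OF v]]] by (rule notE)
  next
    assume "deg G v = 2"
    then obtain x y where N: "neighbours G v = {x, y}" "x \<noteq> y" using deg_2_neighbours[OF G] by blast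
    then have "{x, v} \<in> edges G" by (auto simp: neighbours_def insert_commute)
    then have "apex 2 (contract G x v)" by (rule minor[OF minor_step.contract])
    \<comment> \<open>This also holds for adjacent \<open>x\<close> and \<open>y\<close>:
      contraction identifies the parallel edges, and \<open>smooth\<close> inserts an edge that is
      present already.\<close>
    moreover have "contract G x v = smooth G v x y"
      using N by (auto simp: contract_def smooth_def del_verts_def)
    ultimately show False using apex_smooth[OF G v N, of 2] ap by simp
  qed
qed

theorem proposition1p5:
  fixes G :: "'a sgraph"
  assumes "finite_sgraph G"
    and "MMN2A G"
    and "card (edges G) = 21"
    and "card (verts G) \<notin> {11, 12, 13}"
  shows "\<exists>H \<in> heawood_family. sgraph_iso G H"
proof -
  note G = assms(1)
  define n where "n = card (verts G)"
  have ap: "\<not> apex 2 G" using assms(2) by (simp add: MMN2A_def N2A_def two_apex_iff)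
  have s: "sized n 21 3 n G"
    unfolding sized_def n_def
    using G assms(3) MMN2A_min_deg[OF G assms(2)] less_imp_le[OF deg_less[OF G]] by simp
  have "3 * n \<le> 42" using sum_deg_lower[OF G, of 3] sizedD[OF s] by simp
  \<comment> \<open>A simple graph on six or fewer vertices has at most 15 edges.\<close>
  moreover have "42 \<le> (n - 1) * n"
  proof -
    have "deg G u \<le> n - 1" if "u \<in> verts G" for u
      using deg_less[OF G that] by (simp add: n_def)
    then show ?thesis using sum_deg_upper[OF G, of "n - 1"] sizedD(2,3)[OF s] by simp
  qed
  then have "7 \<le> n"
  proof (rule contrapos_pp)
    assume "\<not> 7 \<le> n"
    then have "(n - 1) * n \<le> 5 * 6" by (intro mult_le_mono) auto
    then show "\<not> 42 \<le> (n - 1) * n" by simp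
  qed
  ultimately consider "n = 7" | "n = 8" | "n = 9" | "n = 10" | "n = 14"
    using assms(4) unfolding n_def[symmetric] by force
  then have "\<exists>A. codes A G \<and> in_heawood A"
  proof cases
    case 1
    note s = s[unfolded 1]
    have fin: "finite (verts G)" using finite_sgraph_edgesD(1)[OF G] .
    have "{u, v} \<in> edges G" if uv: "u \<in> verts G" "v \<in> verts G" "u \<noteq> v" for u v
    proof -
      \<comment> \<open>The degrees add up to 42, and each of the other six is at most six; hence
        the graph is complete.\<close>
      have "6 \<le> deg G u"
      proof (rule ccontr)
        assume "\<not> 6 \<le> deg G u"
        have "deg G w \<le> 6" if "w \<in> verts G" for w using deg_less[OF G that] sizedD(2)[OF s] by simp
        then have "(\<Sum>w\<in>verts G - {u}. deg G w) \<le> 6 * card (verts G - {u})"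
          using sum_bounded_above[of "verts G - {u}" "deg G" 6] by (auto simp: mult.commute)
        then show False
          using sum.remove[OF fin uv(1), of "deg G"] sum_deg[OF G] sizedD(2,3)[OF s] \<open>\<not> 6 \<le> deg G u\<close> uv(1) fin
          by (simp add: card_Diff_singleton)
      qed
      then have "neighbours G u = verts G - {u}"
        using neighbours_subset[OF G, of u] fin uv(1) sizedD(2)[OF s]
        by (intro card_seteq) (auto simp: card_Diff_singleton)
      then show ?thesis using uv by (auto simp: neighbours_def)
    qed
    then have "codes K7_code G" by (rule codes_K7[OF G sizedD(2)[OF s]])
    then show ?thesis using in_heawood_K7 by (intro exI conjI)
  next
    case 2
    obtain A where "A \<in> set n2a8" "codes A G"
      using listed_n2a8[OF s[unfolded 2] ap] unfolding listed_def by (elim bexE)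
    moreover have "in_heawood A" by (rule in_heawood_n2a) (use \<open>A \<in> set n2a8\<close> in simp)
    ultimately show ?thesis by (intro exI conjI)
  next
    case 3
    obtain A where "A \<in> set n2a9" "codes A G"
      using listed_n2a9[OF s[unfolded 3] ap] unfolding listed_def by (elim bexE)
    moreover have "in_heawood A" by (rule in_heawood_n2a) (use \<open>A \<in> set n2a9\<close> in simp)
    ultimately show ?thesis by (intro exI conjI)
  next
    case 4
    obtain A where "A \<in> set n2a10" "codes A G"
      using listed_n2a10[OF s[unfolded 4] ap] unfolding listed_def by (elim bexE)
    moreover have "in_heawood A" by (rule in_heawood_n2a) (use \<open>A \<in> set n2a10\<close> in simp)
    ultimately show ?thesis by (intro exI conjI)
  next
    case 5
    obtain A where "A \<in> set n2a14" "codes A G"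
      using listed_n2a14[OF s[unfolded 5] ap] unfolding listed_def by (elim bexE)
    moreover have "in_heawood A" by (rule in_heawood_n2a) (use \<open>A \<in> set n2a14\<close> in simp)
    ultimately show ?thesis by (intro exI conjI)
  qed
  then obtain A where A: "codes A G" "in_heawood A" by (elim exE conjE)
  obtain H where "H \<in> heawood_family" "codes A H" using A(2) unfolding in_heawood_def by (elim bexE conjE)
  then show ?thesis using sgraph_iso_codes[OF G A(1)] by (intro bexI)
qed

end
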